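(* Let $\mathcal P_n$ be the set of probability vectors with $n$ components. Let $p^{(2)},q^{(2)}\in\mathcal P_n$ have full support and let $p^{(1)},q^{(1)}\in\mathcal P_n$. Assume that $p^{(1)}\neq p^{(2)}$. The following conditions are equivalent. (i) For all $\alpha\ge1/2$, $$D_\alpha(p^{(1)}\|p^{(2)})\ge D_\alpha(q^{(1)}\|q^{(2)}),\qquad D_\alpha(p^{(2)}\|p^{(1)})\ge D_\alpha(q^{(2)}\|q^{(1)}).$$ (ii) For all $\varepsilon>0$ there are a stochastic matrix $T_\varepsilon$ and dichotomies $(q_\varepsilon^{(1)},q_\varepsilon^{(2)})$ and $(r_\varepsilon^{(1)},r_\varepsilon^{(2)})$ such that $$\|q^{(k)}-q_\varepsilon^{(k)}\|_1\le\varepsilon\quad\text{and}\quad T_\varepsilon(r_\varepsilon^{(k)}\otimes p^{(k)})=r_\varepsilon^{(k)}\otimes q_\varepsilon^{(k)},\qquad k=1,2.$$ One may choose $r_\varepsilon^{(k)}=\frac1{m+1}\bigoplus_{\ell=0}^m(q_\varepsilon^{(k)})^{\otimes\ell}\otimes(p^{(k)})^{\otimes(m-\ell)}$, $k=1,2$, for sufficiently large $m\in\mathbb N$. (iii) For all $\varepsilon>0$ there is a dichotomy $(q_\varepsilon^{(1)},q_\varepsilon^{(2)})$ with probability vectors in $\mathcal P_n$ such that $\|q^{(k)}-q_\varepsilon^{(k)}\|_1\le\varepsilon$ for $k=1,2$, and for $m\in\mathbb N$ sufficiently large there is a stochastic matrix $T_{\varepsilon,m}$ such that $$T_{\varepsilon,m}(p^{(k)})^{\otimes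 m}=(q_\varepsilon^{(k)})^{\otimes m},\qquad k=1,2.$$ Moreover, in statements (ii) and (iii) one may assume that $q_\varepsilon^{(2)}=q^{(2)}$ for all $\varepsilon>0$.
   Context: A dichotomy is a pair $(p^{(1)},p^{(2)})$ of (finite) probability vectors of the same length with $\operatorname{supp}p^{(1)}\subseteq\operatorname{supp}p^{(2)}$, where $\operatorname{supp}x$ is the set of indices of nonzero entries. $\mathbb N=\{1,2,\ldots\}$; $\otimes$ is the Kronecker product of vectors, $p^{\otimes0}=(1)$; $\oplus$ is concatenation; vectors of different lengths are compared in $\|\cdot\|_1$ after padding with zeros. A stochastic matrix has non-negative entries and columns summing to $1$. For probability vectors $p,q$ of the same length with $I=\operatorname{supp}p$, $J=\operatorname{supp}q$, the Rényi divergences are: $D_\alpha(p\|q)=\frac1{\alpha-1}\log\sum_{i\in I\cap J}p_i^\alpha q_i^{1-\alpha}$ if $\alpha\in(0,1)$ and $I\cap J\ne\emptyset$; $D_1(p\|q)=\sum_{i\in I}p_i\log\frac{p_i}{q_i}$ if $I\subseteq J$; $D_\alpha(p\|q)=\frac1{\alpha-1}\log\sum_{i\in I}p_i^\alpha q_i^{1-\alpha}$ if $\alpha\in(1,\infty)$ and $I\subseteq J$; $D_\infty(p\|q)=\max_{i\in I}\log\frac{p_i}{q_i}$ if $I\subseteq J$; and $D_\alpha(p\|q)=\infty$ otherwise. *)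

theory Defs
  imports Complex_Main "HOL-Library.Extended_Real" "Jordan_Normal_Form.Matrix"
begin

definition prob_vecs :: "nat \<Rightarrow> real vec set" where
  "prob_vecs n = {v \<in> carrier_vec n. (\<forall>i<n. 0 \<le> v $ i) \<and> (\<Sum>i<n. v $ i) = 1}"

definition supp_vec :: "real vec \<Rightarrow> nat set" where
  "supp_vec v = {i. i < dim_vec v \<and> v $ i \<noteq> 0}"

definition dichotomy :: "real vec \<Rightarrow> real vec \<Rightarrow> bool" where
  "dichotomy p1 p2 \<longleftrightarrow>
     (\<exists>d. p1 \<in> prob_vecs d \<and> p2 \<in> prob_vecs d) \<and> supp_vec p1 \<subseteq> supp_vec p2"

text \<open>Stochastic matrices with \<open>nr\<close> rows and \<open>nc\<close> columns; they need not be square.\<close>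

definition stochastic_mats :: "nat \<Rightarrow> nat \<Rightarrow> real mat set" where
  "stochastic_mats nr nc =
     {T \<in> carrier_mat nr nc. (\<forall>i<nr. \<forall>j<nc. 0 \<le> T $$ (i, j)) \<and>
                             (\<forall>j<nc. (\<Sum>i<nr. T $$ (i, j)) = 1)}"

definition kron_vec :: "real vec \<Rightarrow> real vec \<Rightarrow> real vec" (infixr "\<otimes>\<^sub>v" 70) where
  "v \<otimes>\<^sub>v w = vec (dim_vec v * dim_vec w)
                 (\<lambda>i. v $ (i div dim_vec w) * w $ (i mod dim_vec w))"

primrec kron_power :: "real vec \<Rightarrow> nat \<Rightarrow> real vec" where
  "kron_power v 0 = vec 1 (\<lambda>_. 1)"
| "kron_power v (Suc m) = v \<otimes>\<^sub>v kron_power v m"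

definition concat_vec :: "real vec list \<Rightarrow> real vec" where
  "concat_vec vs = foldr append_vec vs vNil"

text \<open>The vector \<open>1/(m+1) (p\<^sup>m, q \<otimes> p\<^sup>m\<^sup>-\<^sup>1, \<dots>, q\<^sup>m)\<close>, with Kronecker powers.\<close>

definition telescope_vec :: "nat \<Rightarrow> real vec \<Rightarrow> real vec \<Rightarrow> real vec" where
  "telescope_vec m q p =
     (1 / (real m + 1)) \<cdot>\<^sub>v
       concat_vec (map (\<lambda>l. kron_power q l \<otimes>\<^sub>v kron_power p (m - l)) [0..<Suc m])"

text \<open>The \<open>\<ell>\<^sub>1\<close>-distance, where the shorter vector is padded with zeros.\<close>

definition l1_dist :: "real vec \<Rightarrow> real vec \<Rightarrow> real" where
  "l1_dist v w =
     (\<Sum>i < max (dim_vec v) (dim_vec w).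
        \<bar>(if i < dim_vec v then v $ i else 0) - (if i < dim_vec w then w $ i else 0)\<bar>)"

text \<open>A single stochastic matrix has to map \<open>a1\<close> to \<open>b1\<close> and \<open>a2\<close> to \<open>b2\<close>. The dimensions
  are part of the condition, because the matrix-vector product is total and yields
  unintended values on vectors of the wrong length.\<close>

definition majorizes :: "real vec \<Rightarrow> real vec \<Rightarrow> real vec \<Rightarrow> real vec \<Rightarrow> bool" where
  "majorizes a1 a2 b1 b2 \<longleftrightarrow>
     dim_vec a1 = dim_vec a2 \<and> dim_vec b1 = dim_vec b2 \<and>
     (\<exists>T \<in> stochastic_mats (dim_vec b1) (dim_vec a1). T *\<^sub>v a1 = b1 \<and> T *\<^sub>v a2 = b2)"

text \<open>The order \<open>\<alpha>\<close> is extended real so that \<open>\<alpha> = \<infinity>\<close> is included. For \<open>\<alpha> \<le> 0\<close> the divergence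
  is not intended to be used (the value is \<open>\<infinity>\<close>). Logarithms are natural.\<close>

definition renyi_div :: "ereal \<Rightarrow> real vec \<Rightarrow> real vec \<Rightarrow> ereal" where
  "renyi_div \<alpha> p q =
     (let I = supp_vec p; J = supp_vec q; a = real_of_ereal \<alpha> in
      if 0 < \<alpha> \<and> \<alpha> < 1 \<and> I \<inter> J \<noteq> {} then
        ereal (1 / (a - 1) * ln (\<Sum>i\<in>I \<inter> J. (p $ i) powr a * (q $ i) powr (1 - a)))
      else if \<alpha> = 1 \<and> I \<subseteq> J then
        ereal (\<Sum>i\<in>I. p $ i * ln (p $ i / q $ i))
      else if 1 < \<alpha> \<and> \<alpha> < \<infinity> \<and> I \<subseteq> J then
        ereal (1 / (a - 1) * ln (\<Sum>i\<in>I. (p $ i) powr a * (q $ i) powr (1 - a)))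
      else if \<alpha> = \<infinity> \<and> I \<subseteq> J then
        ereal (Max ((\<lambda>i. ln (p $ i / q $ i)) ` I))
      else \<infinity>)"

definition renyi_dominates :: "real vec \<Rightarrow> real vec \<Rightarrow> real vec \<Rightarrow> real vec \<Rightarrow> bool" where
  "renyi_dominates p1 p2 q1 q2 \<longleftrightarrow>
     (\<forall>\<alpha> \<ge> ereal (1/2). renyi_div \<alpha> p1 p2 \<ge> renyi_div \<alpha> q1 q2 \<and>
                        renyi_div \<alpha> p2 p1 \<ge> renyi_div \<alpha> q2 q1)"

end

theory Submission
  imports "HOL-Analysis.Function_Topology" "HOL-Analysis.Convex_Euclidean_Space" Defs
begin

unbundle no vec_syntax

text \<open>Everything is expressed through the sums \<open>\<Sum> x\<^sup>\<alpha> y\<^sup>1\<^sup>-\<^sup>\<alpha>\<close>, which are multiplicative under Kronecker products.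
  That (ii) or (iii) implies (i) is the data processing inequality, proved with tangents of the homogeneous
  function \<open>x\<^sup>\<alpha> y\<^sup>1\<^sup>-\<^sup>\<alpha>\<close>, followed by \<open>\<epsilon> \<rightarrow> 0\<close>; the orders \<open>1\<close> and \<open>\<infinity>\<close> are limits.

  For the converse, \<open>q\<^sub>\<epsilon> = (1 - \<delta>) q + \<delta> q'\<close>, for the target dichotomy \<open>(q, q')\<close>, makes every
  inequality strict by convexity. By Strassen's theorem a stochastic matrix from \<open>p\<^sup>m\<close> to \<open>q\<^sub>\<epsilon>\<^sup>m\<close> exists as
  soon as \<open>\<Sum> max 0 (x - t y)\<close> is at least as large for \<open>p\<^sup>m\<close> as for \<open>q\<^sub>\<epsilon>\<^sup>m\<close>, for every threshold \<open>t\<close>. With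
  \<open>t = exp (m \<sigma>)\<close> these are large deviation quantities: Chernoff's bound from above and exponential tilting
  from below compare them near each fixed \<open>\<sigma>\<close> for large \<open>m\<close>, and compactness of the range of relevant \<open>\<sigma>\<close>
  makes the comparison uniform. A telescoping sum turns the power \<open>m + 1\<close> into the catalyst of (ii).\<close>

section \<open>Martingale couplings of finitely supported measures\<close>

text \<open>The order inequalities suffice because hinge sums have to be compared only where
  something is exponentially small. Above \<open>E.slope 1\<close>, the relative entropy of the
  target, the hinge itself decays. Between \<open>E.slope 0\<close> and \<open>E.slope 1\<close> it
  tends to 1, and its complement, a sum of minima, decays. Below \<open>E.slope 0\<close> the excess
  over \<open>1 - t\<close>, in units of \<open>t\<close>, decays, which is the first case with the
  two vectors exchanged. Orders above 1, in (0,1) and below 0 govern these ranges; strictness at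
  order 1 in both directions settles the two borders, strictness at order infinity the far ends.
  Orders from 1/2 on in both directions cover all of them, since reversing a dichotomy turns
  \<alpha> into 1 - \<alpha>. Zeros of \<open>p1\<close> are the obstacle:
  \<open>0 powr a = 0\<close> makes reversed sums finite while the reversed divergence is infinite.
  In that case the reversed hinge of the source stays above a positive constant and wins without any
  inequality at negative orders. Since \<open>p1\<close> differs from \<open>p2\<close>, all source
  divergences are strictly positive, which is what turns mixing into strict inequality; mixing only
  the first vector leaves \<open>q2\<close> exact.\<close>

lemma compact_weights:
  fixes m :: "'a \<Rightarrow> real"
  shows "compact {z. \<forall>j. 0 \<le> z j \<and> z j \<le> m j}"
proof -
  have "compactin (product_topology (\<lambda>_. euclidean) UNIV) (PiE UNIV (\<lambda>j. {0..m j}))"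
    by (subst compactin_PiE) auto
  then have "compact (PiE UNIV (\<lambda>j. {0..m j}))"
    by (simp flip: euclidean_product_topology compactin_euclidean_iff)
  moreover have "PiE UNIV (\<lambda>j. {0..m j}) = {z. \<forall>j. 0 \<le> z j \<and> z j \<le> m j}"
    by auto
  ultimately show ?thesis by simp
qed

lemma continuous_on_weighted_sum:
  fixes c :: "'a \<Rightarrow> real"
  shows "continuous_on S (\<lambda>z :: 'a \<Rightarrow> real. \<Sum>j\<in>J. z j * c j)"
  by (intro continuous_intros continuous_on_subset[OF continuous_on_product_coordinates]) auto

text \<open>The pairs of mass and first moment of sub-masses of \<open>m\<close> form a compact
  convex set, and the right-hand side of \<open>le\<close> is its support function; a point outside
  would be separated by a hyperplane that violates \<open>le\<close>.\<close>

lemma zonotope_membership: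
  fixes m r :: "'a \<Rightarrow> real"
  assumes "finite J" and m: "\<And>j. 0 \<le> m j"
    and le: "\<And>c d. c * v + d * u \<le> (\<Sum>j\<in>J. m j * max 0 (c + d * r j))"
  shows "\<exists>z. (\<forall>j. 0 \<le> z j \<and> z j \<le> m j) \<and> (\<Sum>j\<in>J. z j) = v \<and> (\<Sum>j\<in>J. z j * r j) = u"
proof (rule ccontr)
  let ?W = "{z. \<forall>j. 0 \<le> z j \<and> z j \<le> m j}"
  let ?f = "\<lambda>z. (\<Sum>j\<in>J. z j * 1, \<Sum>j\<in>J. z j * r j)"
  assume neg: "\<not> ?thesis"
  have "compact (?f ` ?W)"
    by (intro compact_continuous_image compact_weights continuous_on_Pair continuous_on_weighted_sum)
  then have cl: "closed (?f ` ?W)" by (rule compact_imp_closed)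
  have cv: "convex (?f ` ?W)"
  proof (rule convexI, clarsimp simp del: mult_1_right)
    fix x y :: "'a \<Rightarrow> real" and a b :: real
    assume h: "\<forall>j. 0 \<le> x j \<and> x j \<le> m j" "\<forall>j. 0 \<le> y j \<and> y j \<le> m j" "0 \<le> a" "0 \<le> b" "a + b = 1"
    have "a * x j + b * y j \<le> a * m j + b * m j" for j
      using h by (intro add_mono mult_left_mono) auto
    then have "a * x j + b * y j \<le> m j" for j
      using h(5) by (metis distrib_right mult_1)
    then have "(\<lambda>j. a * x j + b * y j) \<in> ?W" using h by auto
    moreover have "?f (\<lambda>j. a * x j + b * y j) =
      (a * (\<Sum>j\<in>J. x j * 1) + b * (\<Sum>j\<in>J. y j * 1), a * (\<Sum>j\<in>J. x j * r j) + b * (\<Sum>j\<in>J. y j * r j))"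
      by (simp add: sum.distrib sum_distrib_left algebra_simps)
    ultimately show "(a * (\<Sum>j\<in>J. x j * 1) + b * (\<Sum>j\<in>J. y j * 1),
        a * (\<Sum>j\<in>J. x j * r j) + b * (\<Sum>j\<in>J. y j * r j)) \<in> ?f ` ?W"
      by (intro image_eqI[where x = "\<lambda>j. a * x j + b * y j"]) simp_all
  qed
  have "(v, u) \<notin> ?f ` ?W"
    using neg by (force)
  then obtain cd b where cd: "inner cd (v, u) < b" "\<forall>x\<in>?f ` ?W. b < inner cd x"
    using separating_hyperplane_closed_point[OF cv cl] by blast
  obtain c d where "cd = (c, d)" by (cases cd)
  \<comment> \<open>The sub-mass minimising the functional with coefficients
    \<open>c + d * r j\<close> over the box: full where the coefficient is negative, empty
    elsewhere.\<close>
  define z where "z j = (if c + d * r j < 0 then m j else 0)" for j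
  have "z \<in> ?W" using m by (auto simp: z_def)
  then have "b < inner cd (?f z)" using cd(2) by blast
  also have "inner cd (?f z) = (\<Sum>j\<in>J. z j * (c + d * r j))"
    by (simp add: \<open>cd = _\<close> inner_prod_def sum_distrib_left flip: sum.distrib) (simp add: algebra_simps)
  also have "\<dots> = - (\<Sum>j\<in>J. m j * max 0 (- c + (- d) * r j))"
  proof -
    have "z j * (c + d * r j) = - (m j * max 0 (- c + (- d) * r j))" for j
    proof -
      have "max 0 (- c + (- d) * r j) = (if c + d * r j < 0 then - (c + d * r j) else 0)" by auto
      then show ?thesis by (simp only: z_def) (simp add: algebra_simps)
    qed
    then show ?thesis by (simp only: sum_negf)
  qed
  also have "\<dots> \<le> c * v + d * u" using le[of "-c" "-d"] by simp
  finally show False using cd(1) by (simp add: \<open>cd = _\<close> inner_prod_def)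
qed

text \<open>Minimising the spread of a sub-mass around its mean forces it to fill a window of consecutive ratios.\<close>

lemma concentrated_submass:
  fixes m r :: "'a \<Rightarrow> real"
  assumes J: "finite J" and m: "\<And>j. 0 \<le> m j"
    and le: "\<And>c d. c * v + d * u \<le> (\<Sum>j\<in>J. m j * max 0 (c + d * r j))"
  obtains z where "\<And>j. 0 \<le> z j" "\<And>j. z j \<le> m j" "(\<Sum>j\<in>J. z j) = v" "(\<Sum>j\<in>J. z j * r j) = u"
    "\<And>j k l. \<lbrakk>j \<in> J; k \<in> J; l \<in> J; 0 < z k; 0 < z l; r l < r j; r j < r k\<rbrakk> \<Longrightarrow> z j = m j"
proof -
  let ?V = "{z. \<forall>j. 0 \<le> z j \<and> z j \<le> m j} \<inter> ({z. (\<Sum>j\<in>J. z j * 1) = v} \<inter> {z. (\<Sum>j\<in>J. z j * r j) = u})"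
  let ?c = "\<lambda>z. \<Sum>j\<in>J. z j * (r j)\<^sup>2"
  have "compact ?V"
    by (intro compact_Int_closed compact_weights closed_Int closed_Collect_eq continuous_on_weighted_sum
        continuous_on_const)
  moreover have "?V \<noteq> {}" using zonotope_membership[OF assms] by auto
  ultimately have "\<exists>z\<in>?V. \<forall>y\<in>?V. ?c z \<le> ?c y"
    by (rule continuous_attains_inf) (rule continuous_on_weighted_sum)
  then obtain z where z: "z \<in> ?V" and zmin: "\<forall>y\<in>?V. ?c z \<le> ?c y" ..
  have win: "z j = m j" if h: "j \<in> J" "k \<in> J" "l \<in> J" "0 < z k" "0 < z l" "r l < r j" "r j < r k" for j k l
  proof (rule ccontr)
    assume "z j \<noteq> m j"
    with z have zj: "z j < m j" by (auto simp: order_less_le)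
    \<comment> \<open>Moving mass from \<open>k\<close> and \<open>l\<close> to \<open>j\<close> in
      the proportion \<theta> to 1 - \<theta> preserves total and mean, because \<open>r j\<close>
      is that convex combination of \<open>r k\<close> and \<open>r l\<close>, but strictly lowers
      the second moment.\<close>
    define \<theta> where "\<theta> = (r j - r l) / (r k - r l)"
    have \<theta>: "0 < \<theta>" "\<theta> < 1" using h by (simp_all add: \<theta>_def)
    have "\<theta> * (r k - r l) = r j - r l" using h by (simp add: \<theta>_def)
    then have rj: "r j = \<theta> * r k + (1 - \<theta>) * r l" by (simp add: algebra_simps)
    \<comment> \<open>Small enough for the capacity left at \<open>j\<close> and for the stocks at
      \<open>k\<close> and \<open>l\<close>, of which only the amounts \<theta> e and (1 - \<theta>)
      e are taken.\<close>
    define e where "e = Min {m j - z j, z k, z l}"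
    have e: "0 < e" "e \<le> m j - z j" "e \<le> z k" "e \<le> z l"
      using zj h by (auto simp: e_def)
    define p q where "p = e * \<theta>" and "q = e * (1 - \<theta>)"
    define y where "y = z(j := z j + e, k := z k - p, l := z l - q)"
    have ne: "j \<noteq> k" "j \<noteq> l" "k \<noteq> l" using h by auto
    have S: "(\<Sum>i\<in>J. y i * c i) = (\<Sum>i\<in>J. z i * c i) + e * (c j - \<theta> * c k - (1 - \<theta>) * c l)" for c
    proof -
      have "(\<Sum>i\<in>J. y i * c i) = (\<Sum>i\<in>J. z i * c i + ((if i = j then e * c j else 0)
          + (if i = k then - e * \<theta> * c k else 0) + (if i = l then - e * (1 - \<theta>) * c l else 0)))"
        using ne by (intro sum.cong) (auto simp: y_def p_def q_def algebra_simps)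
      also have "\<dots> = (\<Sum>i\<in>J. z i * c i) + (e * c j + (- e * \<theta> * c k) + (- e * (1 - \<theta>) * c l))"
        using h J by (simp add: sum.distrib)
      finally show ?thesis by (simp add: algebra_simps)
    qed
    have pq: "0 \<le> p" "p \<le> e" "0 \<le> q" "q \<le> e"
      using \<theta> e by (simp_all add: p_def q_def mult_left_le)
    have zi: "0 \<le> z i" "z i \<le> m i" for i using z by auto
    have "0 \<le> y i \<and> y i \<le> m i" for i
      using pq e zi[of j] zi[of k] zi[of l] zi[of i] by (simp add: y_def)
    moreover have "(\<Sum>j\<in>J. y j * 1) = v" using z S[of "\<lambda>_. 1"] by simp
    moreover have "(\<Sum>j\<in>J. y j * r j) = u" using z S[of r] rj by simp
    ultimately have "?c z \<le> ?c y" using zmin by auto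
    then have "0 \<le> e * ((r j)\<^sup>2 - \<theta> * (r k)\<^sup>2 - (1 - \<theta>) * (r l)\<^sup>2)" by (simp add: S)
    also have "(r j)\<^sup>2 - \<theta> * (r k)\<^sup>2 - (1 - \<theta>) * (r l)\<^sup>2 = - (\<theta> * (1 - \<theta>) * (r k - r l)\<^sup>2)"
      unfolding rj by (simp add: power2_eq_square algebra_simps)
    finally have "e * (\<theta> * (1 - \<theta>) * (r k - r l)\<^sup>2) \<le> 0" by simp
    moreover have "0 < e * (\<theta> * (1 - \<theta>) * (r k - r l)\<^sup>2)" using e \<theta> h by (intro mult_pos_pos) auto
    ultimately show False by simp
  qed
  have "\<And>j. 0 \<le> z j" "\<And>j. z j \<le> m j" "(\<Sum>j\<in>J. z j) = v" "(\<Sum>j\<in>J. z j * r j) = u"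
    using z by auto
  then show ?thesis by (rule that) (rule win)
qed

text \<open>The last assumption is convex order on the line, and \<open>K\<close> is a coupling in
  which the mean of \<open>r\<close> given \<open>i\<close> is \<open>s i\<close>. Induction peels
  off the target of largest ratio and serves it by a concentrated sub-mass; the concentration is
  what preserves the hinge inequalities for the remaining targets.\<close>

theorem strassen_coupling:
  fixes m r :: "'a \<Rightarrow> real" and n s :: "'b \<Rightarrow> real"
  assumes "finite B" "B \<noteq> {}" and J: "finite J"
    and "\<And>j. 0 \<le> m j" "\<And>i. i \<in> B \<Longrightarrow> 0 < n i"
    and "sum m J = sum n B" "(\<Sum>j\<in>J. m j * r j) = (\<Sum>i\<in>B. n i * s i)"
    and "\<And>t. (\<Sum>i\<in>B. n i * max 0 (s i - t)) \<le> (\<Sum>j\<in>J. m j * max 0 (r j - t))"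
  shows "\<exists>K. (\<forall>i j. 0 \<le> K i j) \<and> (\<forall>j\<in>J. (\<Sum>i\<in>B. K i j) = m j) \<and>
    (\<forall>i\<in>B. (\<Sum>j\<in>J. K i j) = n i \<and> (\<Sum>j\<in>J. K i j * r j) = n i * s i)"
  using assms(1,2,4-)
proof (induction "card B" arbitrary: B m)
  case 0
  then show ?case by simp
next
  case (Suc N)
  note m = Suc.prems(3) and n = Suc.prems(4) and tot = Suc.prems(5) and mean = Suc.prems(6)
    and hinge = Suc.prems(7)
  show ?case
  proof (cases "\<exists>i. B = {i}")
    case True
    then obtain i where "B = {i}" ..
    then show ?thesis
      using m tot mean by (intro exI[of _ "\<lambda>_. m"]) simp
  next
    case False
    have "Max (s ` B) \<in> s ` B" using Suc.prems by (intro Max_in) auto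
    then obtain b where b: "b \<in> B" "s b = Max (s ` B)" by auto
    define \<rho> where "\<rho> = s b"
    have s_le: "s i \<le> \<rho>" if "i \<in> B" for i
      using Suc.prems b that by (auto simp: \<rho>_def)
    \<comment> \<open>The membership test for mass \<open>n b\<close> and moment
      \<open>n b * \<rho>\<close>: one target term is at most the whole target sum, and each
      function \<open>max 0 (c + d * x)\<close> reduces to hinges.\<close>
    have le: "c * n b + d * (n b * \<rho>) \<le> (\<Sum>j\<in>J. m j * max 0 (c + d * r j))" for c d
    proof -
      have "c * n b + d * (n b * \<rho>) = n b * (c + d * s b)" by (simp add: \<rho>_def algebra_simps)
      also have "\<dots> \<le> n b * max 0 (c + d * s b)"
        using n[OF b(1)] by (intro mult_left_mono) auto
      also have "\<dots> \<le> (\<Sum>i\<in>B. n i * max 0 (c + d * s i))"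
        using Suc.prems(1) b(1) n
        by (intro member_le_sum) (auto intro!: mult_nonneg_nonneg dest: less_imp_le)
      also have "\<dots> \<le> (\<Sum>j\<in>J. m j * max 0 (c + d * r j))"
      proof (cases "d = 0")
        case True
        then show ?thesis using tot by (simp flip: sum_distrib_right)
      next
        case d: False
        let ?t = "- c / d"
        have pos: "max 0 (c + d * x) = d * max 0 (x - ?t)" if "d > 0" for x
          using that by (auto simp: max_def field_simps)
        \<comment> \<open>For \<open>d < 0\<close> the hinge opens to the left. It differs from one
          opening to the right by an affine function, whose sums agree by \<open>tot\<close> and
          \<open>mean\<close>.\<close>
        have neg: "max 0 (c + d * x) = (- d) * max 0 (x - ?t) + (c + d * x)" if "d < 0" for x
          using that by (auto simp: max_def field_simps)
        show ?thesis
        proof (cases "d > 0")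
          case True
          have "(\<Sum>i\<in>B. n i * max 0 (c + d * s i)) = d * (\<Sum>i\<in>B. n i * max 0 (s i - ?t))"
            by (simp add: pos[OF True] sum_distrib_left algebra_simps)
          also have "\<dots> \<le> d * (\<Sum>j\<in>J. m j * max 0 (r j - ?t))"
            using True by (intro mult_left_mono hinge) auto
          also have "\<dots> = (\<Sum>j\<in>J. m j * max 0 (c + d * r j))"
            by (simp add: pos[OF True] sum_distrib_left algebra_simps)
          finally show ?thesis .
        next
          case False
          with d have d: "d < 0" by simp
          have split: "(\<Sum>i\<in>A. w i * max 0 (c + d * x i)) =
              (- d) * (\<Sum>i\<in>A. w i * max 0 (x i - ?t)) + (c * sum w A + d * (\<Sum>i\<in>A. w i * x i))"
            for A :: "'c set" and w x
          proof -
            have "(\<Sum>i\<in>A. w i * max 0 (c + d * x i)) =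
                (\<Sum>i\<in>A. (- d) * (w i * max 0 (x i - ?t)) + (c * w i + d * (w i * x i)))"
              unfolding neg[OF d] by (intro sum.cong refl) (simp only: ring_distribs mult_ac)
            then show ?thesis by (simp only: sum.distrib sum_distrib_left)
          qed
          show ?thesis
            unfolding split tot mean using d by (intro add_right_mono mult_left_mono hinge) auto
        qed
      qed
      finally show ?thesis .
    qed
    obtain z where z0: "\<And>j. 0 \<le> z j" and zm: "\<And>j. z j \<le> m j"
      and zn: "(\<Sum>j\<in>J. z j) = n b" and zr: "(\<Sum>j\<in>J. z j * r j) = n b * \<rho>"
      and win: "\<And>j k l. \<lbrakk>j \<in> J; k \<in> J; l \<in> J; 0 < z k; 0 < z l; r l < r j; r j < r k\<rbrakk> \<Longrightarrow> z j = m j"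
      by (rule concentrated_submass[OF J m le]) blast
    let ?H = "\<lambda>t. \<Sum>j\<in>J. (m j - z j) * max 0 (r j - t)"
    let ?R = "\<lambda>t. \<Sum>i\<in>B - {b}. n i * max 0 (s i - t)"
    define S where "S = r ` {j \<in> J. 0 < z j}"
    have "{j \<in> J. 0 < z j} \<noteq> {}"
    proof
      assume "{j \<in> J. 0 < z j} = {}"
      then have "\<forall>j\<in>J. z j = 0" using z0 by (force simp: order_less_le)
      then show False using zn n[OF b(1)] by simp
    qed
    then have S: "finite S" "S \<noteq> {}" using J by (auto simp: S_def)
    \<comment> \<open>The extreme ratios charged by \<open>z\<close>. By \<open>win\<close> nothing
      of \<open>m\<close> is left over strictly between them.\<close>
    obtain l where l: "l \<in> J" "0 < z l" "r l = Min S" using Min_in[OF S] by (auto simp: S_def)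
    obtain k where k: "k \<in> J" "0 < z k" "r k = Max S" using Max_in[OF S] by (auto simp: S_def)
    have S_bd: "r l \<le> r j \<and> r j \<le> r k" if "j \<in> J" "0 < z j" for j
      using that S l k by (auto simp: S_def)
    have rk: "\<rho> \<le> r k"
    proof -
      have "n b * \<rho> \<le> (\<Sum>j\<in>J. z j * r k)"
        unfolding zr[symmetric] using S_bd z0
        by (intro sum_mono) (metis mult_left_mono mult_zero_left order_less_le order_refl)
      also have "\<dots> = n b * r k" by (simp add: zn flip: sum_distrib_right)
      finally show ?thesis using n[OF b(1)] by simp
    qed
    have nonneg: "0 \<le> ?H t" for t
      using zm by (intro sum_nonneg mult_nonneg_nonneg) auto
    have above: "?R t = 0" if "\<rho> \<le> t" for t
    proof (intro sum.neutral ballI)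
      fix i assume "i \<in> B - {b}"
      then have "s i \<le> t" using s_le[of i] that by simp
      then show "n i * max 0 (s i - t) = 0" by simp
    qed
    have split_B: "(\<Sum>i\<in>B. f i) = f b + (\<Sum>i\<in>B - {b}. f i)" for f :: "'b \<Rightarrow> real"
      using Suc.prems(1) b(1) by (rule sum.remove)
    \<comment> \<open>To the left of the window the hinge is affine on all of \<open>z\<close>, so
      removing \<open>z\<close> lowers the source sum exactly by the hinge term of the removed
      target.\<close>
    have below: "?R t \<le> ?H t" if "t \<le> r l" "t \<le> \<rho>" for t
    proof -
      have "?H t = (\<Sum>j\<in>J. m j * max 0 (r j - t) - (z j * r j - t * z j))"
      proof (rule sum.cong)
        fix j assume "j \<in> J"
        then show "(m j - z j) * max 0 (r j - t) = m j * max 0 (r j - t) - (z j * r j - t * z j)"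
          using z0[of j] S_bd[of j] that by (cases "z j = 0") (auto simp: max_def algebra_simps)
      qed simp
      also have "\<dots> = (\<Sum>j\<in>J. m j * max 0 (r j - t)) - n b * max 0 (s b - t)"
      proof -
        have "max 0 (s b - t) = \<rho> - t" using that by (simp add: \<rho>_def)
        then show ?thesis
          by (simp only: sum_subtractf sum_distrib_left[symmetric] zr zn) (simp add: algebra_simps)
      qed
      finally show ?thesis using hinge[of t] split_B[of "\<lambda>i. n i * max 0 (s i - t)"] by simp
    qed
    have hinge': "?R t \<le> ?H t" for t
    proof -
      consider "\<rho> \<le> t" | "t \<le> r l" "t \<le> \<rho>" | "r l < t" "t < \<rho>" by linarith
      then show ?thesis
      proof cases
        case 1
        then show ?thesis using nonneg above by simp
      next
        case 2
        then show ?thesis by (rule below)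
      next
        case 3
        define C where "C = (\<Sum>j | j \<in> J \<and> r k \<le> r j. m j - z j)"
        define D where "D = (\<Sum>j | j \<in> J \<and> r k \<le> r j. (m j - z j) * r j)"
        \<comment> \<open>At these thresholds only ratios from \<open>r k\<close> on contribute,
          since \<open>\<rho> \<le> r k\<close> and the window is exhausted. The remaining source
          hinge is therefore affine here.\<close>
        have lin: "?H t' = D - t' * C" if "r l \<le> t'" "t' \<le> \<rho>" for t'
        proof -
          have "?H t' = (\<Sum>j\<in>J. if r k \<le> r j then (m j - z j) * (r j - t') else 0)"
          proof (rule sum.cong)
            fix j assume "j \<in> J"
            then show "(m j - z j) * max 0 (r j - t') = (if r k \<le> r j then (m j - z j) * (r j - t') else 0)"
              using that rk win[OF \<open>j \<in> J\<close> k(1) l(1) k(2) l(2)]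
              by (cases "r j \<le> t'") (auto simp: max_def)
          qed simp
          also have "\<dots> = (\<Sum>j | j \<in> J \<and> r k \<le> r j. (m j - z j) * (r j - t'))"
            using J by (simp add: sum.inter_filter)
          also have "\<dots> = D - t' * C"
            by (simp add: C_def D_def sum_distrib_left right_diff_distrib sum_subtractf mult_ac)
          finally show ?thesis .
        qed
        define \<theta> where "\<theta> = (t - r l) / (\<rho> - r l)"
        have \<theta>: "0 \<le> \<theta>" "\<theta> \<le> 1" using 3 by (simp_all add: \<theta>_def)
        have "\<theta> * (\<rho> - r l) = t - r l" using 3 by (simp add: \<theta>_def)
        then have t: "t = (1 - \<theta>) * r l + \<theta> * \<rho>" by (simp add: algebra_simps)
        \<comment> \<open>The remaining target hinge is convex, hence below its chord from
          \<open>r l\<close> to \<rho>; the affine source hinge dominates that chord at both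
          ends.\<close>
        have "max 0 (x - t) \<le> (1 - \<theta>) * max 0 (x - r l) + \<theta> * max 0 (x - \<rho>)" for x
        proof -
          have "x - t = (1 - \<theta>) * (x - r l) + \<theta> * (x - \<rho>)" unfolding t by (simp add: algebra_simps)
          also have "\<dots> \<le> (1 - \<theta>) * max 0 (x - r l) + \<theta> * max 0 (x - \<rho>)"
            using \<theta> by (intro add_mono mult_left_mono) auto
          finally show ?thesis using \<theta> by auto
        qed
        then have "?R t \<le> (\<Sum>i\<in>B - {b}. n i * ((1 - \<theta>) * max 0 (s i - r l) + \<theta> * max 0 (s i - \<rho>)))"
          using n by (intro sum_mono mult_left_mono) (auto dest: less_imp_le)
        also have "\<dots> = (1 - \<theta>) * ?R (r l) + \<theta> * ?R \<rho>"
          by (simp add: sum_distrib_left sum.distrib distrib_left mult_ac)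
        also have "\<dots> \<le> (1 - \<theta>) * ?H (r l) + \<theta> * ?H \<rho>"
          using \<theta> below[of "r l"] 3 nonneg[of \<rho>] above[of \<rho>]
          by (intro add_mono mult_left_mono) auto
        also have "\<dots> = ?H t"
        proof -
          have "?H (r l) = D - r l * C" "?H \<rho> = D - \<rho> * C" "?H t = D - t * C"
            using 3 by (intro lin; simp)+
          then show ?thesis by (simp only:) (simp add: t algebra_simps)
        qed
        finally show ?thesis .
      qed
    qed
    have "\<exists>K. (\<forall>i j. 0 \<le> K i j) \<and> (\<forall>j\<in>J. (\<Sum>i\<in>B - {b}. K i j) = m j - z j) \<and>
      (\<forall>i\<in>B - {b}. (\<Sum>j\<in>J. K i j) = n i \<and> (\<Sum>j\<in>J. K i j * r j) = n i * s i)"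
    proof (rule Suc.hyps(1))
      show "N = card (B - {b})" using Suc.hyps(2) Suc.prems(1) b by simp
      show "B - {b} \<noteq> {}" using False b by auto
      show "(\<Sum>j\<in>J. m j - z j) = sum n (B - {b})"
        using tot zn split_B[of n] by (simp add: sum_subtractf)
      show "(\<Sum>j\<in>J. (m j - z j) * r j) = (\<Sum>i\<in>B - {b}. n i * s i)"
        using mean zr split_B[of "\<lambda>i. n i * s i"] by (simp add: left_diff_distrib sum_subtractf \<rho>_def)
    qed (use Suc.prems(1) zm n hinge' in auto)
    then obtain K where K: "\<forall>i j. 0 \<le> K i j" "\<forall>j\<in>J. (\<Sum>i\<in>B - {b}. K i j) = m j - z j"
      "\<forall>i\<in>B - {b}. (\<Sum>j\<in>J. K i j) = n i \<and> (\<Sum>j\<in>J. K i j * r j) = n i * s i"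
      by blast
    show ?thesis
    proof (intro exI[of _ "K(b := z)"] conjI ballI allI)
      fix j assume "j \<in> J"
      have "(\<Sum>i\<in>B. (K(b := z)) i j) = z j + (\<Sum>i\<in>B - {b}. K i j)"
        by (simp add: split_B)
      then show "(\<Sum>i\<in>B. (K(b := z)) i j) = m j" using K(2) \<open>j \<in> J\<close> by simp
    qed (use K z0 zn zr in \<open>auto simp: \<rho>_def\<close>)
  qed
qed

section \<open>Large deviations for product dichotomies\<close>

text \<open>The exponential of \<alpha> - 1 times the Renyi divergence, wherever that is finite. As
  \<open>0 powr a = 0\<close> even for \<open>a = 0\<close>, only indices charged by both
  contribute: for non-negative weights the value at order 1 is the mass of \<open>x\<close> on the
  support of \<open>y\<close>, and at order 0 the mass of \<open>y\<close> on the support of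
  \<open>x\<close>.\<close>

definition rsum :: "'a set \<Rightarrow> ('a \<Rightarrow> real) \<Rightarrow> ('a \<Rightarrow> real) \<Rightarrow> real \<Rightarrow> real" where
  "rsum I x y \<alpha> = (\<Sum>i\<in>I. x i powr \<alpha> * y i powr (1 - \<alpha>))"

lemma rsum_swap: "rsum I y x \<alpha> = rsum I x y (1 - \<alpha>)"
  by (simp add: rsum_def mult.commute)

lemma rsum_nonneg: "0 \<le> rsum I x y \<alpha>"
  by (simp add: rsum_def sum_nonneg)

text \<open>Chernoff's bound for both tails: where \<open>x < A * y\<close>, the factor
  \<open>(A * y / x) powr h\<close> is at least 1 and turns order \<alpha> into \<alpha> - h; the
  upper tail is symmetric.\<close>

lemma rsum_window:
  assumes "\<And>j. j \<in> J \<Longrightarrow> 0 \<le> x j" "\<And>j. j \<in> J \<Longrightarrow> 0 \<le> y j" "0 < A" "0 < B" "0 < h"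
  shows "rsum J x y \<alpha> \<le>
    (\<Sum>j\<in>J. if A * y j \<le> x j \<and> x j \<le> B * y j then x j powr \<alpha> * y j powr (1 - \<alpha>) else 0)
    + A powr h * rsum J x y (\<alpha> - h) + B powr (- h) * rsum J x y (\<alpha> + h)"
proof -
  have "u powr \<alpha> * v powr (1 - \<alpha>) \<le> (if A * v \<le> u \<and> u \<le> B * v then u powr \<alpha> * v powr (1 - \<alpha>) else 0)
    + A powr h * (u powr (\<alpha> - h) * v powr (1 - (\<alpha> - h)))
    + B powr (- h) * (u powr (\<alpha> + h) * v powr (1 - (\<alpha> + h)))"
    if "0 \<le> u" "0 \<le> v" for u v
  proof (cases "u = 0 \<or> v = 0")
    case True
    then show ?thesis by auto
  next
    case False
    with that have uv: "0 < u" "0 < v" by auto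
    let ?T = "u powr \<alpha> * v powr (1 - \<alpha>)"
    have "A powr h * (u powr (\<alpha> - h) * v powr (1 - (\<alpha> - h))) = (A * v / u) powr h * ?T"
      using uv assms by (simp add: powr_diff powr_add powr_mult powr_divide powr_minus field_simps)
    moreover have "B powr (- h) * (u powr (\<alpha> + h) * v powr (1 - (\<alpha> + h))) = (u / (B * v)) powr h * ?T"
      using uv assms by (simp add: powr_diff powr_add powr_mult powr_divide powr_minus field_simps)
    moreover have "?T \<le> (A * v / u) powr h * ?T" if "u < A * v"
    proof -
      have "1 \<le> (A * v / u) powr h" using that uv assms by (intro ge_one_powr_ge_zero) auto
      then have "1 * ?T \<le> (A * v / u) powr h * ?T" by (intro mult_right_mono) auto
      then show ?thesis by simp
    qed
    moreover have "?T \<le> (u / (B * v)) powr h * ?T" if "B * v < u"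
    proof -
      have "1 \<le> (u / (B * v)) powr h" using that uv assms by (intro ge_one_powr_ge_zero) auto
      then have "1 * ?T \<le> (u / (B * v)) powr h * ?T" by (intro mult_right_mono) auto
      then show ?thesis by simp
    qed
    moreover have "0 \<le> (A * v / u) powr h * ?T" "0 \<le> (u / (B * v)) powr h * ?T" by auto
    ultimately show ?thesis by (smt (verit))
  qed
  then show ?thesis
    using assms unfolding rsum_def sum_distrib_left by (subst sum.distrib[symmetric])+ (auto intro!: sum_mono)
qed

text \<open>Where the excess is positive, \<open>x / (t * y)\<close> is above 1, so multiplying
  \<open>x\<close> by its power with exponent \<beta> - 1 can only enlarge it.\<close>

lemma excess_le_rsum:
  assumes "\<And>j. j \<in> J \<Longrightarrow> 0 \<le> x j" "\<And>j. j \<in> J \<Longrightarrow> 0 < y j" "0 < t" "1 \<le> \<beta>"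
  shows "(\<Sum>j\<in>J. max 0 (x j - t * y j)) \<le> t powr (1 - \<beta>) * rsum J x y \<beta>"
  unfolding rsum_def sum_distrib_left
proof (rule sum_mono)
  fix j assume j: "j \<in> J"
  show "max 0 (x j - t * y j) \<le> t powr (1 - \<beta>) * (x j powr \<beta> * y j powr (1 - \<beta>))"
  proof (cases "t * y j < x j")
    case True
    have y: "0 < y j" using assms j by auto
    then have x: "0 < x j" using True assms(3) by (meson less_trans mult_pos_pos)
    have "t powr (1 - \<beta>) * (x j powr \<beta> * y j powr (1 - \<beta>)) = (x j / (t * y j)) powr (\<beta> - 1) * x j"
      using x y assms(3) by (simp add: powr_diff powr_mult powr_divide field_simps)
    moreover have "1 \<le> (x j / (t * y j)) powr (\<beta> - 1)"
      using True y assms by (intro ge_one_powr_ge_zero) auto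
    then have "1 * x j \<le> (x j / (t * y j)) powr (\<beta> - 1) * x j"
      using x by (intro mult_right_mono) auto
    moreover have "0 \<le> t * y j" using y assms(3) by auto
    moreover have "max 0 (x j - t * y j) = x j - t * y j" using True by simp
    ultimately show ?thesis by linarith
  qed auto
qed

text \<open>A minimum of two numbers lies below each of their weighted geometric means.\<close>

lemma overlap_le_rsum:
  assumes "\<And>j. j \<in> J \<Longrightarrow> 0 \<le> x j" "\<And>j. j \<in> J \<Longrightarrow> 0 \<le> y j" "0 < t" "0 \<le> \<beta>" "\<beta> \<le> 1"
  shows "(\<Sum>j\<in>J. min (x j) (t * y j)) \<le> t powr (1 - \<beta>) * rsum J x y \<beta>"
  unfolding rsum_def sum_distrib_left
proof (rule sum_mono)
  fix j assume j: "j \<in> J"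
  show "min (x j) (t * y j) \<le> t powr (1 - \<beta>) * (x j powr \<beta> * y j powr (1 - \<beta>))"
  proof (cases "x j = 0 \<or> y j = 0")
    case True
    then show ?thesis by (auto simp: min_def)
  next
    case False
    then have xy: "0 < x j" "0 < y j" using assms(1,2)[OF j] by auto
    let ?z = "min (x j) (t * y j)"
    have z: "0 < ?z" using xy assms(3) by simp
    have "?z = ?z powr \<beta> * ?z powr (1 - \<beta>)" using z by (simp flip: powr_add)
    also have "\<dots> \<le> x j powr \<beta> * (t * y j) powr (1 - \<beta>)"
      using z assms by (intro mult_mono powr_mono2) auto
    finally show ?thesis by (simp add: powr_mult mult_ac)
  qed
qed

section \<open>Cumulant generating functions and exponential tilting\<close>

locale divergence_pair =
  fixes I :: "'a set" and x y :: "'a \<Rightarrow> real"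
  assumes finite_I: "finite I"
    and x_nonneg: "i \<in> I \<Longrightarrow> 0 \<le> x i"
    and y_nonneg: "i \<in> I \<Longrightarrow> 0 \<le> y i"
    and overlap: "\<exists>i\<in>I. 0 < x i \<and> 0 < y i"
begin

abbreviation F where "F \<equiv> rsum I x y"

definition dF where "dF \<alpha> = (\<Sum>i\<in>I. (ln (x i) - ln (y i)) * (x i powr \<alpha> * y i powr (1 - \<alpha>)))"

text \<open>The cumulant generating function of the log-ratio \<open>ln (x / y)\<close> under the
  weights \<open>y\<close> on the common support. Its Legendre transform supplies the large
  deviation rates.\<close>

definition L where "L \<alpha> = ln (F \<alpha>)"

definition slope where "slope \<alpha> = dF \<alpha> / F \<alpha>"

lemma F_pos: "0 < F \<alpha>"
proof -
  obtain i where i: "i \<in> I" "0 < x i" "0 < y i" using overlap by auto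
  then have "0 < x i powr \<alpha> * y i powr (1 - \<alpha>)" by simp
  with i finite_I show ?thesis unfolding rsum_def by (intro sum_pos2[of I i]) auto
qed

lemma exp_L: "exp (L \<alpha>) = F \<alpha>"
  using F_pos by (simp add: L_def)

lemma F_power: "F \<alpha> ^ m = exp (real m * L \<alpha>)"
  by (simp add: exp_of_nat_mult exp_L)

lemma F_deriv: "(F has_real_derivative dF \<alpha>) (at \<alpha>)"
proof -
  have "((\<lambda>\<alpha>. u powr \<alpha> * v powr (1 - \<alpha>)) has_real_derivative
      (ln u - ln v) * (u powr \<alpha> * v powr (1 - \<alpha>))) (at \<alpha>)" if "0 \<le> u" "0 \<le> v" for u v :: real
  proof (cases "u = 0 \<or> v = 0")
    case True
    then show ?thesis by auto
  next
    case False
    then show ?thesis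
      unfolding powr_def by (auto intro!: derivative_eq_intros simp: algebra_simps)
  qed
  then show ?thesis
    unfolding rsum_def[abs_def] dF_def by (intro DERIV_sum) (auto simp: x_nonneg y_nonneg)
qed

lemma L_deriv: "(L has_real_derivative slope \<alpha>) (at \<alpha>)"
  unfolding L_def[abs_def] slope_def using F_pos[of \<alpha>]
  by (auto intro!: derivative_eq_intros F_deriv)

lemma isCont_L: "isCont L \<alpha>"
  using L_deriv by (rule DERIV_isCont)

lemma isCont_slope: "isCont slope \<alpha>"
proof -
  have "isCont (\<lambda>\<alpha>. u powr \<alpha> * v powr (1 - \<alpha>)) \<alpha>" for u v :: real
  proof (cases "u = 0 \<or> v = 0")
    case True
    then show ?thesis by auto
  next
    case False
    then show ?thesis by (auto intro!: continuous_intros)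
  qed
  then have "isCont dF \<alpha>"
    unfolding dF_def[abs_def] by (intro continuous_sum continuous_mult[OF continuous_const])
  then show ?thesis
    unfolding slope_def[abs_def] using F_pos[of \<alpha>] DERIV_isCont[OF F_deriv]
    by (intro continuous_intros) auto
qed

text \<open>At \<open>h = 0\<close> both left-hand sides equal \<open>F \<alpha>\<close>, and their
  derivatives \<open>F \<alpha> * (a - slope \<alpha>)\<close> and
  \<open>F \<alpha> * (slope \<alpha> - b)\<close> are negative, so one small \<open>h\<close>
  serves both tails.\<close>

lemma tilt_exponent:
  assumes "a < slope \<alpha>" "slope \<alpha> < b"
  obtains h where "0 < h" "exp (h * a) * F (\<alpha> - h) < F \<alpha>" "exp (- h * b) * F (\<alpha> + h) < F \<alpha>"
proof -
  have "((\<lambda>h. F (\<alpha> - h)) has_real_derivative dF (\<alpha> - 0) * (- 1)) (at 0)"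
    by (rule DERIV_chain2[OF F_deriv]) (auto intro!: derivative_eq_intros)
  then have "((\<lambda>h. exp (h * a) * F (\<alpha> - h)) has_real_derivative a * F \<alpha> - dF \<alpha>) (at 0)"
    by (auto intro!: derivative_eq_intros)
  from DERIV_neg_dec_right[OF this] obtain d1 where d1: "0 < d1"
    "\<forall>h>0. h < d1 \<longrightarrow> exp (h * a) * F (\<alpha> - h) < F \<alpha>"
    using assms(1) F_pos[of \<alpha>] by (auto simp: slope_def field_simps)
  have "((\<lambda>h. F (\<alpha> + h)) has_real_derivative dF (\<alpha> + 0) * 1) (at 0)"
    by (rule DERIV_chain2[OF F_deriv]) (auto intro!: derivative_eq_intros)
  then have "((\<lambda>h. exp (- h * b) * F (\<alpha> + h)) has_real_derivative - b * F \<alpha> + dF \<alpha>) (at 0)"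
    by (auto intro!: derivative_eq_intros)
  from DERIV_neg_dec_right[OF this] obtain d2 where d2: "0 < d2"
    "\<forall>h>0. h < d2 \<longrightarrow> exp (- h * b) * F (\<alpha> + h) < F \<alpha>"
    using assms(2) F_pos[of \<alpha>] by (auto simp: slope_def field_simps)
  define h where "h = min d1 d2 / 2"
  have "0 < h" "h < d1" "h < d2" using d1(1) d2(1) by (auto simp: h_def)
  then show ?thesis using d1(2) d2(2) by (intro that[of h]) blast+
qed

end

lemma eventually_power_le:
  assumes "0 \<le> c" "c < (1::real)" "0 < e"
  shows "\<forall>\<^sub>F m in sequentially. c ^ m \<le> e"
proof -
  have "(\<lambda>m. c ^ m) \<longlonglongrightarrow> 0" using assms by (intro LIMSEQ_power_zero) auto
  then have "\<forall>\<^sub>F m in sequentially. c ^ m < e" using assms(3) by (rule order_tendstoD)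
  then show ?thesis by eventually_elim simp
qed

lemma eventually_exp_le:
  assumes "g < 0" "0 < e"
  shows "\<forall>\<^sub>F m in sequentially. exp (real m * g) \<le> e"
  using eventually_power_le[of "exp g" e] assms by (simp add: exp_of_nat_mult)

text \<open>Kronecker powers enter the one-sided estimates only through non-negativity and the
  multiplicativity of \<open>rsum\<close>, so index sets and entries stay abstract.\<close>

locale divergence_powers = divergence_pair +
  fixes J :: "nat \<Rightarrow> 'b set" and X Y :: "nat \<Rightarrow> 'b \<Rightarrow> real"
  assumes X_nonneg: "j \<in> J m \<Longrightarrow> 0 \<le> X m j"
    and Y_nonneg: "j \<in> J m \<Longrightarrow> 0 \<le> Y m j"
    and rsum_power: "rsum (J m) (X m) (Y m) \<alpha> = rsum I x y \<alpha> ^ m"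
begin

abbreviation window where
  "window m a b \<alpha> \<equiv> \<Sum>j\<in>J m. if exp (real m * a) * Y m j \<le> X m j \<and> X m j \<le> exp (real m * b) * Y m j
    then X m j powr \<alpha> * Y m j powr (1 - \<alpha>) else 0"

text \<open>Chernoff bounds on both tails of the measure tilted by \<open>\<alpha>\<close>, whose mean log-ratio is \<open>slope \<alpha>\<close>.\<close>

lemma window_mass:
  assumes "a < slope \<alpha>" "slope \<alpha> < b"
  shows "\<forall>\<^sub>F m in sequentially. exp (real m * L \<alpha>) \<le> 2 * window m a b \<alpha>"
proof -
  obtain h where h: "0 < h" "exp (h * a) * F (\<alpha> - h) < F \<alpha>" "exp (- h * b) * F (\<alpha> + h) < F \<alpha>"
    using tilt_exponent[OF assms] .
  \<comment> \<open>The geometric decay of the two tails relative to \<open>F \<alpha> ^ m\<close>.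
    Once each tail holds at most a quarter of the total, half is left in the window.\<close>
  define c d where "c = exp (h * a) * F (\<alpha> - h) / F \<alpha>" and "d = exp (- h * b) * F (\<alpha> + h) / F \<alpha>"
  have cd: "0 \<le> c" "c < 1" "0 \<le> d" "d < 1"
    using h F_pos by (auto simp: c_def d_def rsum_nonneg field_simps)
  have "\<forall>\<^sub>F m in sequentially. c ^ m \<le> 1 / 4" "\<forall>\<^sub>F m in sequentially. d ^ m \<le> 1 / 4"
    using eventually_power_le[of c "1 / 4"] eventually_power_le[of d "1 / 4"] cd by auto
  then show ?thesis
  proof eventually_elim
    case (elim m)
    have "exp (real m * a) powr h = exp (h * a) ^ m" "exp (real m * b) powr (- h) = exp (- h * b) ^ m"
      by (simp_all add: powr_def algebra_simps flip: exp_of_nat_mult)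
    then have "F \<alpha> ^ m \<le> window m a b \<alpha> + exp (h * a) ^ m * F (\<alpha> - h) ^ m + exp (- h * b) ^ m * F (\<alpha> + h) ^ m"
      using rsum_window[of "J m" "X m" "Y m" "exp (real m * a)" "exp (real m * b)" h \<alpha>] h(1)
      by (simp add: X_nonneg Y_nonneg rsum_power)
    also have "exp (h * a) ^ m * F (\<alpha> - h) ^ m = c ^ m * F \<alpha> ^ m"
      using F_pos[of \<alpha>] by (simp add: c_def power_divide power_mult_distrib)
    also have "exp (- h * b) ^ m * F (\<alpha> + h) ^ m = d ^ m * F \<alpha> ^ m"
      using F_pos[of \<alpha>] by (simp add: d_def power_divide power_mult_distrib)
    also have "window m a b \<alpha> + c ^ m * F \<alpha> ^ m + d ^ m * F \<alpha> ^ m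
        \<le> window m a b \<alpha> + 1 / 4 * F \<alpha> ^ m + 1 / 4 * F \<alpha> ^ m"
      using elim F_pos[of \<alpha>] by (intro add_mono mult_right_mono) auto
    finally show ?case by (simp add: F_power)
  qed
qed

text \<open>Cramer's lower bound. In the window \<open>X\<close> exceeds the subtracted term by a
  factor that grows with \<open>m\<close>, so at least half of it survives; the other factor 1/2 is
  the share of the window. The estimate at \<tau> covers all smaller \<sigma> at once.\<close>

lemma excess_lower:
  assumes "a < slope \<alpha>" "slope \<alpha> < b" "1 \<le> \<alpha>" "\<tau> < a"
  shows "\<forall>\<^sub>F m in sequentially. \<forall>\<sigma>\<le>\<tau>.
    exp (real m * (L \<alpha> - (\<alpha> - 1) * b)) / 4 \<le> (\<Sum>j\<in>J m. max 0 (X m j - exp (real m * \<sigma>) * Y m j))"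
proof -
  have "\<forall>\<^sub>F m in sequentially. exp (real m * (\<tau> - a)) \<le> 1 / 2"
    using assms by (intro eventually_exp_le) auto
  with window_mass[OF assms(1,2)] show ?thesis
  proof eventually_elim
    case (elim m)
    show ?case
    proof (intro allI impI)
      fix \<sigma> assume \<sigma>: "\<sigma> \<le> \<tau>"
      \<comment> \<open>The quotient of \<open>X\<close> by its tilted weight is
        \<open>(Y / X) powr (\<alpha> - 1)\<close>; on the window it is at least \<open>E\<close>,
        its value at the upper end \<open>b\<close>.\<close>
      define E where "E = exp (- (real m * ((\<alpha> - 1) * b)))"
      have "E / 2 * window m a b \<alpha> \<le> (\<Sum>j\<in>J m. max 0 (X m j - exp (real m * \<sigma>) * Y m j))"
        unfolding sum_distrib_left
      proof (rule sum_mono)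
        fix j assume j: "j \<in> J m"
        define u v where "u = X m j" and "v = Y m j"
        have uv: "0 \<le> u" "0 \<le> v" using X_nonneg[OF j] Y_nonneg[OF j] by (auto simp: u_def v_def)
        have "E / 2 * (u powr \<alpha> * v powr (1 - \<alpha>)) \<le> max 0 (u - exp (real m * \<sigma>) * v)"
          if w: "exp (real m * a) * v \<le> u" "u \<le> exp (real m * b) * v"
        proof (cases "u = 0 \<or> v = 0")
          case True
          then show ?thesis by auto
        next
          case False
          with uv have uv: "0 < u" "0 < v" by auto
          have "exp (real m * \<sigma>) * v \<le> exp (real m * \<tau>) * v"
            using \<sigma> uv by (intro mult_right_mono) (auto intro: mult_left_mono)
          also have "\<dots> = exp (real m * (\<tau> - a)) * (exp (real m * a) * v)"
            by (simp add: algebra_simps flip: exp_add)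
          also have "\<dots> \<le> 1 / 2 * u"
            using elim(2) w uv by (intro mult_mono) auto
          finally have 1: "u / 2 \<le> u - exp (real m * \<sigma>) * v" by simp
          have "E * (u powr \<alpha> * v powr (1 - \<alpha>)) = (u / (exp (real m * b) * v)) powr (\<alpha> - 1) * u"
            using uv by (simp add: powr_diff powr_mult powr_divide powr_def[of "exp _"] E_def exp_minus
                field_simps exp_diff)
          also have "\<dots> \<le> 1 * u"
            using uv w assms(3) by (intro mult_right_mono powr_le1) auto
          finally have "E / 2 * (u powr \<alpha> * v powr (1 - \<alpha>)) \<le> u - exp (real m * \<sigma>) * v"
            using 1 by simp
          then show ?thesis by (rule max.coboundedI2)
        qed
        then show "E / 2 * (if exp (real m * a) * Y m j \<le> X m j \<and> X m j \<le> exp (real m * b) * Y m j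
            then X m j powr \<alpha> * Y m j powr (1 - \<alpha>) else 0) \<le> max 0 (X m j - exp (real m * \<sigma>) * Y m j)"
          by (auto simp: u_def v_def)
      qed
      moreover have "E / 4 * exp (real m * L \<alpha>) \<le> E / 4 * (2 * window m a b \<alpha>)"
        using elim(1) by (intro mult_left_mono) (auto simp: E_def)
      moreover have "E * exp (real m * L \<alpha>) = exp (real m * (L \<alpha> - (\<alpha> - 1) * b))"
        unfolding E_def exp_add[symmetric] by (simp add: algebra_simps)
      ultimately show "exp (real m * (L \<alpha> - (\<alpha> - 1) * b)) / 4
          \<le> (\<Sum>j\<in>J m. max 0 (X m j - exp (real m * \<sigma>) * Y m j))"
        by simp
    qed
  qed
qed

text \<open>In the window both arguments of the minimum are at least
  \<open>exp (real m * a) * Y\<close>, and \<open>Y\<close> is at least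
  \<open>exp (- real m * \<alpha> * b)\<close> times the tilted weight.\<close>

lemma overlap_lower:
  assumes "a < slope \<alpha>" "slope \<alpha> < b" "0 \<le> \<alpha>"
  shows "\<forall>\<^sub>F m in sequentially. \<forall>\<sigma>\<ge>a.
    exp (real m * (L \<alpha> + a - \<alpha> * b)) / 2 \<le> (\<Sum>j\<in>J m. min (X m j) (exp (real m * \<sigma>) * Y m j))"
  using window_mass[OF assms(1,2)]
proof eventually_elim
  case (elim m)
  show ?case
  proof (intro allI impI)
    fix \<sigma> assume \<sigma>: "a \<le> \<sigma>"
    define E where "E = exp (real m * (a - \<alpha> * b))"
    have "E * window m a b \<alpha> \<le> (\<Sum>j\<in>J m. min (X m j) (exp (real m * \<sigma>) * Y m j))"
      unfolding sum_distrib_left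
    proof (rule sum_mono)
      fix j assume j: "j \<in> J m"
      define u v where "u = X m j" and "v = Y m j"
      have uv: "0 \<le> u" "0 \<le> v" using X_nonneg[OF j] Y_nonneg[OF j] by (auto simp: u_def v_def)
      have "E * (u powr \<alpha> * v powr (1 - \<alpha>)) \<le> min u (exp (real m * \<sigma>) * v)"
        if w: "exp (real m * a) * v \<le> u" "u \<le> exp (real m * b) * v"
      proof (cases "u = 0 \<or> v = 0")
        case True
        then show ?thesis using uv by (auto simp: min_def)
      next
        case False
        with uv have uv: "0 < u" "0 < v" by auto
        have 1: "exp (real m * a) * v \<le> exp (real m * \<sigma>) * v"
          using \<sigma> uv by (intro mult_right_mono) (auto intro: mult_left_mono)
        have "E * (u powr \<alpha> * v powr (1 - \<alpha>)) = (u / (exp (real m * b) * v)) powr \<alpha> * (exp (real m * a) * v)"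
          using uv by (simp add: powr_diff powr_mult powr_divide powr_def[of "exp _"] E_def exp_minus
              field_simps exp_diff)
        also have "\<dots> \<le> 1 * (exp (real m * a) * v)"
          using uv w assms(3) by (intro mult_right_mono powr_le1) auto
        finally show ?thesis using 1 w by simp
      qed
      moreover have "0 \<le> min u (exp (real m * \<sigma>) * v)" using uv by simp
      ultimately show "E * (if exp (real m * a) * Y m j \<le> X m j \<and> X m j \<le> exp (real m * b) * Y m j
          then X m j powr \<alpha> * Y m j powr (1 - \<alpha>) else 0) \<le> min (X m j) (exp (real m * \<sigma>) * Y m j)"
        by (auto simp: u_def v_def)
    qed
    moreover have "E / 2 * exp (real m * L \<alpha>) \<le> E / 2 * (2 * window m a b \<alpha>)"
      using elim(1) by (intro mult_left_mono) (auto simp: E_def)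
    moreover have "E * exp (real m * L \<alpha>) = exp (real m * (L \<alpha> + a - \<alpha> * b))"
      unfolding E_def exp_add[symmetric] by (simp add: algebra_simps)
    ultimately show "exp (real m * (L \<alpha> + a - \<alpha> * b)) / 2
        \<le> (\<Sum>j\<in>J m. min (X m j) (exp (real m * \<sigma>) * Y m j))"
      by simp
  qed
qed

end

lemma (in divergence_pair) swapped_pair: "divergence_pair I y x"
  using overlap by unfold_locales (auto simp: finite_I x_nonneg y_nonneg)

lemma (in divergence_pair) swapped_slope: "divergence_pair.slope I y x \<alpha> = - slope (1 - \<alpha>)"
proof -
  interpret S: divergence_pair I y x by (rule swapped_pair)
  have "S.dF \<alpha> = - dF (1 - \<alpha>)"
    unfolding S.dF_def dF_def by (simp add: algebra_simps flip: sum_negf)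
  then show ?thesis
    unfolding S.slope_def slope_def by (simp add: rsum_swap[of _ y])
qed

lemma (in divergence_powers) swapped_powers: "divergence_powers I y x J Y X"
proof -
  interpret S: divergence_pair I y x by (rule swapped_pair)
  show ?thesis by unfold_locales (simp_all add: X_nonneg Y_nonneg rsum_power rsum_swap[of _ y] rsum_swap[of _ "Y _"])
qed

section \<open>Local comparison of source and target powers\<close>

lemma exp_mult_le_split:
  "a \<le> b + c \<Longrightarrow> exp (real m * a) \<le> exp (real m * b) * exp (real m * c)"
  by (simp add: mult_left_mono flip: exp_add distrib_left)

text \<open>\<open>P\<close> is the source and \<open>E\<close> the mixed target. Strict positivity
  is demanded of the target alone, so that a \<open>p1\<close> with zero entries is covered.\<close>

locale divergence_comparison =
  P: divergence_powers I x y J X Y + E: divergence_powers I' x' y' J' X' Y'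
  for I :: "'a set" and x y and J :: "nat \<Rightarrow> 'b set" and X Y
    and I' :: "'c set" and x' y' and J' :: "nat \<Rightarrow> 'd set" and X' Y' +
  assumes X'_pos: "j \<in> J' m \<Longrightarrow> 0 < X' m j" and Y'_pos: "j \<in> J' m \<Longrightarrow> 0 < Y' m j"
    and sum_X: "(\<Sum>j\<in>J m. X m j) = 1" and sum_Y: "(\<Sum>j\<in>J m. Y m j) = 1"
    and sum_X': "(\<Sum>j\<in>J' m. X' m j) = 1" and sum_Y': "(\<Sum>j\<in>J' m. Y' m j) = 1"
begin

lemma swapped_comparison: "divergence_comparison I y x J Y X I' y' x' J' Y' X'"
proof -
  interpret SP: divergence_powers I y x J Y X by (rule P.swapped_powers)
  interpret SE: divergence_powers I' y' x' J' Y' X' by (rule E.swapped_powers)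
  show ?thesis
    by unfold_locales (simp_all add: X'_pos Y'_pos sum_X sum_Y sum_X' sum_Y')
qed

definition dominated :: "nat \<Rightarrow> real \<Rightarrow> bool" where
  "dominated m t \<longleftrightarrow>
    (\<Sum>j\<in>J' m. max 0 (X' m j - t * Y' m j)) \<le> (\<Sum>j\<in>J m. max 0 (X m j - t * Y m j))"

text \<open>The threshold is measured on the logarithmic scale per factor. The radius is chosen
  before \<open>m\<close>, so that finitely many neighbourhoods can share one lower bound on
  \<open>m\<close>.\<close>

definition locally_dominated :: "real \<Rightarrow> bool" where
  "locally_dominated \<tau> \<longleftrightarrow>
    (\<exists>\<eta>>0. \<forall>\<^sub>F m in sequentially. \<forall>\<sigma>. \<bar>\<sigma> - \<tau>\<bar> < \<eta> \<longrightarrow> dominated m (exp (real m * \<sigma>)))"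

lemma E_excess_le:
  assumes "1 \<le> \<beta>"
  shows "(\<Sum>j\<in>J' m. max 0 (X' m j - exp (real m * \<sigma>) * Y' m j)) \<le> exp (real m * (E.L \<beta> - (\<beta> - 1) * \<sigma>))"
proof -
  have "exp (real m * \<sigma>) powr (1 - \<beta>) * rsum (J' m) (X' m) (Y' m) \<beta> = exp (real m * (E.L \<beta> - (\<beta> - 1) * \<sigma>))"
    by (simp add: E.rsum_power E.F_power powr_def algebra_simps flip: exp_add)
  then show ?thesis
    using excess_le_rsum[of "J' m" "X' m" "Y' m" "exp (real m * \<sigma>)" \<beta>] assms by (simp add: E.X_nonneg Y'_pos)
qed

text \<open>Two exponential rates are compared: Chernoff's for the target at order \<beta>, and
  Cramer's for the source around \<open>P.slope \<alpha>\<close>, which lies beyond \<tau> so that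
  the window clears every threshold near \<tau>.\<close>

lemma excess_local:
  assumes "1 \<le> \<alpha>" "1 \<le> \<beta>" "\<tau> < P.slope \<alpha>"
    and "E.L \<beta> - (\<beta> - 1) * \<tau> < P.L \<alpha> - (\<alpha> - 1) * P.slope \<alpha>"
  shows "locally_dominated \<tau>"
proof -
  define g where "g = P.L \<alpha> - (\<alpha> - 1) * P.slope \<alpha> - (E.L \<beta> - (\<beta> - 1) * \<tau>)"
  \<comment> \<open>Each side may lose g/4: shifting the threshold by \<eta> costs the target rate
    at most \<open>(\<beta> - 1) * \<eta>\<close>, and widening the window to \<open>b\<close> costs
    the source \<open>(\<alpha> - 1) * (g / (4 * \<alpha>))\<close>. The remaining g/2 absorbs the
    factor 1/4. A third of the distance to the slope leaves room for the lower end of the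
    window.\<close>
  define \<eta> where "\<eta> = min ((P.slope \<alpha> - \<tau>) / 3) (g / (4 * \<beta>))"
  define b where "b = P.slope \<alpha> + g / (4 * \<alpha>)"
  have g: "0 < g" using assms by (simp add: g_def)
  have \<eta>: "0 < \<eta>" "\<eta> \<le> (P.slope \<alpha> - \<tau>) / 3" "\<eta> \<le> g / (4 * \<beta>)"
    using assms g unfolding \<eta>_def by (simp, intro min.cobounded1, intro min.cobounded2)
  have "(\<beta> - 1) * \<eta> \<le> \<beta> * (g / (4 * \<beta>))" using \<eta> assms g by (intro mult_mono) auto
  then have \<beta>\<eta>: "(\<beta> - 1) * \<eta> \<le> g / 4" using assms by simp
  have "(\<alpha> - 1) * (g / (4 * \<alpha>)) \<le> \<alpha> * (g / (4 * \<alpha>))" using assms g by (intro mult_right_mono) auto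
  then have \<alpha>b: "(\<alpha> - 1) * b \<le> (\<alpha> - 1) * P.slope \<alpha> + g / 4"
    using assms by (simp add: b_def distrib_left)
  have "\<forall>\<^sub>F m in sequentially. \<forall>\<sigma>\<le>\<tau> + \<eta>. exp (real m * (P.L \<alpha> - (\<alpha> - 1) * b)) / 4
      \<le> (\<Sum>j\<in>J m. max 0 (X m j - exp (real m * \<sigma>) * Y m j))"
    using assms(1,3) \<eta> g
    by (intro P.excess_lower[of "\<tau> + 2 * (P.slope \<alpha> - \<tau>) / 3"]) (auto simp: b_def field_simps)
  moreover have "\<forall>\<^sub>F m in sequentially. exp (real m * (- g / 2)) \<le> 1 / 4"
    using g by (intro eventually_exp_le) auto
  ultimately have "\<forall>\<^sub>F m in sequentially. \<forall>\<sigma>. \<bar>\<sigma> - \<tau>\<bar> < \<eta> \<longrightarrow> dominated m (exp (real m * \<sigma>))"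
  proof eventually_elim
    case (elim m)
    show ?case
    proof (intro allI impI)
      fix \<sigma> assume \<sigma>: "\<bar>\<sigma> - \<tau>\<bar> < \<eta>"
      then have "(\<beta> - 1) * (\<tau> - \<eta>) \<le> (\<beta> - 1) * \<sigma>"
        using assms(2) by (intro mult_left_mono) auto
      moreover have "(\<beta> - 1) * (\<tau> - \<eta>) = (\<beta> - 1) * \<tau> - (\<beta> - 1) * \<eta>" by (simp add: right_diff_distrib)
      ultimately have "E.L \<beta> - (\<beta> - 1) * \<sigma> \<le> P.L \<alpha> - (\<alpha> - 1) * b + - g / 2"
        using \<beta>\<eta> \<alpha>b g_def by linarith
      then have "exp (real m * (E.L \<beta> - (\<beta> - 1) * \<sigma>))
          \<le> exp (real m * (P.L \<alpha> - (\<alpha> - 1) * b)) * exp (real m * (- g / 2))"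
        by (rule exp_mult_le_split)
      also have "\<dots> \<le> exp (real m * (P.L \<alpha> - (\<alpha> - 1) * b)) * (1 / 4)"
        using elim(2) by (intro mult_left_mono) auto
      also have "\<dots> \<le> (\<Sum>j\<in>J m. max 0 (X m j - exp (real m * \<sigma>) * Y m j))"
        using elim(1) \<sigma> by auto
      finally show "dominated m (exp (real m * \<sigma>))"
        unfolding dominated_def by (rule order_trans[OF E_excess_le[OF assms(2)]])
    qed
  qed
  with \<eta>(1) show ?thesis by (auto simp: locally_dominated_def)
qed

text \<open>Both first vectors have total mass 1. In the central range the hinge sums are close to
  1, and only their complements live on an exponential scale.\<close>

lemma dominated_iff_overlap:
  "dominated m t \<longleftrightarrow> (\<Sum>j\<in>J m. min (X m j) (t * Y m j)) \<le> (\<Sum>j\<in>J' m. min (X' m j) (t * Y' m j))"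
proof -
  have "(\<Sum>j\<in>A. max 0 (u j - t * v j)) = (\<Sum>j\<in>A. u j) - (\<Sum>j\<in>A. min (u j) (t * v j))"
    for A :: "'e set" and u v
    unfolding sum_subtractf[symmetric] by (intro sum.cong) auto
  from this[of "X m" "Y m" "J m"] this[of "X' m" "Y' m" "J' m"]
  show ?thesis by (simp add: dominated_def sum_X sum_X')
qed

text \<open>Complements exchange the roles: the target receives the lower bound, from tilting to
  mean log-ratio exactly \<tau>, and the source the upper bound.\<close>

lemma overlap_local:
  assumes "0 \<le> \<alpha>" "\<alpha> \<le> 1" "0 \<le> \<beta>" "\<beta> \<le> 1" "E.slope \<alpha> = \<tau>"
    and "(1 - \<beta>) * \<tau> + P.L \<beta> < E.L \<alpha> + (1 - \<alpha>) * \<tau>"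
  shows "locally_dominated \<tau>"
proof -
  define g where "g = E.L \<alpha> + (1 - \<alpha>) * \<tau> - ((1 - \<beta>) * \<tau> + P.L \<beta>)"
  \<comment> \<open>The estimates below lose \<eta> three times, which is less than the g/2 that is
    available.\<close>
  define \<eta> where "\<eta> = g / 8"
  have g: "0 < g" "0 < \<eta>" using assms by (simp_all add: g_def \<eta>_def)
  have "\<forall>\<^sub>F m in sequentially. \<forall>\<sigma>\<ge>\<tau> - \<eta>. exp (real m * (E.L \<alpha> + (\<tau> - \<eta>) - \<alpha> * (\<tau> + \<eta>))) / 2
      \<le> (\<Sum>j\<in>J' m. min (X' m j) (exp (real m * \<sigma>) * Y' m j))"
    using assms g by (intro E.overlap_lower) auto
  moreover have "\<forall>\<^sub>F m in sequentially. exp (real m * (- g / 2)) \<le> 1 / 2"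
    using g by (intro eventually_exp_le) auto
  ultimately have "\<forall>\<^sub>F m in sequentially. \<forall>\<sigma>. \<bar>\<sigma> - \<tau>\<bar> < \<eta> \<longrightarrow> dominated m (exp (real m * \<sigma>))"
  proof eventually_elim
    case (elim m)
    show ?case
    proof (intro allI impI)
      fix \<sigma> assume \<sigma>: "\<bar>\<sigma> - \<tau>\<bar> < \<eta>"
      have "(1 - \<beta>) * \<sigma> \<le> (1 - \<beta>) * (\<tau> + \<eta>)"
        using assms \<sigma> by (intro mult_left_mono) auto
      also have "\<dots> \<le> (1 - \<beta>) * \<tau> + \<eta>"
        using mult_right_mono[of "1 - \<beta>" 1 \<eta>] assms g by (simp add: distrib_left)
      finally have 1: "(1 - \<beta>) * \<sigma> \<le> (1 - \<beta>) * \<tau> + \<eta>" .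
      have "\<alpha> * (\<tau> + \<eta>) \<le> \<alpha> * \<tau> + \<eta>"
        using mult_right_mono[of \<alpha> 1 \<eta>] assms g by (simp add: distrib_left)
      with 1 g have "(1 - \<beta>) * \<sigma> + P.L \<beta> \<le> E.L \<alpha> + (\<tau> - \<eta>) - \<alpha> * (\<tau> + \<eta>) + - g / 2"
      proof -
        have "(1 - \<alpha>) * \<tau> = \<tau> - \<alpha> * \<tau>" by (simp add: algebra_simps)
        moreover have "g = 8 * \<eta>" by (simp add: \<eta>_def)
        moreover note \<open>\<alpha> * (\<tau> + \<eta>) \<le> \<alpha> * \<tau> + \<eta>\<close> 1 g_def g
        ultimately show ?thesis by linarith
      qed
      then have "exp (real m * ((1 - \<beta>) * \<sigma> + P.L \<beta>))
          \<le> exp (real m * (E.L \<alpha> + (\<tau> - \<eta>) - \<alpha> * (\<tau> + \<eta>))) * exp (real m * (- g / 2))"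
        by (rule exp_mult_le_split)
      also have "\<dots> \<le> exp (real m * (E.L \<alpha> + (\<tau> - \<eta>) - \<alpha> * (\<tau> + \<eta>))) * (1 / 2)"
        using elim(2) by (intro mult_left_mono) auto
      also have "\<dots> \<le> (\<Sum>j\<in>J' m. min (X' m j) (exp (real m * \<sigma>) * Y' m j))"
        using elim(1) \<sigma> by auto
      finally have "exp (real m * ((1 - \<beta>) * \<sigma> + P.L \<beta>)) \<le> (\<Sum>j\<in>J' m. min (X' m j) (exp (real m * \<sigma>) * Y' m j))" .
      moreover have "exp (real m * \<sigma>) powr (1 - \<beta>) * rsum (J m) (X m) (Y m) \<beta> = exp (real m * ((1 - \<beta>) * \<sigma> + P.L \<beta>))"
        by (simp add: P.rsum_power P.F_power powr_def algebra_simps flip: exp_add)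
      ultimately show "dominated m (exp (real m * \<sigma>))"
        using overlap_le_rsum[of "J m" "X m" "Y m" "exp (real m * \<sigma>)" \<beta>] assms
        by (simp add: dominated_iff_overlap P.X_nonneg P.Y_nonneg)
    qed
  qed
  with g show ?thesis by (auto simp: locally_dominated_def)
qed

text \<open>The exponent vanishes at \<beta> = 1 and has the negative derivative
  \<open>E.slope 1 - \<tau>\<close> there.\<close>

lemma E_rate_negative:
  assumes "E.F 1 = 1" "E.slope 1 < \<tau>"
  obtains \<beta> where "1 < \<beta>" "E.L \<beta> - (\<beta> - 1) * \<tau> < 0"
proof -
  have "((\<lambda>\<beta>. E.L \<beta> - (\<beta> - 1) * \<tau>) has_real_derivative E.slope 1 - \<tau>) (at 1)"
    by (auto intro!: derivative_eq_intros E.L_deriv)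
  from DERIV_neg_dec_right[OF this] assms obtain d where "0 < d"
    "\<And>h. 0 < h \<Longrightarrow> h < d \<Longrightarrow> E.L (1 + h) - h * \<tau> < E.L 1"
    by auto
  from this(1) this(2)[of "d / 2"] show ?thesis
    using assms by (intro that[of "1 + d / 2"]) (simp_all add: E.L_def[of 1])
qed

text \<open>The source order is taken where \<open>P.slope\<close> begins to exceed \<tau>. There
  source and target are compared at the same order by \<open>gt\<close>, except at order 1, where
  the target rate is negative for another \<beta>.\<close>

lemma excess_region:
  assumes F1: "P.F 1 = 1" "E.F 1 = 1" and gt: "\<And>\<alpha>. 1 < \<alpha> \<Longrightarrow> E.F \<alpha> < P.F \<alpha>"
    and max: "\<exists>i\<in>I. 0 < y i \<and> exp M * y i < x i" and \<tau>: "E.slope 1 < \<tau>" "\<tau> \<le> M"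
  shows "locally_dominated \<tau>"
proof -
  define S where "S = {\<alpha>. 1 \<le> \<alpha> \<and> \<tau> < P.slope \<alpha>}"
  \<comment> \<open>One entry with log-ratio above \<open>M\<close> makes \<open>P.L\<close> grow
    faster than \<tau> times the order, which slopes bounded by \<tau> would prevent.\<close>
  have "S \<noteq> {}"
  proof
    assume "S = {}"
    then have le: "P.slope \<alpha> \<le> \<tau>" if "1 \<le> \<alpha>" for \<alpha> using that by (force simp: S_def)
    obtain i where i: "i \<in> I" "0 < y i" "exp M * y i < x i" using max by auto
    have xi: "0 < x i" using i by (meson less_trans mult_pos_pos exp_gt_zero)
    define \<mu> where "\<mu> = ln (x i / y i)"
    have "exp M < x i / y i" using i by (simp add: field_simps)
    then have "M < \<mu>" using i xi unfolding \<mu>_def by (metis divide_pos_pos exp_gt_zero ln_exp ln_less_cancel_iff)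
    \<comment> \<open>Large enough for the gain \<mu> - \<tau> per unit of order to outweigh the
      constants \<open>ln (y i)\<close> and \<tau>.\<close>
    define A where "A = 2 + \<bar>ln (y i)\<bar> / (\<mu> - \<tau>) + \<bar>\<tau>\<bar> / (\<mu> - \<tau>)"
    have A: "1 < A" using \<open>M < \<mu>\<close> \<tau> by (simp add: A_def add_pos_nonneg)
    have "exp (ln (y i) + A * \<mu>) = x i powr A * y i powr (1 - A)"
      using i xi by (simp add: \<mu>_def ln_div powr_def algebra_simps flip: exp_add)
    also have "\<dots> \<le> P.F A"
      unfolding rsum_def using i P.finite_I by (intro member_le_sum) auto
    finally have "exp (ln (y i) + A * \<mu>) \<le> exp (P.L A)" by (simp only: P.exp_L)
    then have 1: "ln (y i) + A * \<mu> \<le> P.L A" by simp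
    obtain z where z: "1 < z" "P.L A - P.L 1 = (A - 1) * P.slope z"
      using MVT2[OF A, of P.L P.slope] P.L_deriv by blast
    have "(A - 1) * P.slope z \<le> (A - 1) * \<tau>" using z A le[of z] by (intro mult_left_mono) auto
    with z 1 F1 have "A * (\<mu> - \<tau>) \<le> - ln (y i) - \<tau>" by (simp add: P.L_def algebra_simps)
    moreover have "A * (\<mu> - \<tau>) = 2 * (\<mu> - \<tau>) + \<bar>ln (y i)\<bar> + \<bar>\<tau>\<bar>"
    proof -
      have "\<mu> - \<tau> \<noteq> 0" using \<open>M < \<mu>\<close> \<tau> by simp
      then show ?thesis unfolding A_def distrib_right by simp
    qed
    ultimately have "2 * (\<mu> - \<tau>) + \<bar>ln (y i)\<bar> + \<bar>\<tau>\<bar> \<le> - ln (y i) - \<tau>" by simp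
    then have "2 * (\<mu> - \<tau>) + (\<bar>ln (y i)\<bar> + \<bar>\<tau>\<bar>) \<le> - ln (y i) + - \<tau>" by simp
    also have "\<dots> \<le> \<bar>ln (y i)\<bar> + \<bar>\<tau>\<bar>"
      by (intro add_mono abs_ge_minus_self)
    finally show False using \<open>M < \<mu>\<close> \<tau>(2) by simp
  qed
  \<comment> \<open>The optimal order in Cramer's theorem, where the slope of \<open>P.L\<close> reaches \<open>\<tau>\<close>.\<close>
  define a where "a = Inf S"
  have bdd: "bdd_below S" by (auto simp: S_def intro!: bdd_belowI[of _ 1])
  have a: "1 \<le> a" unfolding a_def using \<open>S \<noteq> {}\<close> by (intro cInf_greatest) (auto simp: S_def)
  have near: "\<exists>\<alpha>\<in>S. \<bar>\<alpha> - a\<bar> < d" if d: "0 < d" for d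
  proof -
    obtain \<alpha> where "\<alpha> \<in> S" "\<alpha> < a + d"
      using cInf_lessD[OF \<open>S \<noteq> {}\<close>, of "a + d"] d by (auto simp: a_def)
    moreover have "a \<le> \<alpha>" unfolding a_def using \<open>\<alpha> \<in> S\<close> bdd by (intro cInf_lower)
    ultimately show ?thesis by (intro bexI[of _ \<alpha>]) auto
  qed
  let ?R = "\<lambda>\<alpha>. P.L \<alpha> - (\<alpha> - 1) * P.slope \<alpha>"
  \<comment> \<open>For \<open>a > 1\<close> the infimum satisfies
    \<open>P.slope a \<le> \<tau>\<close>, so replacing this slope by \<tau> only lowers the source
    rate, and strictness at order \<open>a\<close> permits \<beta> = a. For \<open>a = 1\<close> the
    source rate is 0.\<close>
  have "\<exists>\<beta>\<ge>1. E.L \<beta> - (\<beta> - 1) * \<tau> < ?R a"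
  proof (cases "a = 1")
    case True
    then show ?thesis using E_rate_negative[OF F1(2) \<tau>(1)] F1 by (metis P.L_def diff_self less_imp_le ln_one mult_zero_left diff_zero)
  next
    case False
    with a have a: "1 < a" by simp
    have "P.slope a \<le> \<tau>"
    proof (rule ccontr)
      assume "\<not> ?thesis"
      then have "0 < P.slope a - \<tau>" by simp
      then obtain d where d: "0 < d" "\<forall>\<alpha>. \<bar>\<alpha> - a\<bar> < d \<longrightarrow> \<bar>P.slope \<alpha> - P.slope a\<bar> < P.slope a - \<tau>"
        using P.isCont_slope[of a] unfolding isCont_def LIM_def dist_real_def by (metis abs_0 cancel_comm_monoid_add_class.diff_cancel)
      define \<alpha> where "\<alpha> = max 1 (a - d / 2)"
      have "\<bar>\<alpha> - a\<bar> < d" "\<alpha> < a" "1 \<le> \<alpha>" using a d(1) by (auto simp: \<alpha>_def)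
      moreover have "\<tau> < P.slope \<alpha>" using d(2)[rule_format, of \<alpha>] \<open>\<bar>\<alpha> - a\<bar> < d\<close> by linarith
      ultimately have "\<alpha> \<in> S" by (simp add: S_def)
      then show False using \<open>\<alpha> < a\<close> bdd cInf_lower unfolding a_def by fastforce
    qed
    then have "(a - 1) * P.slope a \<le> (a - 1) * \<tau>" using a by (intro mult_left_mono) auto
    moreover have "E.L a < P.L a" unfolding E.L_def P.L_def using gt[OF a] E.F_pos P.F_pos by simp
    ultimately have "E.L a - (a - 1) * \<tau> < ?R a" by linarith
    then show ?thesis using a by (intro exI[of _ a]) auto
  qed
  then obtain \<beta> where \<beta>: "1 \<le> \<beta>" "E.L \<beta> - (\<beta> - 1) * \<tau> < ?R a" by auto
  \<comment> \<open>\<open>a\<close> itself may violate \<open>\<tau> < P.slope a\<close>;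
    continuity carries the strict gap between the rates to a nearby member of
    \<open>S\<close>.\<close>
  have "isCont ?R a" by (intro continuous_intros P.isCont_L P.isCont_slope)
  then obtain d where d: "0 < d"
    "\<forall>\<alpha>. \<alpha> \<noteq> a \<and> \<bar>\<alpha> - a\<bar> < d \<longrightarrow> \<bar>?R \<alpha> - ?R a\<bar> < ?R a - (E.L \<beta> - (\<beta> - 1) * \<tau>)"
    using \<beta>(2) unfolding isCont_def LIM_def dist_real_def by (metis diff_gt_0_iff_gt)
  obtain \<alpha> where \<alpha>: "\<alpha> \<in> S" "\<bar>\<alpha> - a\<bar> < d" using near[OF d(1)] by auto
  have "E.L \<beta> - (\<beta> - 1) * \<tau> < ?R \<alpha>"
    using d(2) \<alpha>(2) \<beta>(2) by (cases "\<alpha> = a") (simp, smt (verit))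
  then show ?thesis using \<alpha>(1) \<beta>(1) by (intro excess_local[of \<alpha> \<beta>]) (auto simp: S_def)
qed

text \<open>\<open>P.F 1 < 1\<close> says that mass of \<open>x\<close> sits where \<open>y\<close>
  vanishes. Under powers this part grows towards the whole mass, and it counts as excess at every
  threshold, whereas the target excess decays.\<close>

lemma excess_region_singular:
  assumes "P.F 1 < 1" "E.F 1 = 1" "E.slope 1 < \<tau>"
  shows "locally_dominated \<tau>"
proof -
  obtain \<beta> where \<beta>: "1 < \<beta>" "E.L \<beta> - (\<beta> - 1) * \<tau> < 0" using E_rate_negative[OF assms(2,3)] .
  define g where "g = - (E.L \<beta> - (\<beta> - 1) * \<tau>)"
  define \<eta> where "\<eta> = g / (2 * \<beta>)"
  have g: "0 < g" "0 < \<eta>" using \<beta> by (auto simp: g_def \<eta>_def)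
  have "(\<beta> - 1) * \<eta> \<le> \<beta> * \<eta>" using g by (intro mult_right_mono) auto
  then have \<beta>\<eta>: "(\<beta> - 1) * \<eta> \<le> g / 2" using \<beta> by (simp add: \<eta>_def)
  have "\<forall>\<^sub>F m in sequentially. exp (real m * (- g / 2)) \<le> 1 / 2"
    using g by (intro eventually_exp_le) auto
  moreover have "\<forall>\<^sub>F m in sequentially. P.F 1 ^ m \<le> 1 / 2"
    using assms P.F_pos[of 1] by (intro eventually_power_le) auto
  ultimately have "\<forall>\<^sub>F m in sequentially. \<forall>\<sigma>. \<bar>\<sigma> - \<tau>\<bar> < \<eta> \<longrightarrow> dominated m (exp (real m * \<sigma>))"
  proof eventually_elim
    case (elim m)
    show ?case
    proof (intro allI impI)
      fix \<sigma> assume \<sigma>: "\<bar>\<sigma> - \<tau>\<bar> < \<eta>"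
      then have "(\<beta> - 1) * (\<tau> - \<eta>) \<le> (\<beta> - 1) * \<sigma>"
        using \<beta>(1) by (intro mult_left_mono) auto
      then have "E.L \<beta> - (\<beta> - 1) * \<sigma> \<le> - g / 2"
        using \<beta>\<eta> by (simp add: g_def right_diff_distrib)
      then have "exp (real m * (E.L \<beta> - (\<beta> - 1) * \<sigma>)) \<le> exp (real m * (- g / 2))"
        by (simp only: exp_le_cancel_iff) (rule mult_left_mono, auto)
      then have 1: "(\<Sum>j\<in>J' m. max 0 (X' m j - exp (real m * \<sigma>) * Y' m j)) \<le> 1 / 2"
        using E_excess_le[of \<beta> m \<sigma>] \<beta>(1) elim(1) by linarith
      \<comment> \<open>\<open>Y m j powr 0\<close> is 1 or 0 according to whether \<open>Y\<close>
        charges \<open>j\<close>, so each summand is the part of \<open>X\<close> outside the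
        support of \<open>Y\<close>.\<close>
      have "1 - P.F 1 ^ m = (\<Sum>j\<in>J m. X m j - X m j powr 1 * Y m j powr (1 - 1))"
        unfolding P.rsum_power[of m 1, symmetric] rsum_def[of "J m"] by (simp only: sum_subtractf sum_X)
      also have "\<dots> \<le> (\<Sum>j\<in>J m. max 0 (X m j - exp (real m * \<sigma>) * Y m j))"
      proof (rule sum_mono)
        fix j assume "j \<in> J m"
        then show "X m j - X m j powr 1 * Y m j powr (1 - 1) \<le> max 0 (X m j - exp (real m * \<sigma>) * Y m j)"
          using P.X_nonneg[of j m] by (cases "Y m j = 0") auto
      qed
      finally show "dominated m (exp (real m * \<sigma>))" using 1 elim(2) by (simp add: dominated_def)
    qed
  qed
  with g show ?thesis by (auto simp: locally_dominated_def)
qed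

lemma overlap_region:
  assumes "P.F 1 = 1" "E.F 0 = 1" "E.F 1 = 1"
    and lt: "\<And>\<alpha>. 0 < \<alpha> \<Longrightarrow> \<alpha> < 1 \<Longrightarrow> P.F \<alpha> < E.F \<alpha>"
    and slope1: "E.slope 1 < P.slope 1"
    and slope0: "P.F 0 < 1 \<or> P.F 0 = 1 \<and> P.slope 0 < E.slope 0"
    and \<tau>: "E.slope 0 \<le> \<tau>" "\<tau> \<le> E.slope 1"
  shows "locally_dominated \<tau>"
proof -
  obtain \<alpha> where \<alpha>: "0 \<le> \<alpha>" "\<alpha> \<le> 1" "E.slope \<alpha> = \<tau>"
    using IVT'[of E.slope 0 \<tau> 1] \<tau> E.isCont_slope by (auto intro: continuous_at_imp_continuous_on)
  consider "0 < \<alpha>" "\<alpha> < 1" | "\<alpha> = 1" | "\<alpha> = 0" "P.F 0 < 1" | "\<alpha> = 0" "P.F 0 = 1" "P.slope 0 < E.slope 0"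
    using \<alpha> slope0 by linarith
  \<comment> \<open>In the interior \<beta> = \<alpha> works because \<open>lt\<close> is strict. At
    the ends source and target exponents agree, and \<beta> moves off the end in the direction in
    which the source exponent decreases, unless \<open>P.F 0 < 1\<close> already provides the gap at
    \<beta> = 0.\<close>
  then have "\<exists>\<beta>. 0 \<le> \<beta> \<and> \<beta> \<le> 1 \<and> (1 - \<beta>) * \<tau> + P.L \<beta> < E.L \<alpha> + (1 - \<alpha>) * \<tau>"
  proof cases
    case 1
    then have "P.L \<alpha> < E.L \<alpha>" unfolding E.L_def P.L_def using lt E.F_pos P.F_pos by simp
    with \<alpha> show ?thesis by (intro exI[of _ \<alpha>]) auto
  next
    case 2
    have "((\<lambda>\<beta>. (1 - \<beta>) * \<tau> + P.L \<beta>) has_real_derivative P.slope 1 - \<tau>) (at 1)"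
      by (auto intro!: derivative_eq_intros P.L_deriv)
    from DERIV_pos_inc_left[OF this] obtain d where d: "0 < d"
      "\<And>h. 0 < h \<Longrightarrow> h < d \<Longrightarrow> (1 - (1 - h)) * \<tau> + P.L (1 - h) < P.L 1"
      using slope1 \<tau> by auto
    define h where "h = min (1 / 2) (d / 2)"
    have "0 < h" "h < d" "h < 1" using d(1) by (auto simp: h_def)
    then show ?thesis
      using d(2)[of h] assms(1,3) 2 by (intro exI[of _ "1 - h"]) (simp add: P.L_def[of 1] E.L_def)
  next
    case 3
    have "P.L 0 < 0" unfolding P.L_def using 3(2) P.F_pos by simp
    then show ?thesis using 3 assms(2) by (intro exI[of _ 0]) (simp add: E.L_def)
  next
    case 4
    have "((\<lambda>\<beta>. (1 - \<beta>) * \<tau> + P.L \<beta>) has_real_derivative P.slope 0 - \<tau>) (at 0)"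
      by (auto intro!: derivative_eq_intros P.L_deriv)
    from DERIV_neg_dec_right[OF this] obtain d where d: "0 < d"
      "\<And>h. 0 < h \<Longrightarrow> h < d \<Longrightarrow> (1 - h) * \<tau> + P.L h < \<tau> + P.L 0"
      using 4 \<tau> by auto
    define h where "h = min (1 / 2) (d / 2)"
    have "0 < h" "h < d" "h < 1" using d(1) by (auto simp: h_def)
    then show ?thesis
      using d(2)[of h] assms(2) 4 by (intro exI[of _ h]) (simp add: P.L_def[of 0] E.L_def)
  qed
  then show ?thesis using overlap_local[OF \<alpha>(1,2) _ _ \<alpha>(3)] by blast
qed

section \<open>Reversal of the roles and uniformity in the threshold\<close>

lemma dominated_swap:
  assumes "0 < t" "divergence_comparison.dominated J Y X J' Y' X' m (1 / t)"
  shows "dominated m t"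
proof -
  interpret S: divergence_comparison I y x J Y X I' y' x' J' Y' X'
    by (rule swapped_comparison)
  have "(\<Sum>j\<in>A. max 0 (u j - t * v j)) = t * (\<Sum>j\<in>A. max 0 (v j - 1 / t * u j)) + ((\<Sum>j\<in>A. u j) - t * (\<Sum>j\<in>A. v j))"
    for A :: "'e set" and u v
  proof -
    \<comment> \<open>The hinge of the reversed pair differs by a scaling and an affine term; the
      latter has the same sum for source and target.\<close>
    have "max 0 (u j - t * v j) = t * max 0 (v j - 1 / t * u j) + (u j - t * v j)" for j
      using assms(1) by (auto simp: max_def field_simps)
    then show ?thesis by (simp add: sum.distrib sum_subtractf sum_distrib_left)
  qed
  from this[of "X m" "Y m" "J m"] this[of "X' m" "Y' m" "J' m"] show ?thesis
    using assms by (simp add: dominated_def S.dominated_def sum_X sum_X' sum_Y sum_Y')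
qed

lemma locally_dominated_swap:
  assumes "divergence_comparison.locally_dominated J Y X J' Y' X' (- \<tau>)"
  shows "locally_dominated \<tau>"
proof -
  interpret S: divergence_comparison I y x J Y X I' y' x' J' Y' X'
    by (rule swapped_comparison)
  obtain \<eta> where \<eta>: "0 < \<eta>"
    "\<forall>\<^sub>F m in sequentially. \<forall>\<sigma>. \<bar>\<sigma> - - \<tau>\<bar> < \<eta> \<longrightarrow> S.dominated m (exp (real m * \<sigma>))"
    using assms unfolding S.locally_dominated_def by blast
  from \<eta>(2) have "\<forall>\<^sub>F m in sequentially. \<forall>\<sigma>. \<bar>\<sigma> - \<tau>\<bar> < \<eta> \<longrightarrow> dominated m (exp (real m * \<sigma>))"
  proof eventually_elim
    case (elim m)
    show ?case
    proof (intro allI impI)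
      fix \<sigma> assume "\<bar>\<sigma> - \<tau>\<bar> < \<eta>"
      then have "S.dominated m (exp (real m * (- \<sigma>)))" by (intro elim[rule_format]) (simp add: abs_minus_commute)
      then show "dominated m (exp (real m * \<sigma>))"
        by (intro dominated_swap) (simp_all add: exp_minus inverse_eq_divide)
    qed
  qed
  with \<eta>(1) show ?thesis by (auto simp: locally_dominated_def)
qed

text \<open>\<open>M\<close> and \<open>N\<close> bound the log-ratios of the target per factor, so
  that only thresholds between \<open>- N\<close> and \<open>M\<close> are critical, and this
  compact interval is covered by the local results. The assumption \<open>reverse\<close> separates
  sources in which \<open>y\<close> has mass outside the support of \<open>x\<close>; for these the
  low thresholds are settled by the singular case.\<close>

theorem eventually_dominated:
  assumes F1: "P.F 1 = 1" "E.F 0 = 1" "E.F 1 = 1"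
    and gt: "\<And>\<alpha>. 1 < \<alpha> \<Longrightarrow> E.F \<alpha> < P.F \<alpha>"
    and lt: "\<And>\<alpha>. 0 < \<alpha> \<Longrightarrow> \<alpha> < 1 \<Longrightarrow> P.F \<alpha> < E.F \<alpha>"
    and slope1: "E.slope 1 < P.slope 1"
    and M: "\<And>m j. j \<in> J' m \<Longrightarrow> X' m j \<le> exp (real m * M) * Y' m j"
      "\<exists>i\<in>I. 0 < y i \<and> exp M * y i < x i"
    and N: "\<And>m j. j \<in> J' m \<Longrightarrow> Y' m j \<le> exp (real m * N) * X' m j"
    and reverse: "P.F 0 < 1 \<or> P.F 0 = 1 \<and> (\<forall>\<alpha><0. E.F \<alpha> < P.F \<alpha>) \<and> P.slope 0 < E.slope 0 \<and>
      (\<exists>i\<in>I. 0 < x i \<and> exp N * x i < y i)"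
  shows "\<forall>\<^sub>F m in sequentially. \<forall>t. dominated m t"
proof -
  interpret S: divergence_comparison I y x J Y X I' y' x' J' Y' X'
    by (rule swapped_comparison)
  have local: "locally_dominated \<tau>" if "- N \<le> \<tau>" "\<tau> \<le> M" for \<tau>
  proof -
    consider "E.slope 1 < \<tau>" | "E.slope 0 \<le> \<tau>" "\<tau> \<le> E.slope 1" | "\<tau> < E.slope 0" "P.F 0 < 1"
      | "\<tau> < E.slope 0" "\<not> P.F 0 < 1" by linarith
    then show ?thesis
    proof cases
      case 1
      then show ?thesis using F1 gt M(2) that by (intro excess_region[of M]) auto
    next
      case 2
      then show ?thesis using F1 lt slope1 reverse by (intro overlap_region) auto
    next
      case 3
      then have "S.locally_dominated (- \<tau>)"
        using F1 by (intro S.excess_region_singular)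
          (simp_all add: rsum_swap[of _ y] rsum_swap[of _ y'] E.swapped_slope)
      then show ?thesis by (rule locally_dominated_swap)
    next
      case 4
      then have "S.locally_dominated (- \<tau>)"
        using F1 reverse that by (intro S.excess_region[of N])
          (auto simp: rsum_swap[of _ y] rsum_swap[of _ y'] E.swapped_slope)
      then show ?thesis by (rule locally_dominated_swap)
    qed
  qed
  \<comment> \<open>Comparing total masses at \<open>m = 1\<close> shows that the interval of
    critical thresholds is nonempty, as the Bolzano induction requires.\<close>
  have "(\<Sum>j\<in>J' 1. X' 1 j) \<le> (\<Sum>j\<in>J' 1. exp (real 1 * M) * Y' 1 j)"
    "(\<Sum>j\<in>J' 1. Y' 1 j) \<le> (\<Sum>j\<in>J' 1. exp (real 1 * N) * X' 1 j)"
    by (intro sum_mono M(1) N; assumption)+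
  then have "0 \<le> M" "0 \<le> N" by (simp_all add: sum_X' sum_Y' flip: sum_distrib_left)
  then have "- N \<le> M" by simp
  then have "\<forall>\<^sub>F m in sequentially. \<forall>\<sigma>. - N \<le> \<sigma> \<and> \<sigma> \<le> M \<longrightarrow> dominated m (exp (real m * \<sigma>))"
  proof (induction rule: Bolzano)
    case (trans a b c)
    from trans(1,2) show ?case
      by eventually_elim (meson linear)
  next
    case (local \<tau>)
    then obtain \<eta> where \<eta>: "0 < \<eta>"
      "\<forall>\<^sub>F m in sequentially. \<forall>\<sigma>. \<bar>\<sigma> - \<tau>\<bar> < \<eta> \<longrightarrow> dominated m (exp (real m * \<sigma>))"
      using \<open>\<And>\<tau>. - N \<le> \<tau> \<Longrightarrow> \<tau> \<le> M \<Longrightarrow> locally_dominated \<tau>\<close> unfolding locally_dominated_def by blast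
    show ?case
    proof (intro exI[of _ \<eta>] conjI allI impI \<eta>(1))
      fix a b assume ab: "a \<le> \<tau> \<and> \<tau> \<le> b \<and> b - a < \<eta>"
      from \<eta>(2) show "\<forall>\<^sub>F m in sequentially. \<forall>\<sigma>. a \<le> \<sigma> \<and> \<sigma> \<le> b \<longrightarrow> dominated m (exp (real m * \<sigma>))"
        by eventually_elim (use ab in auto)
    qed
  qed
  with eventually_gt_at_top[of 0] show ?thesis
  proof eventually_elim
    case (elim m)
    show ?case
    proof
      fix t :: real
      have lower: "1 - t \<le> (\<Sum>j\<in>J m. max 0 (X m j - t * Y m j))"
      proof -
        have "1 - t = (\<Sum>j\<in>J m. X m j - t * Y m j)"
          by (simp add: sum_subtractf sum_X sum_Y flip: sum_distrib_left)
        also have "\<dots> \<le> (\<Sum>j\<in>J m. max 0 (X m j - t * Y m j))" by (intro sum_mono) auto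
        finally show ?thesis .
      qed
      \<comment> \<open>By \<open>lower\<close> no source hinge falls below \<open>1 - t\<close>;
        the target attains this value as soon as all its ratios are at least
        \<open>t\<close>.\<close>
      have upper: "dominated m t" if "\<And>j. j \<in> J' m \<Longrightarrow> t * Y' m j \<le> X' m j"
      proof -
        have "(\<Sum>j\<in>J' m. max 0 (X' m j - t * Y' m j)) = (\<Sum>j\<in>J' m. X' m j - t * Y' m j)"
          using that by (intro sum.cong) auto
        also have "\<dots> = 1 - t"
          by (simp add: sum_subtractf sum_X' sum_Y' flip: sum_distrib_left)
        finally show ?thesis using lower by (simp add: dominated_def)
      qed
      show "dominated m t"
      proof (cases "0 < t")
        case False
        then have "t * Y' m j \<le> X' m j" if "j \<in> J' m" for j
          using X'_pos[OF that] Y'_pos[OF that] by (smt (verit) mult_nonpos_nonneg)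
        then show ?thesis by (rule upper)
      next
        case True
        define \<sigma> where "\<sigma> = ln t / real m"
        have t: "t = exp (real m * \<sigma>)" using True elim(1) by (simp add: \<sigma>_def)
        consider "- N \<le> \<sigma>" "\<sigma> \<le> M" | "\<sigma> < - N" | "M < \<sigma>" by linarith
        then show ?thesis
        proof cases
          case 1
          then show ?thesis using elim(2) t by auto
        next
          case 2
          have "t * Y' m j \<le> X' m j" if j: "j \<in> J' m" for j
          proof -
            have "real m * \<sigma> \<le> real m * (- N)" using 2 by (intro mult_left_mono) auto
            then have "t * Y' m j \<le> exp (real m * (- N)) * (exp (real m * N) * X' m j)"
              unfolding t using N[OF j] Y'_pos[OF j] by (intro mult_mono) auto
            then show ?thesis by (simp flip: mult.assoc exp_add)
          qed
          then show ?thesis by (rule upper)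
        next
          case 3
          have "X' m j \<le> t * Y' m j" if j: "j \<in> J' m" for j
          proof -
            have "exp (real m * M) * Y' m j \<le> t * Y' m j"
              unfolding t using 3 Y'_pos[OF j] by (intro mult_right_mono) (auto intro: mult_left_mono)
            then show ?thesis using M(1)[OF j] by simp
          qed
          then have "(\<Sum>j\<in>J' m. max 0 (X' m j - t * Y' m j)) = 0"
            by (intro sum.neutral) auto
          then show ?thesis by (simp add: dominated_def sum_nonneg)
        qed
      qed
    qed
  qed
qed

end

section \<open>Kronecker products and majorization\<close>

text \<open>General in \<phi>, so that the rules for Kronecker products and concatenations serve the
  power sums, the hinge sums and plain total masses alike.\<close>

definition pairsum :: "(real \<Rightarrow> real \<Rightarrow> real) \<Rightarrow> real vec \<Rightarrow> real vec \<Rightarrow> real" where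
  "pairsum \<phi> v w = (\<Sum>i<dim_vec v. \<phi> (v $ i) (w $ i))"

abbreviation vec_rsum :: "nat \<Rightarrow> real vec \<Rightarrow> real vec \<Rightarrow> real \<Rightarrow> real" where
  "vec_rsum n v w \<equiv> rsum {..<n} (vec_index v) (vec_index w)"

lemma rsum_eq_pairsum:
  "vec_rsum (dim_vec v) v w \<alpha> = pairsum (\<lambda>x y. x powr \<alpha> * y powr (1 - \<alpha>)) v w"
  by (simp add: rsum_def pairsum_def)

lemma dim_kron_vec [simp]: "dim_vec (v \<otimes>\<^sub>v w) = dim_vec v * dim_vec w"
  by (simp add: kron_vec_def)

lemma dim_kron_power [simp]: "dim_vec (kron_power v m) = dim_vec v ^ m"
  by (induction m) auto

lemma sum_div_mod:
  fixes f :: "nat \<Rightarrow> nat \<Rightarrow> 'a :: comm_monoid_add"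
  shows "(\<Sum>k<a * b. f (k div b) (k mod b)) = (\<Sum>i<a. \<Sum>j<b. f i j)"
proof -
  have "(\<Sum>k<a * b. f (k div b) (k mod b)) = (\<Sum>i<a. \<Sum>k = i * b..<i * b + b. f (k div b) (k mod b))"
    by (rule sum.nat_group[symmetric])
  also have "\<dots> = (\<Sum>i<a. \<Sum>j<b. f i j)"
  proof (rule sum.cong)
    fix i
    have "(\<Sum>k = i * b..<i * b + b. f (k div b) (k mod b)) = (\<Sum>j = 0..<b. f ((j + i * b) div b) ((j + i * b) mod b))"
      using sum.shift_bounds_nat_ivl[of "\<lambda>k. f (k div b) (k mod b)" 0 "i * b" b] by (simp add: add.commute)
    also have "\<dots> = (\<Sum>j<b. f i j)"
      by (intro sum.cong) auto
    finally show "(\<Sum>k = i * b..<i * b + b. f (k div b) (k mod b)) = (\<Sum>j<b. f i j)" .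
  qed simp
  finally show ?thesis .
qed

lemma pairsum_kron:
  assumes "dim_vec v = dim_vec v'" "dim_vec w = dim_vec w'"
  shows "pairsum \<phi> (v \<otimes>\<^sub>v w) (v' \<otimes>\<^sub>v w')
    = pairsum (\<lambda>a b. pairsum (\<lambda>c d. \<phi> (a * c) (b * d)) w w') v v'"
  unfolding pairsum_def
  using assms by (simp add: kron_vec_def
      flip: sum_div_mod[where f = "\<lambda>i j. \<phi> (v $ i * w $ j) (v' $ i * w' $ j)"])

lemma pairsum_commute:
  "pairsum (\<lambda>a b. pairsum (\<lambda>c d. g a b c d) w w') v v' = pairsum (\<lambda>c d. pairsum (\<lambda>a b. g a b c d) v v') w w'"
  unfolding pairsum_def by (rule sum.swap)

lemma pairsum_mult:
  "pairsum (\<lambda>a b. pairsum (\<lambda>c d. \<phi> a b * \<psi> c d) w w') v v' = pairsum \<phi> v v' * pairsum \<psi> w w'"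
  by (simp add: pairsum_def sum_product)

lemma pairsum_kron_mult:
  assumes "dim_vec v = dim_vec v'" "dim_vec w = dim_vec w'"
    and "\<And>a b c d. \<phi> (a * c) (b * d) = \<phi> a b * \<phi> c d"
  shows "pairsum \<phi> (v \<otimes>\<^sub>v w) (v' \<otimes>\<^sub>v w') = pairsum \<phi> v v' * pairsum \<phi> w w'"
  using assms by (simp add: pairsum_kron pairsum_mult)

lemma pairsum_kron_power:
  assumes "dim_vec v = dim_vec v'" "\<And>a b c d. \<phi> (a * c) (b * d) = \<phi> a b * \<phi> c d" "\<phi> 1 1 = 1"
  shows "pairsum \<phi> (kron_power v m) (kron_power v' m) = pairsum \<phi> v v' ^ m"
  using assms by (induction m) (simp_all add: pairsum_kron_mult, simp add: pairsum_def)

lemma rsum_kron: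
  assumes "dim_vec v = dim_vec v'" "dim_vec w = dim_vec w'"
  shows "vec_rsum (dim_vec v * dim_vec w) (v \<otimes>\<^sub>v w) (v' \<otimes>\<^sub>v w') \<alpha>
    = vec_rsum (dim_vec v) v v' \<alpha> * vec_rsum (dim_vec w) w w' \<alpha>"
  using pairsum_kron_mult[OF assms, of "\<lambda>x y. x powr \<alpha> * y powr (1 - \<alpha>)"]
  by (simp add: rsum_eq_pairsum powr_mult mult_ac flip: dim_kron_vec)

lemma rsum_kron_power:
  assumes "dim_vec v = dim_vec v'"
  shows "vec_rsum (dim_vec v ^ m) (kron_power v m) (kron_power v' m) \<alpha>
    = vec_rsum (dim_vec v) v v' \<alpha> ^ m"
  using pairsum_kron_power[OF assms, of "\<lambda>x y. x powr \<alpha> * y powr (1 - \<alpha>)"]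
  by (simp add: rsum_eq_pairsum powr_mult mult_ac flip: dim_kron_power)

lemma pairsum_append:
  assumes "dim_vec v = dim_vec v'" "dim_vec w = dim_vec w'"
  shows "pairsum \<phi> (v @\<^sub>v w) (v' @\<^sub>v w') = pairsum \<phi> v v' + pairsum \<phi> w w'"
proof -
  have "(\<Sum>i<dim_vec v + dim_vec w. f i) = (\<Sum>i<dim_vec v. f i) + (\<Sum>i<dim_vec w. f (dim_vec v + i))"
    for f :: "nat \<Rightarrow> real"
  proof -
    have "(\<Sum>i<a + b. f i) = (\<Sum>i<a. f i) + (\<Sum>i<b. f (a + i))" for a b
      by (induction b) (simp_all add: add.assoc)
    then show ?thesis .
  qed
  then show ?thesis using assms by (simp add: pairsum_def)
qed

section \<open>Concatenation and the telescoping vector\<close>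

lemma dim_concat_map:
  "dim_vec (concat_vec (map f xs)) = (\<Sum>x\<leftarrow>xs. dim_vec (f x))"
  by (induction xs) (simp_all add: concat_vec_def)

lemma pairsum_concat_map:
  assumes "\<And>x. x \<in> set xs \<Longrightarrow> dim_vec (f x) = dim_vec (g x)"
  shows "pairsum \<phi> (concat_vec (map f xs)) (concat_vec (map g xs)) = (\<Sum>x\<leftarrow>xs. pairsum \<phi> (f x) (g x))"
  using assms
proof (induction xs)
  case Nil
  then show ?case by (simp add: concat_vec_def pairsum_def)
next
  case (Cons x xs)
  then have "pairsum \<phi> (concat_vec (map f xs)) (concat_vec (map g xs)) = (\<Sum>x\<leftarrow>xs. pairsum \<phi> (f x) (g x))"
    by simp
  moreover have "dim_vec (concat_vec (map f xs)) = dim_vec (concat_vec (map g xs))"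
    using Cons.prems by (simp add: dim_concat_map cong: map_cong)
  ultimately show ?case
    using pairsum_append[of "f x" "g x"] Cons.prems by (simp add: concat_vec_def)
qed

lemma dim_telescope_vec:
  "dim_vec (telescope_vec m q p) = (\<Sum>l\<leftarrow>[0..<Suc m]. dim_vec q ^ l * dim_vec p ^ (m - l))"
  by (simp add: telescope_vec_def dim_concat_map del: upt_Suc)

lemma pairsum_telescope:
  assumes "dim_vec q = dim_vec q'" "dim_vec p = dim_vec p'"
  shows "pairsum \<phi> (telescope_vec m q p) (telescope_vec m q' p') =
    (\<Sum>l\<le>m. pairsum (\<lambda>a b. pairsum (\<lambda>c d. \<phi> (1 / (real m + 1) * (a * c)) (1 / (real m + 1) * (b * d)))
      (kron_power p (m - l)) (kron_power p' (m - l))) (kron_power q l) (kron_power q' l))"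
proof -
  have dims: "dim_vec (concat_vec (map (\<lambda>l. kron_power q l \<otimes>\<^sub>v kron_power p (m - l)) [0..<Suc m])) =
      dim_vec (concat_vec (map (\<lambda>l. kron_power q' l \<otimes>\<^sub>v kron_power p' (m - l)) [0..<Suc m]))"
    by (simp add: dim_concat_map assms del: upt_Suc)
  have "pairsum \<phi> (c \<cdot>\<^sub>v v) (c \<cdot>\<^sub>v v') = pairsum (\<lambda>x y. \<phi> (c * x) (c * y)) v v'"
    if "dim_vec v = dim_vec v'" for c v v'
    using that by (simp add: pairsum_def)
  from this[OF dims] show ?thesis
    unfolding telescope_vec_def
    by (simp add: pairsum_concat_map assms pairsum_kron sum_list_sum_nth atLeast0LessThan
        interv_sum_list_conv_sum_set_nat flip: lessThan_Suc_atMost del: upt_Suc)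
qed

text \<open>Tensoring the telescope with \<open>p\<close> and with \<open>q\<close> produces the same blocks, except for the first block of
  the former and the last one of the latter.\<close>

lemma pairsum_telescope_le:
  assumes "dim_vec q = dim_vec q'" "dim_vec p = dim_vec p'"
    and "pairsum (\<lambda>x y. \<phi> (1 / (real m + 1) * x) (1 / (real m + 1) * y)) (kron_power q (Suc m)) (kron_power q' (Suc m))
      \<le> pairsum (\<lambda>x y. \<phi> (1 / (real m + 1) * x) (1 / (real m + 1) * y)) (kron_power p (Suc m)) (kron_power p' (Suc m))"
  shows "pairsum \<phi> (telescope_vec m q p \<otimes>\<^sub>v q) (telescope_vec m q' p' \<otimes>\<^sub>v q')
    \<le> pairsum \<phi> (telescope_vec m q p \<otimes>\<^sub>v p) (telescope_vec m q' p' \<otimes>\<^sub>v p')"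
proof -
  define \<psi> where "\<psi> x y = \<phi> (1 / (real m + 1) * x) (1 / (real m + 1) * y)" for x y
  \<comment> \<open>The block with \<open>l\<close> factors \<open>q\<close> and \<open>k\<close>
    factors \<open>p\<close>; the normalisation of the telescope is hidden in \<psi>.\<close>
  define K where "K l k = pairsum (\<lambda>a b. pairsum (\<lambda>c d. \<psi> (a * c) (b * d))
      (kron_power p k) (kron_power p' k)) (kron_power q l) (kron_power q' l)" for l k
  have one: "pairsum \<chi> (kron_power v 0) (kron_power v' 0) = \<chi> 1 1" for \<chi> v v'
    by (simp add: pairsum_def)
  have K0: "K 0 (Suc m) = pairsum \<psi> (kron_power p (Suc m)) (kron_power p' (Suc m))"
    unfolding K_def one by simp
  have Km: "K (Suc m) 0 = pairsum \<psi> (kron_power q (Suc m)) (kron_power q' (Suc m))"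
    unfolding K_def one by simp
  have dims: "dim_vec (telescope_vec m q p) = dim_vec (telescope_vec m q' p')"
    by (simp add: dim_telescope_vec assms)
  have P: "pairsum \<phi> (telescope_vec m q p \<otimes>\<^sub>v p) (telescope_vec m q' p' \<otimes>\<^sub>v p') = (\<Sum>l\<le>m. K l (Suc (m - l)))"
  proof -
    have "pairsum \<phi> (telescope_vec m q p \<otimes>\<^sub>v p) (telescope_vec m q' p' \<otimes>\<^sub>v p') =
       (\<Sum>l\<le>m. pairsum (\<lambda>a b. pairsum (\<lambda>c d. pairsum (\<lambda>e f. \<psi> (a * (e * c)) (b * (f * d))) p p')
         (kron_power p (m - l)) (kron_power p' (m - l))) (kron_power q l) (kron_power q' l))"
      by (simp add: pairsum_kron[OF dims assms(2)] pairsum_telescope[OF assms(1,2)] \<psi>_def mult_ac)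
    also have "\<dots> = (\<Sum>l\<le>m. K l (Suc (m - l)))"
      by (subst pairsum_commute[of _ p p']) (simp add: K_def pairsum_kron assms)
    finally show ?thesis .
  qed
  have Q: "pairsum \<phi> (telescope_vec m q p \<otimes>\<^sub>v q) (telescope_vec m q' p' \<otimes>\<^sub>v q') = (\<Sum>l\<le>m. K (Suc l) (m - l))"
  proof -
    have "pairsum \<phi> (telescope_vec m q p \<otimes>\<^sub>v q) (telescope_vec m q' p' \<otimes>\<^sub>v q') =
       (\<Sum>l\<le>m. pairsum (\<lambda>a b. pairsum (\<lambda>c d. pairsum (\<lambda>e f. \<psi> (e * a * c) (f * b * d)) q q')
         (kron_power p (m - l)) (kron_power p' (m - l))) (kron_power q l) (kron_power q' l))"
      by (simp add: pairsum_kron[OF dims assms(1)] pairsum_telescope[OF assms(1,2)] \<psi>_def mult_ac)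
    also have "\<dots> = (\<Sum>l\<le>m. K (Suc l) (m - l))"
      \<comment> \<open>The added factor \<open>q\<close> stands innermost; it is moved past the
        block of \<open>p\<close> and then past that of \<open>q\<close>, whose first factor it
        becomes.\<close>
      by (subst pairsum_commute[of _ q q'], subst pairsum_commute[of _ q q'])
        (simp add: K_def pairsum_kron assms)
    finally show ?thesis .
  qed
  have "(\<Sum>l\<le>m. K l (Suc (m - l))) = (\<Sum>l\<le>m. K l (Suc m - l))"
    by (intro sum.cong) (auto simp: Suc_diff_le)
  also have "\<dots> + K (Suc m) 0 = (\<Sum>l\<le>Suc m. K l (Suc m - l))" by simp
  also have "\<dots> = K 0 (Suc m) + (\<Sum>l\<le>m. K (Suc l) (m - l))"
    by (subst sum.atMost_Suc_shift) simp
  finally show ?thesis using P Q K0 Km assms(3) by (simp add: \<psi>_def[abs_def])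
qed

text \<open>Strassen's coupling is applied to the weights \<open>a2\<close> and the ratios
  \<open>a1 / a2\<close>. Divided by the source weight it is a channel; its second marginal says
  that \<open>a2\<close> goes to \<open>b2\<close>, and the martingale condition that
  \<open>a1\<close> goes to \<open>b1\<close>.\<close>

lemma majorizesI:
  assumes dims: "dim_vec a1 = dim_vec a2" "dim_vec b1 = dim_vec b2" "0 < dim_vec b1"
    and pos: "\<And>j. j < dim_vec a2 \<Longrightarrow> 0 < a2 $ j" "\<And>i. i < dim_vec b2 \<Longrightarrow> 0 < b2 $ i"
    and sums: "(\<Sum>i<dim_vec b1. b1 $ i) = (\<Sum>j<dim_vec a1. a1 $ j)"
      "(\<Sum>i<dim_vec b2. b2 $ i) = (\<Sum>j<dim_vec a2. a2 $ j)"
    and hinge: "\<And>t. pairsum (\<lambda>x y. max 0 (x - t * y)) b1 b2 \<le> pairsum (\<lambda>x y. max 0 (x - t * y)) a1 a2"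
  shows "majorizes a1 a2 b1 b2"
proof -
  let ?N = "dim_vec a1" and ?M = "dim_vec b1"
  define m where "m j = (if j < ?N then a2 $ j else 0)" for j
  define r where "r j = a1 $ j / a2 $ j" for j
  define s where "s i = b1 $ i / b2 $ i" for i
  have mr: "m j * r j = a1 $ j" "m j * max 0 (r j - t) = max 0 (a1 $ j - t * a2 $ j)" if "j < ?N" for j t
    using that pos(1)[of j] dims by (auto simp: m_def r_def max_def field_simps)
  have ns: "b2 $ i * s i = b1 $ i" "b2 $ i * max 0 (s i - t) = max 0 (b1 $ i - t * b2 $ i)" if "i < ?M" for i t
    using that pos(2)[of i] dims by (auto simp: s_def max_def field_simps)
  have "\<exists>K. (\<forall>i j. 0 \<le> K i j) \<and> (\<forall>j\<in>{..<?N}. (\<Sum>i\<in>{..<?M}. K i j) = m j) \<and>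
    (\<forall>i\<in>{..<?M}. (\<Sum>j\<in>{..<?N}. K i j) = b2 $ i \<and> (\<Sum>j\<in>{..<?N}. K i j * r j) = b2 $ i * s i)"
  proof (rule strassen_coupling)
    show "0 \<le> m j" for j using pos(1)[of j] dims by (auto simp: m_def)
    show "sum m {..<?N} = (\<Sum>i<?M. b2 $ i)" using sums(2) dims by (simp add: m_def)
    show "(\<Sum>j<?N. m j * r j) = (\<Sum>i<?M. b2 $ i * s i)" using sums(1) by (simp add: mr ns)
    show "(\<Sum>i<?M. b2 $ i * max 0 (s i - t)) \<le> (\<Sum>j<?N. m j * max 0 (r j - t))" for t
      using hinge[of t] by (simp add: mr ns pairsum_def)
  qed (use dims pos in auto)
  then obtain K where K0: "\<forall>i j. 0 \<le> K i j" "\<forall>j\<in>{..<?N}. (\<Sum>i\<in>{..<?M}. K i j) = m j"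
    "\<forall>i\<in>{..<?M}. (\<Sum>j\<in>{..<?N}. K i j) = b2 $ i \<and> (\<Sum>j\<in>{..<?N}. K i j * r j) = b2 $ i * s i"
    by blast
  then have K: "\<And>i j. 0 \<le> K i j" "\<And>j. j < ?N \<Longrightarrow> (\<Sum>i<?M. K i j) = a2 $ j"
    "\<And>i. i < ?M \<Longrightarrow> (\<Sum>j<?N. K i j) = b2 $ i" "\<And>i. i < ?M \<Longrightarrow> (\<Sum>j<?N. K i j * r j) = b1 $ i"
    by (simp_all add: m_def ns)
  define T where "T = mat ?M ?N (\<lambda>(i, j). K i j / a2 $ j)"
  have T: "T \<in> stochastic_mats ?M ?N"
    using K(1,2) pos(1) order_less_irrefl[of "0 :: real"] dims
    by (force simp: T_def stochastic_mats_def less_imp_le simp flip: sum_divide_distrib)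
  have ap: "(T *\<^sub>v a) $ i = (\<Sum>j<?N. K i j / a2 $ j * a $ j)" if "dim_vec a = ?N" "i < ?M" for a i
    using that by (simp add: T_def scalar_prod_def atLeast0LessThan)
  have "T *\<^sub>v a1 = b1"
  proof (rule eq_vecI)
    fix i assume i: "i < dim_vec b1"
    then show "(T *\<^sub>v a1) $ i = b1 $ i"
      using K(4)[OF i] by (subst ap) (auto simp: r_def)
  qed (simp add: T_def)
  moreover have "T *\<^sub>v a2 = b2"
  proof (rule eq_vecI)
    fix i assume "i < dim_vec b2"
    then have i: "i < ?M" using dims by simp
    have "(\<Sum>j<?N. K i j / a2 $ j * a2 $ j) = (\<Sum>j<?N. K i j)"
      using pos(1) dims by (intro sum.cong) (auto simp: less_imp_neq[symmetric])
    then show "(T *\<^sub>v a2) $ i = b2 $ i"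
      using K(3)[OF i] i dims by (subst ap) auto
  qed (use dims in \<open>simp add: T_def\<close>)
  ultimately show ?thesis using T dims unfolding majorizes_def by auto
qed

lemma majorizesE:
  assumes "majorizes a1 a2 b1 b2"
  obtains t where "dim_vec a1 = dim_vec a2" "dim_vec b1 = dim_vec b2" "\<And>i j. 0 \<le> t i j"
    "\<And>j. j < dim_vec a1 \<Longrightarrow> (\<Sum>i<dim_vec b1. t i j) = 1"
    "\<And>i. i < dim_vec b1 \<Longrightarrow> b1 $ i = (\<Sum>j<dim_vec a1. t i j * a1 $ j)"
    "\<And>i. i < dim_vec b1 \<Longrightarrow> b2 $ i = (\<Sum>j<dim_vec a1. t i j * a2 $ j)"
proof -
  obtain T where dims: "dim_vec a1 = dim_vec a2" "dim_vec b1 = dim_vec b2"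
    and T: "T \<in> stochastic_mats (dim_vec b1) (dim_vec a1)" "T *\<^sub>v a1 = b1" "T *\<^sub>v a2 = b2"
    using assms by (auto simp: majorizes_def)
  define t where "t i j = (if i < dim_vec b1 \<and> j < dim_vec a1 then T $$ (i, j) else 0)" for i j
  have carrier: "T \<in> carrier_mat (dim_vec b1) (dim_vec a1)" using T by (simp add: stochastic_mats_def)
  have ap: "(T *\<^sub>v a) $ i = (\<Sum>j<dim_vec a1. t i j * a $ j)" if "dim_vec a = dim_vec a1" "i < dim_vec b1" for a i
    using that carrier by (auto simp: scalar_prod_def atLeast0LessThan t_def)
  show ?thesis
  proof (rule that[of t])
    show "b1 $ i = (\<Sum>j<dim_vec a1. t i j * a1 $ j)" if "i < dim_vec b1" for i
      using ap[of a1 i] that T(2) by simp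
    show "b2 $ i = (\<Sum>j<dim_vec a1. t i j * a2 $ j)" if "i < dim_vec b1" for i
      using ap[of a2 i] that T(3) dims by simp
  qed (use T(1) dims in \<open>auto simp: t_def stochastic_mats_def\<close>)
qed

section \<open>Strict inequalities for mixtures\<close>

text \<open>By the mean value theorem the difference of the two sides is
  \<open>\<alpha> * ((w - 1) * (z powr (\<alpha> - 1) - 1))\<close> with \<open>z\<close> between 1
  and \<open>w\<close>, and the signs of the factors decide.\<close>

lemma powr_tangent_at_one:
  fixes w \<alpha> :: real
  assumes "0 < w" "w \<noteq> 1"
  shows "1 < \<alpha> \<or> \<alpha> < 0 \<Longrightarrow> 1 + \<alpha> * (w - 1) < w powr \<alpha>"
    and "0 < \<alpha> \<Longrightarrow> \<alpha> < 1 \<Longrightarrow> w powr \<alpha> < 1 + \<alpha> * (w - 1)"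
proof -
  have deriv: "((\<lambda>w. w powr \<alpha>) has_real_derivative \<alpha> * z powr (\<alpha> - 1)) (at z)" if "0 < z" for z
    using that by (auto intro!: derivative_eq_intros)
  obtain z where z: "0 < z" "1 < z \<longleftrightarrow> 1 < w" "z \<noteq> 1" and eq: "w powr \<alpha> - 1 = (w - 1) * (\<alpha> * z powr (\<alpha> - 1))"
  proof (cases "1 < w")
    case True
    obtain z where "1 < z" "z < w" "w powr \<alpha> - 1 powr \<alpha> = (w - 1) * (\<alpha> * z powr (\<alpha> - 1))"
      using MVT2[OF True, of "\<lambda>w. w powr \<alpha>" "\<lambda>z. \<alpha> * z powr (\<alpha> - 1)"] deriv by auto
    then show ?thesis using True by (intro that[of z]) auto
  next
    case False
    then have w: "w < 1" using assms by simp
    obtain z where "w < z" "z < 1" "1 powr \<alpha> - w powr \<alpha> = (1 - w) * (\<alpha> * z powr (\<alpha> - 1))"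
      using MVT2[OF w, of "\<lambda>w. w powr \<alpha>" "\<lambda>z. \<alpha> * z powr (\<alpha> - 1)"] deriv assms by force
    then show ?thesis using w assms by (intro that[of z]) (auto simp: algebra_simps)
  qed
  have D: "w powr \<alpha> - (1 + \<alpha> * (w - 1)) = \<alpha> * ((w - 1) * (z powr (\<alpha> - 1) - 1))"
    using eq by (simp add: algebra_simps)
  have up: "0 < (w - 1) * (z powr (\<alpha> - 1) - 1)" if "1 < \<alpha>"
    using that z assms powr_less_mono2[of "\<alpha> - 1" 1 z] powr_less_mono2[of "\<alpha> - 1" z 1]
    by (cases "1 < w") (auto intro: mult_pos_pos mult_neg_neg)
  have down: "(w - 1) * (z powr (\<alpha> - 1) - 1) < 0" if "\<alpha> < 1"
    using that z assms powr_less_mono2_neg[of "\<alpha> - 1" 1 z] powr_less_mono2_neg[of "\<alpha> - 1" z 1]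
    by (cases "1 < w") (auto intro: mult_pos_neg mult_neg_pos)
  show "1 + \<alpha> * (w - 1) < w powr \<alpha>" if "1 < \<alpha> \<or> \<alpha> < 0"
  proof -
    have "0 < \<alpha> * ((w - 1) * (z powr (\<alpha> - 1) - 1))"
      using that up down by (auto intro: mult_pos_pos mult_neg_neg)
    then show ?thesis using D by linarith
  qed
  show "w powr \<alpha> < 1 + \<alpha> * (w - 1)" if "0 < \<alpha>" "\<alpha> < 1"
  proof -
    have "\<alpha> * ((w - 1) * (z powr (\<alpha> - 1) - 1)) < 0"
      using that down by (auto intro: mult_pos_neg)
    then show ?thesis using D by linarith
  qed
qed

text \<open>The tangent plane of the homogeneous function \<open>x\<^sup>\<alpha> y\<^sup>1\<^sup>-\<^sup>\<alpha>\<close> along the ray \<open>x = V y\<close>.\<close>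

definition tangent :: "real \<Rightarrow> real \<Rightarrow> real \<Rightarrow> real \<Rightarrow> real" where
  "tangent \<alpha> V x y = (1 - \<alpha>) * V powr \<alpha> * y + \<alpha> * V powr (\<alpha> - 1) * x"

lemma tangent_scaled:
  assumes "0 < V" "0 < x" "0 < y"
  shows "tangent \<alpha> V x y = V powr \<alpha> * y * (1 + \<alpha> * (x / (V * y) - 1))"
    and "x powr \<alpha> * y powr (1 - \<alpha>) = V powr \<alpha> * y * (x / (V * y)) powr \<alpha>"
  using assms by (simp_all add: tangent_def powr_diff powr_divide powr_mult field_simps)

lemma tangent_on_ray: "0 < V \<Longrightarrow> tangent \<alpha> V (V * y) y = V powr \<alpha> * y"
  by (simp add: tangent_def powr_diff field_simps)

lemma tangent_less:
  assumes "0 < V" "0 < y" "1 < \<alpha> \<and> 0 \<le> x \<or> \<alpha> < 0 \<and> 0 < x" "x \<noteq> V * y"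
  shows "tangent \<alpha> V x y < x powr \<alpha> * y powr (1 - \<alpha>)"
proof (cases "x = 0")
  case True
  then show ?thesis using assms by (auto simp: tangent_def intro!: mult_neg_pos)
next
  case False
  then have x: "0 < x" using assms by auto
  have "1 + \<alpha> * (x / (V * y) - 1) < (x / (V * y)) powr \<alpha>"
    using assms x by (intro powr_tangent_at_one) (auto simp: field_simps)
  then show ?thesis using assms x by (simp add: tangent_scaled[OF assms(1) x assms(2)])
qed

lemma less_tangent:
  assumes "0 < V" "0 \<le> x" "0 \<le> y" "0 < \<alpha>" "\<alpha> < 1" "x \<noteq> V * y"
  shows "x powr \<alpha> * y powr (1 - \<alpha>) < tangent \<alpha> V x y"
proof -
  consider "x = 0" "0 < y" | "0 < x" "y = 0" | "0 < x" "0 < y" using assms by fastforce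
  then show ?thesis
  proof cases
    case 3
    have "(x / (V * y)) powr \<alpha> < 1 + \<alpha> * (x / (V * y) - 1)"
      using assms 3 by (intro powr_tangent_at_one) (auto simp: field_simps)
    then show ?thesis using assms 3 by (simp add: tangent_scaled[OF assms(1) 3])
  qed (use assms in \<open>auto simp: tangent_def\<close>)
qed

lemma tangent_eq: "0 < V \<Longrightarrow> 0 \<le> y \<Longrightarrow> (V * y) powr \<alpha> * y powr (1 - \<alpha>) = tangent \<alpha> V (V * y) y"
  by (cases "y = 0") (simp add: tangent_def, simp add: tangent_on_ray powr_mult powr_diff)

text \<open>At \<open>y = 0\<close> the convention \<open>0 powr a = 0\<close> makes the right-hand
  side zero, although for \<alpha> > 1 and \<open>x > 0\<close> the natural value is infinite; the
  last hypothesis excludes this.\<close>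

lemma tangent_le:
  assumes "0 < V" "0 \<le> y" "1 < \<alpha> \<and> 0 \<le> x \<or> \<alpha> < 0 \<and> 0 < x" "y = 0 \<Longrightarrow> x = 0"
  shows "tangent \<alpha> V x y \<le> x powr \<alpha> * y powr (1 - \<alpha>)"
  using tangent_less[of V y \<alpha> x] tangent_eq[of V y \<alpha>] assms
  by (cases "x = V * y"; cases "y = 0") (auto simp: less_imp_le)

lemma le_tangent:
  assumes "0 < V" "0 \<le> x" "0 \<le> y" "0 < \<alpha>" "\<alpha> < 1"
  shows "x powr \<alpha> * y powr (1 - \<alpha>) \<le> tangent \<alpha> V x y"
  using less_tangent[of V x y \<alpha>] tangent_eq[of V y \<alpha>] assms
  by (cases "x = V * y") (auto simp: less_imp_le)

lemma tangent_one: "tangent \<alpha> 1 x y = (1 - \<alpha>) * y + \<alpha> * x"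
  by (simp add: tangent_def)

lemma sum_tangent:
  "(\<Sum>i\<in>I. tangent \<alpha> V (x i) (y i)) = tangent \<alpha> V (\<Sum>i\<in>I. x i) (\<Sum>i\<in>I. y i)"
  by (simp add: tangent_def sum.distrib sum_distrib_left)

lemma tangent_scale: "tangent \<alpha> V (c * x) (c * y) = c * tangent \<alpha> V x y"
  by (simp add: tangent_def algebra_simps)

lemma tangent_add: "tangent \<alpha> V (x + x') (y + y') = tangent \<alpha> V x y + tangent \<alpha> V x' y'"
  by (simp add: tangent_def algebra_simps)

text \<open>The tangents along \<open>x = y\<close> sum to 1 because both totals are 1, and an index
  where the entries differ makes the comparison strict.\<close>

lemma one_less_rsum:
  assumes "finite I" "\<And>i. i \<in> I \<Longrightarrow> 0 < y i"
    and "\<And>i. i \<in> I \<Longrightarrow> 1 < \<alpha> \<and> 0 \<le> x i \<or> \<alpha> < 0 \<and> 0 < x i"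
    and "sum x I = 1" "sum y I = 1" "\<exists>i\<in>I. x i \<noteq> y i"
  shows "1 < rsum I x y \<alpha>"
proof -
  have "1 = (\<Sum>i\<in>I. tangent \<alpha> 1 (x i) (y i))" unfolding sum_tangent assms(4,5) by (simp add: tangent_one)
  also have "\<dots> < rsum I x y \<alpha>"
    unfolding rsum_def
  proof (rule sum_strict_mono_ex1[OF assms(1)])
    show "\<forall>i\<in>I. tangent \<alpha> 1 (x i) (y i) \<le> x i powr \<alpha> * y i powr (1 - \<alpha>)"
      using assms(2,3) by (intro ballI tangent_le) (force dest: less_imp_le)+
    show "\<exists>i\<in>I. tangent \<alpha> 1 (x i) (y i) < x i powr \<alpha> * y i powr (1 - \<alpha>)"
    proof -
      obtain i where i: "i \<in> I" "x i \<noteq> y i" using assms(6) by blast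
      then show ?thesis using assms(2,3)[OF i(1)] by (intro bexI[OF _ i(1)] tangent_less) auto
    qed
  qed
  finally show ?thesis .
qed

lemma rsum_less_one:
  assumes "finite I" "\<And>i. i \<in> I \<Longrightarrow> 0 \<le> x i" "\<And>i. i \<in> I \<Longrightarrow> 0 \<le> y i" "0 < \<alpha>" "\<alpha> < 1"
    and "sum x I = 1" "sum y I = 1" "\<exists>i\<in>I. x i \<noteq> y i"
  shows "rsum I x y \<alpha> < 1"
proof -
  have "rsum I x y \<alpha> < (\<Sum>i\<in>I. tangent \<alpha> 1 (x i) (y i))"
    unfolding rsum_def
  proof (rule sum_strict_mono_ex1[OF assms(1)])
    show "\<forall>i\<in>I. x i powr \<alpha> * y i powr (1 - \<alpha>) \<le> tangent \<alpha> 1 (x i) (y i)"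
      using assms by (intro ballI le_tangent) auto
    show "\<exists>i\<in>I. x i powr \<alpha> * y i powr (1 - \<alpha>) < tangent \<alpha> 1 (x i) (y i)"
    proof -
      obtain i where i: "i \<in> I" "x i \<noteq> y i" using assms(8) by blast
      then show ?thesis using assms(2,3)[OF i(1)] assms(4,5) by (intro bexI[OF _ i(1)] less_tangent) auto
    qed
  qed
  also have "\<dots> = 1" unfolding sum_tangent assms(6,7) by (simp add: tangent_one)
  finally show ?thesis .
qed

text \<open>Joint convexity: the tangent at the ratio of the mixture is linear, touches at the
  mixture and lies below at both constituents. The constituent \<open>(v, v)\<close> contributes
  exactly \<delta>.\<close>

lemma rsum_mix_le:
  assumes "\<And>i. i \<in> I \<Longrightarrow> 0 < v i" "sum v I = 1" "0 < \<delta>" "\<delta> < 1"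
    and "\<And>i. i \<in> I \<Longrightarrow> 1 < \<alpha> \<and> 0 \<le> u i \<or> \<alpha> < 0 \<and> 0 < u i"
  shows "rsum I (\<lambda>i. (1 - \<delta>) * u i + \<delta> * v i) v \<alpha> \<le> (1 - \<delta>) * rsum I u v \<alpha> + \<delta>"
proof -
  have "rsum I (\<lambda>i. (1 - \<delta>) * u i + \<delta> * v i) v \<alpha> \<le> (\<Sum>i\<in>I. (1 - \<delta>) * (u i powr \<alpha> * v i powr (1 - \<alpha>)) + \<delta> * v i)"
    unfolding rsum_def
  proof (rule sum_mono)
    fix i assume i: "i \<in> I"
    let ?e = "(1 - \<delta>) * u i + \<delta> * v i" and ?V = "((1 - \<delta>) * u i + \<delta> * v i) / v i"
    have e: "0 < ?e" "?e = ?V * v i" and v: "0 < v i"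
      using assms(1,3,4) assms(5)[OF i] i by (auto intro!: add_nonneg_pos simp: less_imp_neq[symmetric])
    then have V: "0 < ?V" by simp
    have "?e powr \<alpha> * v i powr (1 - \<alpha>) = tangent \<alpha> ?V ?e (v i)"
      using tangent_eq[OF V, of "v i" \<alpha>] v by simp
    also have "\<dots> = (1 - \<delta>) * tangent \<alpha> ?V (u i) (v i) + \<delta> * tangent \<alpha> ?V (v i) (v i)"
      by (simp flip: tangent_scale tangent_add) (simp add: algebra_simps)
    also have "\<dots> \<le> (1 - \<delta>) * (u i powr \<alpha> * v i powr (1 - \<alpha>)) + \<delta> * (v i powr \<alpha> * v i powr (1 - \<alpha>))"
      using assms(3,4) assms(5)[OF i] v V by (intro add_mono mult_left_mono tangent_le) auto
    finally show "?e powr \<alpha> * v i powr (1 - \<alpha>) \<le> (1 - \<delta>) * (u i powr \<alpha> * v i powr (1 - \<alpha>)) + \<delta> * v i"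
      using v by (simp flip: powr_add)
  qed
  also have "\<dots> = (1 - \<delta>) * rsum I u v \<alpha> + \<delta>"
    by (simp add: sum.distrib rsum_def sum_distrib_left assms(2) flip: sum_distrib_left)
  finally show ?thesis .
qed

lemma rsum_mix_ge:
  assumes "\<And>i. i \<in> I \<Longrightarrow> 0 < v i" "sum v I = 1" "0 < \<delta>" "\<delta> < 1" "0 < \<alpha>" "\<alpha> < 1"
    and "\<And>i. i \<in> I \<Longrightarrow> 0 \<le> u i"
  shows "(1 - \<delta>) * rsum I u v \<alpha> + \<delta> \<le> rsum I (\<lambda>i. (1 - \<delta>) * u i + \<delta> * v i) v \<alpha>"
proof -
  have "(1 - \<delta>) * rsum I u v \<alpha> + \<delta> = (\<Sum>i\<in>I. (1 - \<delta>) * (u i powr \<alpha> * v i powr (1 - \<alpha>)) + \<delta> * v i)"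
    by (simp add: sum.distrib rsum_def sum_distrib_left assms(2) flip: sum_distrib_left)
  also have "\<dots> \<le> rsum I (\<lambda>i. (1 - \<delta>) * u i + \<delta> * v i) v \<alpha>"
    unfolding rsum_def
  proof (rule sum_mono)
    fix i assume i: "i \<in> I"
    let ?e = "(1 - \<delta>) * u i + \<delta> * v i" and ?V = "((1 - \<delta>) * u i + \<delta> * v i) / v i"
    have e: "0 < ?e" "?e = ?V * v i" and v: "0 < v i"
      using assms(1,3,4) assms(7)[OF i] i by (auto intro!: add_nonneg_pos simp: less_imp_neq[symmetric])
    then have V: "0 < ?V" by simp
    have "(1 - \<delta>) * (u i powr \<alpha> * v i powr (1 - \<alpha>)) + \<delta> * v i
        = (1 - \<delta>) * (u i powr \<alpha> * v i powr (1 - \<alpha>)) + \<delta> * (v i powr \<alpha> * v i powr (1 - \<alpha>))"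
      using v by (simp flip: powr_add)
    also have "\<dots> \<le> (1 - \<delta>) * tangent \<alpha> ?V (u i) (v i) + \<delta> * tangent \<alpha> ?V (v i) (v i)"
      using assms(3-6) assms(7)[OF i] v V by (intro add_mono mult_left_mono le_tangent) auto
    also have "\<dots> = tangent \<alpha> ?V ?e (v i)"
      by (simp flip: tangent_scale tangent_add) (simp add: algebra_simps)
    also have "\<dots> = ?e powr \<alpha> * v i powr (1 - \<alpha>)"
      using tangent_eq[OF V, of "v i" \<alpha>] v by simp
    finally show "(1 - \<delta>) * (u i powr \<alpha> * v i powr (1 - \<alpha>)) + \<delta> * v i \<le> ?e powr \<alpha> * v i powr (1 - \<alpha>)" .
  qed
  finally show ?thesis .
qed

section \<open>Relative entropy under mixing\<close>

lemma ln_tangent_le: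
  fixes z :: real
  assumes "0 < z"
  shows "1 - 1 / z \<le> ln z"
  using ln_le_minus_one[of "1 / z"] assms by (simp add: ln_div)

text \<open>Tangents of the logarithm at the ratio of the mixture \<open>e\<close> leave the
  corrections \<open>u i - e\<close> and \<open>v i - e\<close>, which cancel under the weights 1 -
  \<delta> and \<delta>.\<close>

lemma relative_entropy_mix_le:
  assumes "\<And>i. i \<in> I \<Longrightarrow> 0 < v i" "\<And>i. i \<in> I \<Longrightarrow> 0 \<le> u i" "0 < \<delta>" "\<delta> < (1 :: real)"
  shows "(\<Sum>i\<in>I. ((1 - \<delta>) * u i + \<delta> * v i) * (ln ((1 - \<delta>) * u i + \<delta> * v i) - ln (v i)))
    \<le> (1 - \<delta>) * (\<Sum>i\<in>I. u i * (ln (u i) - ln (v i)))"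
  unfolding sum_distrib_left
proof (rule sum_mono)
  fix i assume i: "i \<in> I"
  define e where "e = (1 - \<delta>) * u i + \<delta> * v i"
  have v: "0 < v i" and u: "0 \<le> u i" using assms(1,2) i by auto
  have e: "0 < e" using assms(3,4) u v by (auto simp: e_def intro!: add_nonneg_pos)
  define l where "l = ln e - ln (v i)"
  have "u i * l + (u i - e) \<le> u i * (ln (u i) - ln (v i))"
  proof (cases "u i = 0")
    case False
    with u have u: "0 < u i" by simp
    have "u i * (1 - e / u i) \<le> u i * (ln (u i) - ln e)"
      using ln_tangent_le[of "u i / e"] u e by (intro mult_left_mono) (auto simp: ln_div)
    then show ?thesis using u by (simp add: l_def algebra_simps)
  qed (use e in simp)
  then have 1: "(1 - \<delta>) * (u i * l + (u i - e)) \<le> (1 - \<delta>) * (u i * (ln (u i) - ln (v i)))"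
    using assms(4) by (intro mult_left_mono) auto
  have "v i * (1 - e / v i) \<le> v i * (- l)"
    using ln_tangent_le[of "v i / e"] v e by (intro mult_left_mono) (auto simp: ln_div l_def)
  then have "\<delta> * (v i * l + (v i - e)) \<le> \<delta> * 0"
    using assms(3) v by (intro mult_left_mono) (auto simp: algebra_simps)
  moreover have "(1 - \<delta>) * (u i * l + (u i - e)) + \<delta> * (v i * l + (v i - e)) = e * l"
    unfolding e_def by (simp add: algebra_simps)
  ultimately have "e * l \<le> (1 - \<delta>) * (u i * (ln (u i) - ln (v i)))" using 1 by simp
  then show "((1 - \<delta>) * u i + \<delta> * v i) * (ln ((1 - \<delta>) * u i + \<delta> * v i) - ln (v i))
      \<le> (1 - \<delta>) * (u i * (ln (u i) - ln (v i)))"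
    by (simp add: e_def l_def)
qed

text \<open>Concavity of the logarithm, entry by entry: here the mixture stands only in the second
  argument of the divergence.\<close>

lemma reverse_entropy_mix_ge:
  assumes "\<And>i. i \<in> I \<Longrightarrow> 0 < v i" "\<And>i. i \<in> I \<Longrightarrow> 0 < u i" "0 < \<delta>" "\<delta> < (1 :: real)"
  shows "(1 - \<delta>) * (\<Sum>i\<in>I. v i * (ln (u i) - ln (v i)))
    \<le> (\<Sum>i\<in>I. v i * (ln ((1 - \<delta>) * u i + \<delta> * v i) - ln (v i)))"
  unfolding sum_distrib_left
proof (rule sum_mono)
  fix i assume i: "i \<in> I"
  define e where "e = (1 - \<delta>) * u i + \<delta> * v i"
  have v: "0 < v i" and u: "0 < u i" using assms(1,2) i by auto
  have e: "0 < e" using assms(3,4) u v by (auto simp: e_def intro!: add_nonneg_pos)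
  have 1: "(1 - \<delta>) * ln (u i) \<le> (1 - \<delta>) * (ln e + (u i / e - 1))"
    using ln_le_minus_one[of "u i / e"] u e assms(4) by (intro mult_left_mono) (auto simp: ln_div)
  have 2: "\<delta> * ln (v i) \<le> \<delta> * (ln e + (v i / e - 1))"
    using ln_le_minus_one[of "v i / e"] v e assms(3) by (intro mult_left_mono) (auto simp: ln_div)
  have "(1 - \<delta>) * (u i / e) + \<delta> * (v i / e) = e / e"
    unfolding add_divide_distrib[symmetric] times_divide_eq_right by (simp add: e_def)
  then have "(1 - \<delta>) * (ln e + (u i / e - 1)) + \<delta> * (ln e + (v i / e - 1)) = ln e"
    using e by (simp add: algebra_simps)
  with 1 2 have "(1 - \<delta>) * ln (u i) + \<delta> * ln (v i) \<le> ln e" by linarith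
  then have "(1 - \<delta>) * (ln (u i) - ln (v i)) \<le> ln e - ln (v i)" by (simp add: algebra_simps)
  then have "v i * ((1 - \<delta>) * (ln (u i) - ln (v i))) \<le> v i * (ln e - ln (v i))"
    using v by (intro mult_left_mono) auto
  then show "(1 - \<delta>) * (v i * (ln (u i) - ln (v i))) \<le> v i * (ln ((1 - \<delta>) * u i + \<delta> * v i) - ln (v i))"
    by (simp add: e_def mult_ac)
qed

text \<open>Gibbs' inequality: each term is at least \<open>x i - y i\<close>, strictly unless the
  entries agree, and these differences sum to zero.\<close>

lemma relative_entropy_pos:
  assumes "finite I" "\<And>i. i \<in> I \<Longrightarrow> 0 \<le> x i" "\<And>i. i \<in> I \<Longrightarrow> 0 < y i"
    and "sum x I = 1" "sum y I = (1 :: real)" "\<exists>i\<in>I. x i \<noteq> y i"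
  shows "0 < (\<Sum>i\<in>I. x i * (ln (x i) - ln (y i)))"
proof -
  have strict: "x i - y i < x i * (ln (x i) - ln (y i))" if "i \<in> I" "x i \<noteq> y i" for i
  proof (cases "x i = 0")
    case False
    with that assms have x: "0 < x i" and y: "0 < y i" by (force simp: order_less_le)+
    have "ln (y i / x i) < y i / x i - 1"
      using ln_le_minus_one[of "y i / x i"] ln_eq_minus_one[of "y i / x i"] x y that by force
    then have "x i * (1 - y i / x i) < x i * (ln (x i) - ln (y i))"
      using x y by (intro mult_strict_left_mono) (auto simp: ln_div)
    then show ?thesis using x by (simp add: algebra_simps)
  qed (use that assms in auto)
  have "0 = (\<Sum>i\<in>I. x i - y i)" by (simp add: sum_subtractf assms)
  also have "\<dots> < (\<Sum>i\<in>I. x i * (ln (x i) - ln (y i)))"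
  proof (rule sum_strict_mono_ex1[OF assms(1)])
    show "\<forall>i\<in>I. x i - y i \<le> x i * (ln (x i) - ln (y i))"
    proof
      fix i assume "i \<in> I"
      then show "x i - y i \<le> x i * (ln (x i) - ln (y i))"
        using strict[of i] by (cases "x i = y i") auto
    qed
    show "\<exists>i\<in>I. x i - y i < x i * (ln (x i) - ln (y i))" using strict assms(6) by blast
  qed
  finally show ?thesis .
qed

section \<open>Entries of Kronecker powers\<close>

lemma kron_power_Suc_index:
  assumes "k < dim_vec v ^ Suc m"
  obtains i j where "i < dim_vec v" "j < dim_vec v ^ m"
    "\<And>w. dim_vec w = dim_vec v \<Longrightarrow> kron_power w (Suc m) $ k = w $ i * kron_power w m $ j"
proof
  have pos: "0 < dim_vec v ^ m" using assms by (cases "dim_vec v ^ m = 0") auto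
  show "k div dim_vec v ^ m < dim_vec v" using assms by (simp add: less_mult_imp_div_less)
  show "k mod dim_vec v ^ m < dim_vec v ^ m" using pos by simp
  show "kron_power w (Suc m) $ k = w $ (k div dim_vec v ^ m) * kron_power w m $ (k mod dim_vec v ^ m)"
    if "dim_vec w = dim_vec v" for w
    using assms that by (simp add: kron_vec_def)
qed

lemma kron_power_nonneg:
  assumes "\<And>i. i < dim_vec v \<Longrightarrow> 0 \<le> v $ i" "k < dim_vec v ^ m"
  shows "0 \<le> kron_power v m $ k"
  using assms(2)
proof (induction m arbitrary: k)
  case (Suc m)
  then show ?case using assms(1) by (elim kron_power_Suc_index) (simp del: kron_power.simps)
qed simp

lemma kron_power_pos:
  assumes "\<And>i. i < dim_vec v \<Longrightarrow> 0 < v $ i" "k < dim_vec v ^ m"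
  shows "0 < kron_power v m $ k"
  using assms(2)
proof (induction m arbitrary: k)
  case (Suc m)
  then show ?case using assms(1) by (elim kron_power_Suc_index) (simp del: kron_power.simps)
qed simp

lemma kron_power_le:
  assumes "dim_vec v = dim_vec w" "\<And>i. i < dim_vec v \<Longrightarrow> 0 \<le> v $ i \<and> v $ i \<le> c * w $ i" "k < dim_vec v ^ m"
  shows "kron_power v m $ k \<le> c ^ m * kron_power w m $ k"
  using assms(3)
proof (induction m arbitrary: k)
  case (Suc m)
  from Suc.prems obtain i j where ij: "i < dim_vec v" "j < dim_vec v ^ m"
    "\<And>w. dim_vec w = dim_vec v \<Longrightarrow> kron_power w (Suc m) $ k = w $ i * kron_power w m $ j"
    by (rule kron_power_Suc_index) blast
  have "v $ i * kron_power v m $ j \<le> (c * w $ i) * (c ^ m * kron_power w m $ j)"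
    using assms(2)[OF ij(1)] Suc.IH[OF ij(2)] kron_power_nonneg[OF _ ij(2)] assms(2)
    by (intro mult_mono) auto
  then show ?case using ij(3)[of v] ij(3)[of w] assms(1) by (simp add: mult_ac del: kron_power.simps)
qed simp

lemma sum_kron_power: "(\<Sum>k<dim_vec v ^ m. kron_power v m $ k) = (\<Sum>i<dim_vec v. v $ i) ^ m"
  using pairsum_kron_power[of v v "\<lambda>x y. x" m] by (simp add: pairsum_def)

lemma kron_divergence_powers:
  assumes "dim_vec v = n" "dim_vec w = n" "\<And>i. i < n \<Longrightarrow> 0 \<le> v $ i" "\<And>i. i < n \<Longrightarrow> 0 \<le> w $ i"
    and "\<exists>i<n. 0 < v $ i \<and> 0 < w $ i"
  shows "divergence_powers {..<n} (vec_index v) (vec_index w) (\<lambda>m. {..<n ^ m})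
    (\<lambda>m. vec_index (kron_power v m)) (\<lambda>m. vec_index (kron_power w m))"
proof unfold_locales
  show "\<exists>i\<in>{..<n}. 0 < v $ i \<and> 0 < w $ i" using assms(5) by blast
  show "0 \<le> kron_power v m $ j" if "j \<in> {..<n ^ m}" for m j
    using that assms by (intro kron_power_nonneg) auto
  show "0 \<le> kron_power w m $ j" if "j \<in> {..<n ^ m}" for m j
    using that assms by (intro kron_power_nonneg) auto
  show "vec_rsum (n ^ m) (kron_power v m) (kron_power w m) \<alpha>
      = vec_rsum n v w \<alpha> ^ m" for m \<alpha>
    using rsum_kron_power[of v w m \<alpha>] assms by simp
qed (use assms in auto)

section \<open>Orders between dichotomies and the effect of mixing\<close>

lemma prob_vecsD:
  assumes "p \<in> prob_vecs n"
  shows "dim_vec p = n" "\<And>i. i < n \<Longrightarrow> 0 \<le> p $ i" "(\<Sum>i<n. p $ i) = 1"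
  using assms by (auto simp: prob_vecs_def)

lemma prob_vecs_support:
  assumes "p \<in> prob_vecs n"
  obtains i where "i < n" "0 < p $ i"
proof -
  have "\<exists>i<n. p $ i \<noteq> 0"
    using prob_vecsD(3)[OF assms] by (metis lessThan_iff sum.neutral zero_neq_one)
  then show ?thesis using that prob_vecsD(2)[OF assms] by (force simp: order_less_le)
qed

text \<open>A negative \<open>\<alpha>\<close> stands for the order \<open>1 - \<alpha>\<close> of the reversed dichotomies. Without full support of \<open>p1\<close> the
  reversed divergence is infinite; the convention \<open>0 powr \<alpha> = 0\<close> would then give a meaningless finite sum.\<close>

definition divergence_order :: "nat \<Rightarrow> real vec \<Rightarrow> real vec \<Rightarrow> real vec \<Rightarrow> real vec \<Rightarrow> bool" where
  "divergence_order n p1 p2 q1 q2 \<longleftrightarrow>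
    (\<forall>\<alpha>>1. vec_rsum n q1 q2 \<alpha> \<le> vec_rsum n p1 p2 \<alpha>) \<and>
    (\<forall>\<alpha>. 0 < \<alpha> \<and> \<alpha> < 1 \<longrightarrow>
      vec_rsum n p1 p2 \<alpha> \<le> vec_rsum n q1 q2 \<alpha>) \<and>
    ((\<forall>i<n. 0 < p1 $ i) \<longrightarrow> (\<forall>i<n. 0 < q1 $ i) \<and>
      (\<forall>\<alpha><0. vec_rsum n q1 q2 \<alpha> \<le> vec_rsum n p1 p2 \<alpha>))"

definition entropy_order :: "nat \<Rightarrow> real vec \<Rightarrow> real vec \<Rightarrow> real vec \<Rightarrow> real vec \<Rightarrow> bool" where
  "entropy_order n p1 p2 q1 q2 \<longleftrightarrow>
    (\<Sum>i<n. q1 $ i * (ln (q1 $ i) - ln (q2 $ i))) \<le> (\<Sum>i<n. p1 $ i * (ln (p1 $ i) - ln (p2 $ i)))"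

text \<open>Order infinity in cross-multiplied form. The witness is also required to maximise the
  ratio of the source, because strictness after mixing rests on that ratio exceeding 1.\<close>

definition max_ratio_order :: "nat \<Rightarrow> real vec \<Rightarrow> real vec \<Rightarrow> real vec \<Rightarrow> real vec \<Rightarrow> bool" where
  "max_ratio_order n p1 p2 q1 q2 \<longleftrightarrow>
    (\<exists>i<n. 0 < p1 $ i \<and> (\<forall>k<n. q1 $ k * p2 $ i \<le> p1 $ i * q2 $ k \<and> p1 $ k * p2 $ i \<le> p1 $ i * p2 $ k))"

text \<open>Otherwise \<open>p1\<close> would be below \<open>p2\<close> in every entry, and equal
  totals would make them equal.\<close>

lemma max_ratio_gt_one:
  assumes "p1 \<in> prob_vecs n" "p2 \<in> prob_vecs n" "\<And>i. i < n \<Longrightarrow> 0 < p2 $ i" "p1 \<noteq> p2"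
    and i: "i < n" "\<And>k. k < n \<Longrightarrow> p1 $ k * p2 $ i \<le> p1 $ i * p2 $ k"
  shows "p2 $ i < p1 $ i"
proof (rule ccontr)
  note P = prob_vecsD[OF assms(1)] prob_vecsD[OF assms(2)]
  assume "\<not> ?thesis"
  then have le: "p1 $ i \<le> p2 $ i" by simp
  have le': "p1 $ k \<le> p2 $ k" if k: "k < n" for k
  proof -
    have "p1 $ k * p2 $ i \<le> p2 $ i * p2 $ k"
      using i(2)[OF k] mult_right_mono[OF le, of "p2 $ k"] P(5)[OF k] by linarith
    then show ?thesis using assms(3)[OF i(1)] by (simp add: mult.commute)
  qed
  have "p1 = p2"
  proof (rule eq_vecI)
    fix k assume "k < dim_vec p2"
    then have k: "k < n" using P by simp
    show "p1 $ k = p2 $ k"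
    proof (rule ccontr)
      assume "p1 $ k \<noteq> p2 $ k"
      then have "p1 $ k < p2 $ k" using le'[OF k] by simp
      then have "(\<Sum>i<n. p1 $ i) < (\<Sum>i<n. p2 $ i)" using le' k by (intro sum_strict_mono_ex1) auto
      then show False using P by simp
    qed
  qed (use P in simp)
  with assms(4) show False by simp
qed

locale dichotomy_mixture =
  fixes n :: nat and p1 p2 q1 q2 :: "real vec" and \<delta> :: real
  assumes p1: "p1 \<in> prob_vecs n" and p2: "p2 \<in> prob_vecs n"
    and q1: "q1 \<in> prob_vecs n" and q2: "q2 \<in> prob_vecs n"
    and p2_pos: "i < n \<Longrightarrow> 0 < p2 $ i" and q2_pos: "i < n \<Longrightarrow> 0 < q2 $ i"
    and neq: "p1 \<noteq> p2" and \<delta>: "0 < \<delta>" "\<delta> < 1"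
begin

text \<open>All divergences of the admixture \<open>(q2, q2)\<close> vanish, so its sums are
  constantly 1 and mixing pulls every divergence of the target towards zero. It also makes
  \<open>e1\<close> positive where \<open>q1\<close> vanishes.\<close>

definition e1 where "e1 = vec n (\<lambda>i. (1 - \<delta>) * q1 $ i + \<delta> * q2 $ i)"

lemmas P1 = prob_vecsD[OF p1] and P2 = prob_vecsD[OF p2] and Q1 = prob_vecsD[OF q1] and Q2 = prob_vecsD[OF q2]

lemma dim_e1 [simp]: "dim_vec e1 = n"
  by (simp add: e1_def)

lemma e1_index: "i < n \<Longrightarrow> e1 $ i = (1 - \<delta>) * q1 $ i + \<delta> * q2 $ i"
  by (simp add: e1_def)

lemma e1_pos: "i < n \<Longrightarrow> 0 < e1 $ i"
  using \<delta> Q1(2) q2_pos by (simp add: e1_index add_nonneg_pos)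

lemma e1_prob: "e1 \<in> prob_vecs n"
  using e1_pos \<delta> Q1(3) Q2(3)
  by (auto simp: prob_vecs_def less_imp_le e1_def sum.distrib simp flip: sum_distrib_left)

lemma differ: "\<exists>i<n. p1 $ i \<noteq> p2 $ i"
  using neq P1(1) P2(1) by (metis eq_vecI)

lemma rsum_e1:
  "vec_rsum n e1 q2 \<alpha>
    = rsum {..<n} (\<lambda>i. (1 - \<delta>) * q1 $ i + \<delta> * q2 $ i) (vec_index q2) \<alpha>"
  unfolding rsum_def by (intro sum.cong) (auto simp: e1_index)

text \<open>Convexity bounds the mixed sum by the mean \<open>(1 - \<delta>) * ?P + \<delta>\<close>
  of the source value and 1, and the source value exceeds 1 because the source vectors
  differ.\<close>

lemma e1_rsum_less:
  assumes "\<And>i. i < n \<Longrightarrow> 1 < \<alpha> \<or> \<alpha> < 0 \<and> 0 < p1 $ i \<and> 0 < q1 $ i"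
    and "vec_rsum n q1 q2 \<alpha> \<le> vec_rsum n p1 p2 \<alpha>"
  shows "vec_rsum n e1 q2 \<alpha> < vec_rsum n p1 p2 \<alpha>"
proof -
  let ?P = "vec_rsum n p1 p2 \<alpha>"
  have "vec_rsum n e1 q2 \<alpha> \<le> (1 - \<delta>) * vec_rsum n q1 q2 \<alpha> + \<delta>"
    unfolding rsum_e1 using q2_pos Q2(3) Q1(2) \<delta> assms(1) by (intro rsum_mix_le) auto
  also have "\<dots> \<le> (1 - \<delta>) * ?P + \<delta>"
    using assms(2) \<delta> by (intro add_right_mono mult_left_mono) auto
  also have "\<dots> < ?P"
  proof -
    have "1 < ?P"
      using p2_pos P1(2,3) P2(3) assms(1) differ by (intro one_less_rsum) auto
    then have "\<delta> * 1 < \<delta> * ?P" using \<delta> by simp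
    then show ?thesis by (simp add: algebra_simps)
  qed
  finally show ?thesis .
qed

lemma less_e1_rsum:
  assumes "0 < \<alpha>" "\<alpha> < 1"
    and "vec_rsum n p1 p2 \<alpha> \<le> vec_rsum n q1 q2 \<alpha>"
  shows "vec_rsum n p1 p2 \<alpha> < vec_rsum n e1 q2 \<alpha>"
proof -
  let ?P = "vec_rsum n p1 p2 \<alpha>"
  have "?P < 1"
    using P1(2,3) P2(2,3) differ assms(1,2) by (intro rsum_less_one) auto
  then have "\<delta> * ?P < \<delta> * 1" using \<delta> by simp
  then have "?P < (1 - \<delta>) * ?P + \<delta>" by (simp add: algebra_simps)
  also have "\<dots> \<le> (1 - \<delta>) * vec_rsum n q1 q2 \<alpha> + \<delta>"
    using assms \<delta> by (intro add_right_mono mult_left_mono) auto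
  also have "\<dots> \<le> vec_rsum n e1 q2 \<alpha>"
    unfolding rsum_e1 using q2_pos Q2(3) Q1(2) \<delta> assms by (intro rsum_mix_ge) auto
  finally show ?thesis .
qed

lemma e1_entropy_less:
  assumes "entropy_order n p1 p2 q1 q2"
  shows "(\<Sum>i<n. e1 $ i * (ln (e1 $ i) - ln (q2 $ i))) < (\<Sum>i<n. p1 $ i * (ln (p1 $ i) - ln (p2 $ i)))"
    (is "_ < ?P")
proof -
  have pos: "0 < ?P"
    using P1(2,3) P2(3) p2_pos differ by (intro relative_entropy_pos) auto
  have "(\<Sum>i<n. e1 $ i * (ln (e1 $ i) - ln (q2 $ i)))
      = (\<Sum>i<n. ((1 - \<delta>) * q1 $ i + \<delta> * q2 $ i) * (ln ((1 - \<delta>) * q1 $ i + \<delta> * q2 $ i) - ln (q2 $ i)))"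
    by (intro sum.cong) (auto simp: e1_index)
  also have "\<dots> \<le> (1 - \<delta>) * (\<Sum>i<n. q1 $ i * (ln (q1 $ i) - ln (q2 $ i)))"
    using q2_pos Q1(2) \<delta> by (intro relative_entropy_mix_le) auto
  also have "\<dots> \<le> (1 - \<delta>) * ?P"
    using assms \<delta> unfolding entropy_order_def by (intro mult_left_mono) auto
  also have "\<dots> < ?P" using pos \<delta> by (simp add: algebra_simps)
  finally show ?thesis .
qed

lemma e1_reverse_entropy_less:
  assumes "\<And>i. i < n \<Longrightarrow> 0 < p1 $ i" "\<And>i. i < n \<Longrightarrow> 0 < q1 $ i" "entropy_order n p2 p1 q2 q1"
  shows "(\<Sum>i<n. p2 $ i * (ln (p1 $ i) - ln (p2 $ i))) < (\<Sum>i<n. q2 $ i * (ln (e1 $ i) - ln (q2 $ i)))"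
    (is "?P < _")
proof -
  have flip: "(\<Sum>i<n. x $ i * (ln (y $ i) - ln (x $ i))) = - (\<Sum>i<n. x $ i * (ln (x $ i) - ln (y $ i)))"
    for x y :: "real vec"
    by (simp flip: sum_negf) (simp add: algebra_simps)
  have "0 < (\<Sum>i<n. p2 $ i * (ln (p2 $ i) - ln (p1 $ i)))"
  proof (rule relative_entropy_pos)
    show "\<exists>i\<in>{..<n}. p2 $ i \<noteq> p1 $ i" using differ by force
  qed (use P2(2,3) P1(3) assms(1) in auto)
  then have "?P < (1 - \<delta>) * ?P" using \<delta> flip[of p2 p1] by (simp add: algebra_simps)
  also have "\<dots> \<le> (1 - \<delta>) * (\<Sum>i<n. q2 $ i * (ln (q1 $ i) - ln (q2 $ i)))"
    using assms(3) \<delta> flip[of p2 p1] flip[of q2 q1] unfolding entropy_order_def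
    by (intro mult_left_mono) auto
  also have "\<dots> \<le> (\<Sum>i<n. q2 $ i * (ln ((1 - \<delta>) * q1 $ i + \<delta> * q2 $ i) - ln (q2 $ i)))"
    using q2_pos assms(2) \<delta> by (intro reverse_entropy_mix_ge) auto
  also have "\<dots> = (\<Sum>i<n. q2 $ i * (ln (e1 $ i) - ln (q2 $ i)))"
    by (intro sum.cong) (auto simp: e1_index)
  finally show ?thesis .
qed

lemma e1_max_ratio:
  assumes "max_ratio_order n p1 p2 q1 q2"
  obtains c where "0 < c" "\<And>k. k < n \<Longrightarrow> e1 $ k \<le> c * q2 $ k" "\<exists>i<n. 0 < p2 $ i \<and> c * p2 $ i < p1 $ i"
proof -
  obtain i where i: "i < n" "0 < p1 $ i"
    "\<And>k. k < n \<Longrightarrow> q1 $ k * p2 $ i \<le> p1 $ i * q2 $ k" "\<And>k. k < n \<Longrightarrow> p1 $ k * p2 $ i \<le> p1 $ i * p2 $ k"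
    using assms unfolding max_ratio_order_def by blast
  have gt: "p2 $ i < p1 $ i" using max_ratio_gt_one[OF p1 p2 p2_pos neq i(1,4)] .
  define r where "r = p1 $ i / p2 $ i"
  have r: "1 < r" using gt p2_pos[OF i(1)] by (simp add: r_def)
  show ?thesis
  \<comment> \<open>The maximal source ratio \<open>r > 1\<close> mixed with the ratio 1 of
    \<open>(q2, q2)\<close>: it bounds the mixed target and stays below \<open>r\<close>.\<close>
  proof (rule that[of "(1 - \<delta>) * r + \<delta>"])
    show "0 < (1 - \<delta>) * r + \<delta>" using r \<delta> by (simp add: add_pos_pos)
    show "e1 $ k \<le> ((1 - \<delta>) * r + \<delta>) * q2 $ k" if k: "k < n" for k
    proof -
      have "q1 $ k \<le> r * q2 $ k" using i(3)[OF k] p2_pos[OF i(1)] by (simp add: r_def field_simps)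
      then have "(1 - \<delta>) * q1 $ k \<le> (1 - \<delta>) * (r * q2 $ k)" using \<delta> by (intro mult_left_mono) auto
      then show ?thesis by (simp add: e1_index[OF k] algebra_simps)
    qed
    have "\<delta> * 1 < \<delta> * r" using r \<delta> by simp
    then have "(1 - \<delta>) * r + \<delta> < r" by (simp add: algebra_simps)
    then have "((1 - \<delta>) * r + \<delta>) * p2 $ i < r * p2 $ i" using p2_pos[OF i(1)] by simp
    also have "r * p2 $ i = p1 $ i" using p2_pos[OF i(1)] by (simp add: r_def)
    finally show "\<exists>i<n. 0 < p2 $ i \<and> ((1 - \<delta>) * r + \<delta>) * p2 $ i < p1 $ i"
      using p2_pos[OF i(1)] i(1) by blast
  qed
qed

lemma e1_min_ratio:
  assumes "\<And>i. i < n \<Longrightarrow> 0 < p1 $ i" "max_ratio_order n p2 p1 q2 q1"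
  obtains c where "0 < c" "\<And>k. k < n \<Longrightarrow> q2 $ k \<le> c * e1 $ k" "\<exists>i<n. 0 < p1 $ i \<and> c * p1 $ i < p2 $ i"
proof -
  obtain i where i: "i < n" "0 < p2 $ i"
    "\<And>k. k < n \<Longrightarrow> q2 $ k * p1 $ i \<le> p2 $ i * q1 $ k" "\<And>k. k < n \<Longrightarrow> p2 $ k * p1 $ i \<le> p2 $ i * p1 $ k"
    using assms(2) unfolding max_ratio_order_def by blast
  have gt: "p1 $ i < p2 $ i" using max_ratio_gt_one[OF p2 p1 assms(1) neq[symmetric] i(1,4)] .
  define r where "r = p1 $ i / p2 $ i"
  have r: "0 < r" "r < 1" using gt i(2) assms(1)[OF i(1)] by (auto simp: r_def)
  \<comment> \<open>The same mixture for the minimal ratio of \<open>p1\<close> to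
    \<open>p2\<close>; as this is below 1, \<open>d\<close> lies above it. The witness is
    \<open>1 / d\<close> because the claim concerns the reversed ratio.\<close>
  define d where "d = (1 - \<delta>) * r + \<delta>"
  have "\<delta> * r < \<delta> * 1" using r \<delta> by (intro mult_strict_left_mono) auto
  then have d: "r < d" by (simp add: d_def algebra_simps)
  with r(1) have "0 < d" by simp
  note d = this d
  show ?thesis
  proof (rule that[of "1 / d"])
    show "0 < 1 / d" using d by simp
    show "q2 $ k \<le> 1 / d * e1 $ k" if k: "k < n" for k
    proof -
      have "r * q2 $ k \<le> q1 $ k" using i(2) i(3)[OF k] by (simp add: r_def field_simps)
      then have "(1 - \<delta>) * (r * q2 $ k) \<le> (1 - \<delta>) * q1 $ k" using \<delta> by (intro mult_left_mono) auto
      then have "d * q2 $ k \<le> e1 $ k" by (simp add: e1_index[OF k] d_def algebra_simps)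
      then show ?thesis using d by (simp add: field_simps)
    qed
    have "p1 $ i = r * p2 $ i" using i(2) by (simp add: r_def)
    also have "\<dots> < d * p2 $ i" using d i(2) by simp
    finally have "1 / d * p1 $ i < p2 $ i" using d by (simp add: field_simps)
    then show "\<exists>i<n. 0 < p1 $ i \<and> 1 / d * p1 $ i < p2 $ i" using i(1) assms(1) by blast
  qed
qed

theorem eventually_majorizes:
  assumes order: "divergence_order n p1 p2 q1 q2" and ent: "entropy_order n p1 p2 q1 q2"
    and max: "max_ratio_order n p1 p2 q1 q2"
    and reverse: "(\<forall>i<n. 0 < p1 $ i) \<Longrightarrow> entropy_order n p2 p1 q2 q1 \<and> max_ratio_order n p2 p1 q2 q1"
  shows "\<forall>\<^sub>F m in sequentially. \<forall>t.
    pairsum (\<lambda>x y. max 0 (x - t * y)) (kron_power e1 m) (kron_power q2 m)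
    \<le> pairsum (\<lambda>x y. max 0 (x - t * y)) (kron_power p1 m) (kron_power p2 m)"
proof -
  obtain i0 where i0: "i0 < n" "0 < p1 $ i0" using prob_vecs_support[OF p1] .
  interpret P: divergence_powers "{..<n}" "vec_index p1" "vec_index p2" "\<lambda>m. {..<n ^ m}"
    "\<lambda>m. vec_index (kron_power p1 m)" "\<lambda>m. vec_index (kron_power p2 m)"
    using P1 P2 p2_pos i0 by (intro kron_divergence_powers) auto
  interpret E: divergence_powers "{..<n}" "vec_index e1" "vec_index q2" "\<lambda>m. {..<n ^ m}"
    "\<lambda>m. vec_index (kron_power e1 m)" "\<lambda>m. vec_index (kron_power q2 m)"
    using Q2 q2_pos e1_pos i0 by (intro kron_divergence_powers) (auto simp: less_imp_le)
  have sums: "(\<Sum>j<n ^ m. kron_power v m $ j) = 1" if "v \<in> prob_vecs n" for v m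
    using sum_kron_power[of v m] prob_vecsD[OF that] by simp
  interpret C: divergence_comparison "{..<n}" "vec_index p1" "vec_index p2" "\<lambda>m. {..<n ^ m}"
    "\<lambda>m. vec_index (kron_power p1 m)" "\<lambda>m. vec_index (kron_power p2 m)"
    "{..<n}" "vec_index e1" "vec_index q2" "\<lambda>m. {..<n ^ m}"
    "\<lambda>m. vec_index (kron_power e1 m)" "\<lambda>m. vec_index (kron_power q2 m)"
    by unfold_locales (auto simp: sums p1 p2 q2 e1_prob Q2(1) intro!: kron_power_pos e1_pos q2_pos)
  have F1: "P.F 1 = 1" "E.F 0 = 1" "E.F 1 = 1"
    using P1 p2_pos Q2 e1_pos q2_pos prob_vecsD(3)[OF e1_prob]
    by (auto simp: rsum_def less_imp_neq[symmetric] less_imp_le)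
  \<comment> \<open>At orders 1 and 0 the tilted measures are the first and the second vector
    themselves, so the slopes are the relative entropy and minus the reversed one.\<close>
  have slope1: "P.slope 1 = (\<Sum>i<n. p1 $ i * (ln (p1 $ i) - ln (p2 $ i)))"
    "E.slope 1 = (\<Sum>i<n. e1 $ i * (ln (e1 $ i) - ln (q2 $ i)))"
    unfolding P.slope_def E.slope_def P.dF_def E.dF_def F1
    using P1(2) p2_pos e1_pos q2_pos
    by (auto intro!: sum.cong simp: mult.commute less_imp_neq[symmetric] less_imp_le)
  have slope0: "E.slope 0 = (\<Sum>i<n. q2 $ i * (ln (e1 $ i) - ln (q2 $ i)))"
    unfolding E.slope_def E.dF_def F1 using e1_pos q2_pos
    by (auto intro!: sum.cong simp: mult.commute less_imp_neq[symmetric] less_imp_le)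
  obtain c where c: "0 < c" "\<And>k. k < n \<Longrightarrow> e1 $ k \<le> c * q2 $ k" "\<exists>i<n. 0 < p2 $ i \<and> c * p2 $ i < p1 $ i"
    using e1_max_ratio[OF max] by blast
  have "\<exists>d>0. (\<forall>k<n. q2 $ k \<le> d * e1 $ k) \<and>
    ((\<forall>i<n. 0 < p1 $ i) \<longrightarrow> (\<exists>i<n. 0 < p1 $ i \<and> d * p1 $ i < p2 $ i))"
  proof (cases "\<forall>i<n. 0 < p1 $ i")
    case True
    then show ?thesis using e1_min_ratio reverse by metis
  next
    case False
    \<comment> \<open>With a zero in \<open>p1\<close> only the bound for the target remains to be
      shown; it comes from the share \<delta> of \<open>q2\<close> in \<open>e1\<close>.\<close>
    have "q2 $ k \<le> 1 / \<delta> * e1 $ k" if k: "k < n" for k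
    proof -
      have "0 \<le> (1 - \<delta>) * q1 $ k" using Q1(2)[OF k] \<delta> by auto
      then show ?thesis using \<delta> by (simp add: e1_index[OF k] field_simps)
    qed
    then show ?thesis using False \<delta> by (intro exI[of _ "1 / \<delta>"]) auto
  qed
  then obtain d where d: "0 < d" "\<And>k. k < n \<Longrightarrow> q2 $ k \<le> d * e1 $ k"
    "(\<forall>i<n. 0 < p1 $ i) \<Longrightarrow> (\<exists>i<n. 0 < p1 $ i \<and> d * p1 $ i < p2 $ i)" by blast
  have expm: "exp (real m * ln z) = z ^ m" if "0 < z" for z m
    using that by (simp add: exp_of_nat_mult)
  have "\<forall>\<^sub>F m in sequentially. \<forall>t. C.dominated m t"
  proof (rule C.eventually_dominated[of "ln c" "ln d"])
    show "P.F 1 = 1" "E.F 0 = 1" "E.F 1 = 1" by (fact F1)+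
    show "E.F \<alpha> < P.F \<alpha>" if "1 < \<alpha>" for \<alpha>
      using that order unfolding divergence_order_def by (intro e1_rsum_less) auto
    show "P.F \<alpha> < E.F \<alpha>" if "0 < \<alpha>" "\<alpha> < 1" for \<alpha>
      using that order unfolding divergence_order_def by (intro less_e1_rsum) auto
    show "E.slope 1 < P.slope 1" unfolding slope1 by (rule e1_entropy_less[OF ent])
    show "kron_power e1 m $ j \<le> exp (real m * ln c) * kron_power q2 m $ j" if "j \<in> {..<n ^ m}" for m j
      using that c e1_pos Q2(1) unfolding expm[OF c(1)] by (intro kron_power_le) (auto simp: less_imp_le)
    show "kron_power q2 m $ j \<le> exp (real m * ln d) * kron_power e1 m $ j" if "j \<in> {..<n ^ m}" for m j
      using that d Q2(1,2) unfolding expm[OF d(1)] by (intro kron_power_le) (auto simp: less_imp_le)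
    show "\<exists>i\<in>{..<n}. 0 < p2 $ i \<and> exp (ln c) * p2 $ i < p1 $ i" using c by auto
    show "P.F 0 < 1 \<or> P.F 0 = 1 \<and> (\<forall>\<alpha><0. E.F \<alpha> < P.F \<alpha>) \<and> P.slope 0 < E.slope 0 \<and>
      (\<exists>i\<in>{..<n}. 0 < p1 $ i \<and> exp (ln d) * p1 $ i < p2 $ i)"
    proof (cases "\<forall>i<n. 0 < p1 $ i")
      case True
      then have q1_pos: "\<forall>i<n. 0 < q1 $ i" using order by (simp add: divergence_order_def)
      have F0: "P.F 0 = 1"
        using P2 p2_pos True by (auto simp: rsum_def less_imp_neq[symmetric] less_imp_le)
      have "P.slope 0 = (\<Sum>i<n. p2 $ i * (ln (p1 $ i) - ln (p2 $ i)))"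
        unfolding P.slope_def P.dF_def F0 using True p2_pos
        by (auto intro!: sum.cong simp: mult.commute less_imp_neq[symmetric] less_imp_le)
      then have "P.slope 0 < E.slope 0"
        unfolding slope0 using True q1_pos reverse by (auto intro!: e1_reverse_entropy_less)
      moreover have "E.F \<alpha> < P.F \<alpha>" if "\<alpha> < 0" for \<alpha>
        using that order True q1_pos unfolding divergence_order_def by (intro e1_rsum_less) auto
      ultimately show ?thesis using F0 d True by auto
    next
      case False
      then obtain i where i: "i < n" "p1 $ i = 0" using P1(2) by (metis order_less_le)
      \<comment> \<open>\<open>P.F 0\<close> is the mass of \<open>p2\<close> on the support of
        \<open>p1\<close>, and index \<open>i\<close> is missing there.\<close>
      have "P.F 0 < (\<Sum>i<n. p2 $ i)"
        unfolding rsum_def using i P2(2) p2_pos by (intro sum_strict_mono_ex1) (auto intro!: bexI[of _ i])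
      then show ?thesis using P2(3) by simp
    qed
  qed
  then show ?thesis
    by (simp add: C.dominated_def pairsum_def P1(1))
qed

end

section \<open>Renyi divergences\<close>

lemma supp_prob: "p \<in> prob_vecs n \<Longrightarrow> supp_vec p = {i. i < n \<and> 0 < p $ i}"
  using prob_vecsD[of p n] by (auto simp: supp_vec_def order_less_le)

lemma rsum_on_supports:
  assumes "p \<in> prob_vecs n" "q \<in> prob_vecs n"
  shows "(\<Sum>i\<in>supp_vec p \<inter> supp_vec q. p $ i powr \<alpha> * q $ i powr (1 - \<alpha>)) = vec_rsum n p q \<alpha>"
  unfolding rsum_def using prob_vecsD(1)[OF assms(1)] prob_vecsD(1)[OF assms(2)]
  by (intro sum.mono_neutral_left) (auto simp: supp_vec_def)

lemma prob_pair:
  assumes "p \<in> prob_vecs n" "q \<in> prob_vecs n" "supp_vec p \<inter> supp_vec q \<noteq> {}"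
  shows "divergence_pair {..<n} (vec_index p) (vec_index q)"
  using prob_vecsD[OF assms(1)] prob_vecsD[OF assms(2)] assms(3)
  by unfold_locales (auto simp: supp_prob[OF assms(1)] supp_prob[OF assms(2)])

lemma renyi_div_less_one:
  assumes "p \<in> prob_vecs n" "q \<in> prob_vecs n" "supp_vec p \<inter> supp_vec q \<noteq> {}" "0 < a" "a < 1"
  shows "renyi_div (ereal a) p q = ereal (1 / (a - 1) * ln (vec_rsum n p q a))"
  using assms by (simp add: renyi_div_def Let_def rsum_on_supports)

lemma renyi_div_less_one_le_iff:
  assumes "p \<in> prob_vecs n" "p' \<in> prob_vecs n" "supp_vec p \<inter> supp_vec p' \<noteq> {}"
    and "q \<in> prob_vecs n" "q' \<in> prob_vecs n" "supp_vec q \<inter> supp_vec q' \<noteq> {}" "0 < a" "a < 1"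
  shows "renyi_div (ereal a) q q' \<le> renyi_div (ereal a) p p' \<longleftrightarrow>
    vec_rsum n p p' a \<le> vec_rsum n q q' a"
proof -
  interpret P: divergence_pair "{..<n}" "vec_index p" "vec_index p'" using assms by (intro prob_pair)
  interpret Q: divergence_pair "{..<n}" "vec_index q" "vec_index q'" using assms by (intro prob_pair)
  have "renyi_div (ereal a) q q' \<le> renyi_div (ereal a) p p' \<longleftrightarrow> 1 / (a - 1) * ln (Q.F a) \<le> 1 / (a - 1) * ln (P.F a)"
    using assms by (simp add: renyi_div_less_one)
  also have "\<dots> \<longleftrightarrow> ln (P.F a) \<le> ln (Q.F a)" using assms(8) by (simp add: divide_le_cancel)
  finally show ?thesis using P.F_pos[of a] Q.F_pos[of a] by simp
qed

locale dominated_pair =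
  fixes n :: nat and p p' :: "real vec"
  assumes p: "p \<in> prob_vecs n" and p': "p' \<in> prob_vecs n" and p'_pos: "i < n \<Longrightarrow> 0 < p' $ i"
begin

lemmas p_facts = prob_vecsD[OF p] and p'_facts = prob_vecsD[OF p']

lemma supp_p': "supp_vec p' = {..<n}"
  using p'_pos by (auto simp: supp_prob[OF p'])

lemma supp_p_subset: "supp_vec p \<subseteq> supp_vec p'"
  unfolding supp_p' using p_facts(1) by (auto simp: supp_vec_def)

lemma supp_p_nonempty: "supp_vec p \<noteq> {}"
  using prob_vecs_support[OF p] by (metis (mono_tags, lifting) empty_iff mem_Collect_eq supp_prob[OF p])

lemma supp_meet: "supp_vec p \<inter> supp_vec p' \<noteq> {}"
  using supp_p_subset supp_p_nonempty by auto

sublocale divergence_pair "{..<n}" "vec_index p" "vec_index p'"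
  by (rule prob_pair[OF p p' supp_meet])

lemma F_one: "F 1 = 1"
proof -
  have "F 1 = (\<Sum>i<n. p $ i)"
    unfolding rsum_def using p_facts(2) p'_pos by (intro sum.cong) (auto simp: less_imp_neq[symmetric])
  then show ?thesis using p_facts by simp
qed

lemma dF_one: "dF 1 = (\<Sum>i<n. p $ i * (ln (p $ i) - ln (p' $ i)))"
  unfolding dF_def using p_facts(2) p'_pos
  by (intro sum.cong) (auto simp: mult.commute less_imp_neq[symmetric])

lemma renyi_div_one: "renyi_div 1 p p' = ereal (\<Sum>i<n. p $ i * (ln (p $ i) - ln (p' $ i)))"
proof -
  have "(\<Sum>i\<in>supp_vec p. p $ i * ln (p $ i / p' $ i)) = (\<Sum>i<n. p $ i * (ln (p $ i) - ln (p' $ i)))"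
    using p'_pos by (intro sum.mono_neutral_cong_left) (auto simp: supp_prob[OF p] ln_div order_less_le dest: p_facts(2))
  then show ?thesis using supp_p_subset by (simp add: renyi_div_def Let_def)
qed

lemma renyi_div_greater_one:
  assumes "1 < a"
  shows "renyi_div (ereal a) p p' = ereal (1 / (a - 1) * ln (F a))"
  using supp_p_subset assms rsum_on_supports[OF p p', of a]
  by (simp add: renyi_div_def Let_def inf.absorb1)

lemma renyi_div_infinity: "renyi_div \<infinity> p p' = ereal (Max ((\<lambda>i. ln (p $ i / p' $ i)) ` supp_vec p))"
  using supp_p_subset by (simp add: renyi_div_def Let_def)

lemma max_ratio:
  obtains i where "i < n" "0 < p $ i" "renyi_div \<infinity> p p' = ereal (ln (p $ i / p' $ i))"
    "\<And>k. k < n \<Longrightarrow> p $ k * p' $ i \<le> p $ i * p' $ k"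
proof -
  let ?f = "\<lambda>i. ln (p $ i / p' $ i)"
  have fin: "finite (supp_vec p)" by (simp add: supp_prob[OF p])
  then have "Max (?f ` supp_vec p) \<in> ?f ` supp_vec p" using supp_p_nonempty by (intro Max_in) auto
  then obtain i where i: "i \<in> supp_vec p" "Max (?f ` supp_vec p) = ?f i" by auto
  then have i': "i < n" "0 < p $ i" by (auto simp: supp_prob[OF p])
  show ?thesis
  proof (rule that[OF i'])
    show "renyi_div \<infinity> p p' = ereal (?f i)" using i by (simp add: renyi_div_infinity)
    show "p $ k * p' $ i \<le> p $ i * p' $ k" if k: "k < n" for k
    proof (cases "0 < p $ k")
      case True
      then have "?f k \<le> ?f i" using fin k i(2)[symmetric] by (simp add: supp_prob[OF p])
      then have "p $ k / p' $ k \<le> p $ i / p' $ i" using True i' p'_pos k by simp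
      then show ?thesis using p'_pos k i' by (simp add: field_simps)
    next
      case False
      then have "p $ k = 0" using p_facts(2)[OF k] by simp
      then show ?thesis using i' p'_pos[OF k] by simp
    qed
  qed
qed

end

locale dominated_pairs = P: dominated_pair n p p' + Q: dominated_pair n q q' for n p p' q q'
begin

lemma renyi_greater_one_le_iff:
  assumes "1 < a"
  shows "renyi_div (ereal a) q q' \<le> renyi_div (ereal a) p p' \<longleftrightarrow> Q.F a \<le> P.F a"
  using assms P.F_pos[of a] Q.F_pos[of a]
  by (simp add: P.renyi_div_greater_one Q.renyi_div_greater_one divide_le_cancel)

lemma renyi_one_le_iff: "renyi_div 1 q q' \<le> renyi_div 1 p p' \<longleftrightarrow> entropy_order n p p' q q'"
  by (simp add: P.renyi_div_one Q.renyi_div_one entropy_order_def)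

lemma max_ratio_order:
  assumes "renyi_div \<infinity> q q' \<le> renyi_div \<infinity> p p'"
  shows "max_ratio_order n p p' q q'"
proof -
  obtain i where i: "i < n" "0 < p $ i" "renyi_div \<infinity> p p' = ereal (ln (p $ i / p' $ i))"
    "\<And>k. k < n \<Longrightarrow> p $ k * p' $ i \<le> p $ i * p' $ k" using P.max_ratio by blast
  obtain j where j: "j < n" "0 < q $ j" "renyi_div \<infinity> q q' = ereal (ln (q $ j / q' $ j))"
    "\<And>k. k < n \<Longrightarrow> q $ k * q' $ j \<le> q $ j * q' $ k" using Q.max_ratio by blast
  have "ln (q $ j / q' $ j) \<le> ln (p $ i / p' $ i)" using assms i(3) j(3) by simp
  then have ratio: "q $ j / q' $ j \<le> p $ i / p' $ i"
    using i(1,2) j(1,2) P.p'_pos Q.p'_pos by simp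
  have "q $ k * p' $ i \<le> p $ i * q' $ k" if k: "k < n" for k
  proof -
    have "q $ k / q' $ k \<le> q $ j / q' $ j" using j(4)[OF k] Q.p'_pos k j(1) by (simp add: field_simps)
    also note ratio
    finally show ?thesis using Q.p'_pos[OF k] P.p'_pos[OF i(1)] by (simp add: field_simps)
  qed
  then show ?thesis unfolding max_ratio_order_def using i by blast
qed

text \<open>Both sums equal 1 at order 1, so their order for \<open>a > 1\<close> passes to the
  derivatives at 1, which are the relative entropies.\<close>

lemma entropy_order_limit:
  assumes "\<And>a. 1 < a \<Longrightarrow> Q.F a \<le> P.F a"
  shows "entropy_order n p p' q q'"
proof (rule ccontr)
  assume "\<not> ?thesis"
  then have "0 < Q.dF 1 - P.dF 1" by (simp add: entropy_order_def P.dF_one Q.dF_one)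
  moreover have "((\<lambda>a. Q.F a - P.F a) has_real_derivative Q.dF 1 - P.dF 1) (at 1)"
    by (intro derivative_intros P.F_deriv Q.F_deriv)
  ultimately obtain d where d: "0 < d" "\<And>h. 0 < h \<Longrightarrow> h < d \<Longrightarrow> Q.F 1 - P.F 1 < Q.F (1 + h) - P.F (1 + h)"
    using DERIV_pos_inc_right by blast
  from d(2)[of "d / 2"] assms[of "1 + d / 2"] d(1) show False by (simp add: P.F_one Q.F_one)
qed

text \<open>With \<open>r\<close> and \<open>s\<close> the maximal ratios of source and target,
  \<open>q $ j * s powr (a - 1) \<le> Q.F a \<le> P.F a \<le> r powr (a - 1)\<close>. For large
  \<open>a\<close> this excludes \<open>r < s\<close>.\<close>

lemma renyi_infinity_limit:
  assumes "\<And>a. 1 < a \<Longrightarrow> Q.F a \<le> P.F a"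
  shows "renyi_div \<infinity> q q' \<le> renyi_div \<infinity> p p'"
proof -
  obtain i where i: "i < n" "0 < p $ i" "renyi_div \<infinity> p p' = ereal (ln (p $ i / p' $ i))"
    "\<And>k. k < n \<Longrightarrow> p $ k * p' $ i \<le> p $ i * p' $ k" using P.max_ratio by blast
  obtain j where j: "j < n" "0 < q $ j" "renyi_div \<infinity> q q' = ereal (ln (q $ j / q' $ j))"
    using Q.max_ratio by blast
  define r s where "r = p $ i / p' $ i" and "s = q $ j / q' $ j"
  have rs: "0 < r" "0 < s" using i j P.p'_pos Q.p'_pos by (auto simp: r_def s_def)
  have "s \<le> r"
  proof (rule ccontr)
    assume "\<not> s \<le> r"
    then have "1 < s / r" using rs by simp
    then obtain m where m: "1 / q $ j < (s / r) ^ m" using real_arch_pow by blast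
    \<comment> \<open>An integer value of \<open>a - 1\<close> turns \<open>powr\<close> into
      ordinary powers; the successor guarantees \<open>a > 1\<close> also for
      \<open>m = 0\<close>.\<close>
    define a where "a = real (Suc m) + 1"
    have a: "1 < a" by (simp add: a_def)
    have "q $ j * s powr (a - 1) = q $ j powr a * q' $ j powr (1 - a)"
      using j Q.p'_pos[OF j(1)] by (simp add: s_def powr_divide powr_diff field_simps)
    also have "\<dots> \<le> Q.F a"
      unfolding rsum_def using j by (intro member_le_sum) auto
    also have "\<dots> \<le> P.F a" using assms[OF a] .
    also have "\<dots> \<le> (\<Sum>k<n. p $ k * r powr (a - 1))"
      unfolding rsum_def
    proof (rule sum_mono)
      fix k assume "k \<in> {..<n}"
      then have k: "k < n" by simp
      show "p $ k powr a * p' $ k powr (1 - a) \<le> p $ k * r powr (a - 1)"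
      proof (cases "p $ k = 0")
        case False
        then have pk: "0 < p $ k" using P.p_facts(2)[OF k] by simp
        have "p $ k powr a * p' $ k powr (1 - a) = p $ k * (p $ k / p' $ k) powr (a - 1)"
          using pk P.p'_pos[OF k] by (simp add: powr_divide powr_diff field_simps)
        also have "\<dots> \<le> p $ k * r powr (a - 1)"
          using i(4)[OF k] pk P.p'_pos[OF k] P.p'_pos[OF i(1)] a
          by (intro mult_left_mono powr_mono2) (auto simp: r_def field_simps)
        finally show ?thesis .
      qed simp
    qed
    also have "\<dots> = r powr (a - 1)" by (simp add: P.p_facts flip: sum_distrib_right)
    finally have "q $ j * s ^ Suc m \<le> r ^ Suc m" using rs by (simp add: a_def powr_realpow del: power_Suc flip: of_nat_Suc)
    then have "(s / r) ^ Suc m \<le> 1 / q $ j"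
      using rs j(2) by (simp add: power_divide field_simps)
    moreover have "(s / r) ^ m \<le> (s / r) ^ Suc m" using \<open>1 < s / r\<close> by (intro power_increasing) auto
    ultimately show False using m by linarith
  qed
  then show ?thesis using rs i(3) j(3) by (simp add: r_def s_def)
qed

lemma renyi_order_ge_one:
  assumes "\<And>a. 1 < a \<Longrightarrow> Q.F a \<le> P.F a" "1 \<le> \<alpha>"
  shows "renyi_div \<alpha> q q' \<le> renyi_div \<alpha> p p'"
proof (cases \<alpha>)
  case (real a)
  show ?thesis
  proof (cases "a = 1")
    case True
    then show ?thesis using real entropy_order_limit[OF assms(1)] renyi_one_le_iff by (simp add: one_ereal_def)
  next
    case False
    with real assms(2) have "1 < a" by simp
    then show ?thesis using real assms(1) renyi_greater_one_le_iff by simp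
  qed
next
  case PInf
  then show ?thesis using renyi_infinity_limit[OF assms(1)] by simp
qed (use assms(2) in simp)

end

section \<open>Renyi domination in terms of power sums\<close>

context
  fixes n :: nat and p1 p2 q1 q2 :: "real vec"
  assumes p1: "p1 \<in> prob_vecs n" and p2: "p2 \<in> prob_vecs n"
    and q1: "q1 \<in> prob_vecs n" and q2: "q2 \<in> prob_vecs n"
    and p2_pos: "\<And>i. i < n \<Longrightarrow> 0 < p2 $ i" and q2_pos: "\<And>i. i < n \<Longrightarrow> 0 < q2 $ i"
begin

interpretation dominated_pairs n p1 p2 q1 q2
  by unfold_locales (auto simp: p1 p2 q1 q2 p2_pos q2_pos)

lemma reverse_pairs:
  assumes "\<forall>i<n. 0 < p1 $ i" "\<forall>i<n. 0 < q1 $ i"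
  shows "dominated_pairs n p2 p1 q2 q1"
  using assms by unfold_locales (auto simp: p1 p2 q1 q2)

lemma not_full_support:
  assumes "\<not> (\<forall>i<n. 0 < q $ i)" "q \<in> prob_vecs n" "p \<in> prob_vecs n" "\<And>i. i < n \<Longrightarrow> 0 < p $ i" "1 \<le> \<alpha>"
  shows "renyi_div \<alpha> p q = \<infinity>"
proof -
  have "\<not> supp_vec p \<subseteq> supp_vec q"
    using assms(1,4) by (auto simp: supp_prob[OF assms(2)] supp_prob[OF assms(3)])
  then show ?thesis using assms(5) by (auto simp: renyi_div_def Let_def)
qed

lemma renyi_dominates_orders:
  assumes dom: "renyi_dominates p1 p2 q1 q2"
  shows "divergence_order n p1 p2 q1 q2" "entropy_order n p1 p2 q1 q2" "max_ratio_order n p1 p2 q1 q2"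
    and "\<forall>i<n. 0 < p1 $ i \<Longrightarrow> entropy_order n p2 p1 q2 q1 \<and> max_ratio_order n p2 p1 q2 q1"
proof -
  have half: "ereal (1 / 2) \<le> 1" by (simp add: one_ereal_def)
  have le: "renyi_div \<alpha> q1 q2 \<le> renyi_div \<alpha> p1 p2" "renyi_div \<alpha> q2 q1 \<le> renyi_div \<alpha> p2 p1"
    if "ereal (1 / 2) \<le> \<alpha>" for \<alpha>
    using dom that unfolding renyi_dominates_def by auto
  show "entropy_order n p1 p2 q1 q2" using le(1)[OF half] by (simp add: renyi_one_le_iff)
  show "max_ratio_order n p1 p2 q1 q2" by (intro max_ratio_order le) simp
  \<comment> \<open>A zero of \<open>q1\<close> would make the reversed target divergence of order 1
    infinite, while that of the source is finite.\<close>
  have q1_pos: "\<forall>i<n. 0 < q1 $ i" if "\<forall>i<n. 0 < p1 $ i"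
  proof (rule ccontr)
    assume "\<not> ?thesis"
    then have "renyi_div 1 q2 q1 = \<infinity>" using not_full_support[OF _ q1 q2 q2_pos] by blast
    moreover interpret R: dominated_pair n p2 p1 using that by unfold_locales (auto simp: p1 p2)
    have "renyi_div 1 p2 p1 \<noteq> \<infinity>" by (simp add: R.renyi_div_one)
    ultimately show False using le(2)[OF half] by simp
  qed
  show "entropy_order n p2 p1 q2 q1 \<and> max_ratio_order n p2 p1 q2 q1" if full: "\<forall>i<n. 0 < p1 $ i"
  proof -
    interpret R: dominated_pairs n p2 p1 q2 q1 using reverse_pairs[OF full q1_pos[OF full]] .
    show ?thesis using le(2)[OF half] le(2)[of \<infinity>] R.renyi_one_le_iff R.max_ratio_order by simp
  qed
  have gt: "Q.F a \<le> P.F a" if "1 < a" for a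
    using le(1)[of "ereal a"] that renyi_greater_one_le_iff[OF that] by simp
  have lt: "P.F a \<le> Q.F a" if a: "0 < a" "a < 1" for a
  proof (cases "1 / 2 \<le> a")
    case True
    then show ?thesis
      using le(1)[of "ereal a"] a renyi_div_less_one_le_iff[OF p1 p2 P.supp_meet q1 q2 Q.supp_meet a] by simp
  next
    \<comment> \<open>For \<open>a < 1/2\<close> the sum is that of the reversed pair at order
      \<open>1 - a\<close>, which lies in the assumed range.\<close>
    case False
    have meet: "supp_vec p2 \<inter> supp_vec p1 \<noteq> {}" "supp_vec q2 \<inter> supp_vec q1 \<noteq> {}"
      using P.supp_meet Q.supp_meet by auto
    show ?thesis
      using False le(2)[of "ereal (1 - a)"] a
        renyi_div_less_one_le_iff[OF p2 p1 meet(1) q2 q1 meet(2), of "1 - a"]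
      by (simp add: rsum_swap[of _ "vec_index p2"] rsum_swap[of _ "vec_index q2"])
  qed
  have neg: "Q.F a \<le> P.F a" if full: "\<forall>i<n. 0 < p1 $ i" and a: "a < 0" for a
  proof -
    interpret R: dominated_pairs n p2 p1 q2 q1 using reverse_pairs[OF full q1_pos[OF full]] .
    show ?thesis
      using a le(2)[of "ereal (1 - a)"] R.renyi_greater_one_le_iff[of "1 - a"]
      by (simp add: rsum_swap[of _ "vec_index p2"] rsum_swap[of _ "vec_index q2"])
  qed
  show "divergence_order n p1 p2 q1 q2"
    unfolding divergence_order_def using gt lt neg q1_pos by blast
qed

lemma divergence_order_renyi_dominates:
  assumes order: "divergence_order n p1 p2 q1 q2"
  shows "renyi_dominates p1 p2 q1 q2"
  unfolding renyi_dominates_def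
proof (intro allI impI)
  fix \<alpha> :: ereal assume \<alpha>: "ereal (1 / 2) \<le> \<alpha>"
  show "renyi_div \<alpha> q1 q2 \<le> renyi_div \<alpha> p1 p2 \<and> renyi_div \<alpha> q2 q1 \<le> renyi_div \<alpha> p2 p1"
  proof (cases "1 \<le> \<alpha>")
    case True
    have 1: "renyi_div \<alpha> q1 q2 \<le> renyi_div \<alpha> p1 p2"
      using order True unfolding divergence_order_def by (intro renyi_order_ge_one) auto
    have 2: "renyi_div \<alpha> q2 q1 \<le> renyi_div \<alpha> p2 p1"
    proof (cases "\<forall>i<n. 0 < p1 $ i")
      case full: True
      with order have q1_pos: "\<forall>i<n. 0 < q1 $ i" by (simp add: divergence_order_def)
      interpret R: dominated_pairs n p2 p1 q2 q1 using reverse_pairs[OF full q1_pos] .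
      have "R.Q.F a \<le> R.P.F a" if "1 < a" for a
        using order full that unfolding divergence_order_def
        by (simp add: rsum_swap[of _ "vec_index p2"] rsum_swap[of _ "vec_index q2"])
      then show ?thesis using True by (rule R.renyi_order_ge_one)
    next
      case False
      then show ?thesis using not_full_support[OF _ p1 p2 p2_pos True] by simp
    qed
    from 1 2 show ?thesis ..
  next
    case False
    with \<alpha> obtain a where a: "\<alpha> = ereal a" "0 < a" "a < 1" by (cases \<alpha>) auto
    have meet: "supp_vec p2 \<inter> supp_vec p1 \<noteq> {}" "supp_vec q2 \<inter> supp_vec q1 \<noteq> {}"
      using P.supp_meet Q.supp_meet by auto
    have "P.F b \<le> Q.F b" if "0 < b" "b < 1" for b
      using order that by (simp add: divergence_order_def)
    from this[of a] this[of "1 - a"] show ?thesis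
      using a renyi_div_less_one_le_iff[OF p1 p2 P.supp_meet q1 q2 Q.supp_meet a(2,3)]
        renyi_div_less_one_le_iff[OF p2 p1 meet(1) q2 q1 meet(2) a(2,3)]
      by (simp add: rsum_swap[of _ "vec_index p2"] rsum_swap[of _ "vec_index q2"])
  qed
qed

end

section \<open>Data processing and limits\<close>

lemma rsum_cong:
  assumes "\<And>i. i \<in> I \<Longrightarrow> x i = x' i" "\<And>i. i \<in> I \<Longrightarrow> y i = y' i"
  shows "rsum I x y \<alpha> = rsum I x' y' \<alpha>"
  unfolding rsum_def using assms by (intro sum.cong) auto

text \<open>The inequality for one output of a channel, with \<open>t\<close> its transition
  weights: the tangent at the ratio of the two sums is linear, exact for the sums and a lower bound
  for every term.\<close>

lemma powr_sum_le:
  fixes t x y :: "'a \<Rightarrow> real"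
  assumes "finite A" "\<And>j. j \<in> A \<Longrightarrow> 0 \<le> t j" "\<And>j. j \<in> A \<Longrightarrow> 0 \<le> x j" "\<And>j. j \<in> A \<Longrightarrow> 0 \<le> y j"
    and "\<And>j. j \<in> A \<Longrightarrow> y j = 0 \<Longrightarrow> x j = 0" "1 < \<alpha>"
  shows "(\<Sum>j\<in>A. t j * x j) powr \<alpha> * (\<Sum>j\<in>A. t j * y j) powr (1 - \<alpha>)
    \<le> (\<Sum>j\<in>A. t j * (x j powr \<alpha> * y j powr (1 - \<alpha>)))" (is "?X powr \<alpha> * ?Y powr _ \<le> ?R")
proof (cases "?X = 0 \<or> ?Y = 0")
  case True
  have "0 \<le> ?R" using assms(2) by (intro sum_nonneg mult_nonneg_nonneg) auto
  then show ?thesis using True by auto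
next
  case False
  moreover have "0 \<le> ?X" "0 \<le> ?Y" using assms(2-4) by (auto intro!: sum_nonneg)
  ultimately have pos: "0 < ?X" "0 < ?Y" by auto
  then have V: "0 < ?X / ?Y" by simp
  have "?X powr \<alpha> * ?Y powr (1 - \<alpha>) = tangent \<alpha> (?X / ?Y) ?X ?Y"
    using tangent_eq[OF V, of ?Y \<alpha>] pos by simp
  also have "\<dots> = (\<Sum>j\<in>A. t j * tangent \<alpha> (?X / ?Y) (x j) (y j))"
    by (simp add: sum_tangent[symmetric] tangent_scale)
  also have "\<dots> \<le> ?R"
    using V assms by (intro sum_mono mult_left_mono tangent_le) auto
  finally show ?thesis .
qed

lemma sum_powr_le:
  fixes t x y :: "'a \<Rightarrow> real"
  assumes "finite A" "\<And>j. j \<in> A \<Longrightarrow> 0 \<le> t j" "\<And>j. j \<in> A \<Longrightarrow> 0 \<le> x j" "\<And>j. j \<in> A \<Longrightarrow> 0 \<le> y j"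
    and "0 < \<alpha>" "\<alpha> < 1"
  shows "(\<Sum>j\<in>A. t j * (x j powr \<alpha> * y j powr (1 - \<alpha>)))
    \<le> (\<Sum>j\<in>A. t j * x j) powr \<alpha> * (\<Sum>j\<in>A. t j * y j) powr (1 - \<alpha>)" (is "?R \<le> ?X powr \<alpha> * ?Y powr _")
proof (cases "?X = 0 \<or> ?Y = 0")
  case True
  then have "\<forall>j\<in>A. t j * x j = 0 \<or> t j * y j = 0"
    using assms(1-4) sum_nonneg_eq_0_iff[of A "\<lambda>j. t j * x j"] sum_nonneg_eq_0_iff[of A "\<lambda>j. t j * y j"] by auto
  then have "?R = 0" by (intro sum.neutral) auto
  then show ?thesis using True by auto
next
  case False
  moreover have "0 \<le> ?X" "0 \<le> ?Y" using assms(2-4) by (auto intro!: sum_nonneg)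
  ultimately have pos: "0 < ?X" "0 < ?Y" by auto
  then have V: "0 < ?X / ?Y" by simp
  have "?R \<le> (\<Sum>j\<in>A. t j * tangent \<alpha> (?X / ?Y) (x j) (y j))"
    using V assms by (intro sum_mono mult_left_mono le_tangent) auto
  also have "\<dots> = tangent \<alpha> (?X / ?Y) ?X ?Y"
    by (simp add: sum_tangent[symmetric] tangent_scale)
  also have "\<dots> = ?X powr \<alpha> * ?Y powr (1 - \<alpha>)"
    using tangent_eq[OF V, of ?Y \<alpha>] pos by simp
  finally show ?thesis .
qed

locale channel =
  fixes A :: "'a set" and B :: "'b set" and t :: "'b \<Rightarrow> 'a \<Rightarrow> real" and x y :: "'a \<Rightarrow> real"
  assumes fin: "finite A" "finite B" and t_nonneg: "0 \<le> t i j"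
    and t_sum: "j \<in> A \<Longrightarrow> (\<Sum>i\<in>B. t i j) = 1"
    and x_nonneg: "j \<in> A \<Longrightarrow> 0 \<le> x j" and y_nonneg: "j \<in> A \<Longrightarrow> 0 \<le> y j"
begin

definition out where "out z i = (\<Sum>j\<in>A. t i j * z j)"

lemma rsum_le_out:
  assumes "0 < \<alpha>" "\<alpha> < 1"
  shows "rsum A x y \<alpha> \<le> rsum B (out x) (out y) \<alpha>"
proof -
  have "rsum A x y \<alpha> = (\<Sum>j\<in>A. \<Sum>i\<in>B. t i j * (x j powr \<alpha> * y j powr (1 - \<alpha>)))"
    by (simp add: rsum_def t_sum flip: sum_distrib_right)
  also have "\<dots> = (\<Sum>i\<in>B. \<Sum>j\<in>A. t i j * (x j powr \<alpha> * y j powr (1 - \<alpha>)))"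
    by (rule sum.swap)
  also have "\<dots> \<le> rsum B (out x) (out y) \<alpha>"
    unfolding rsum_def out_def using fin t_nonneg x_nonneg y_nonneg assms by (intro sum_mono sum_powr_le)
  finally show ?thesis .
qed

text \<open>Restricting to the outputs and inputs charged by \<open>y\<close>, which is lossless under the first assumption.\<close>

lemma out_rsum_le:
  assumes mass: "(\<Sum>i | i \<in> B \<and> 0 < out y i. out x i) \<le> (\<Sum>j | j \<in> A \<and> 0 < y j. x j)" and \<alpha>: "1 < \<alpha>"
  shows "rsum B (out x) (out y) \<alpha> \<le> rsum A x y \<alpha>"
proof -
  define S where "S = {j \<in> A. 0 < y j}"
  define S' where "S' = {i \<in> B. 0 < out y i}"
  have S: "finite S" "finite S'" "S \<subseteq> A" "S' \<subseteq> B" using fin by (auto simp: S_def S'_def)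
  have out_nonneg: "0 \<le> out x i" "0 \<le> out y i" for i
    using t_nonneg x_nonneg y_nonneg by (auto simp: out_def intro!: sum_nonneg)
  have t0: "t i j = 0" if "i \<in> B - S'" "j \<in> S" for i j
  proof -
    have "out y i = 0" using that out_nonneg(2)[of i] by (auto simp: S'_def)
    then have "t i j * y j = 0"
      using that S fin t_nonneg y_nonneg sum_nonneg_eq_0_iff[of A "\<lambda>j. t i j * y j"] by (auto simp: out_def)
    then show ?thesis using that by (auto simp: S_def)
  qed
  have t1: "(\<Sum>i\<in>S'. t i j) = 1" if "j \<in> S" for j
    using t_sum[of j] sum.mono_neutral_left[OF fin(2) S(4), of "\<lambda>i. t i j"] t0 that S by auto
  have split: "out z i = (\<Sum>j\<in>S. t i j * z j) + (\<Sum>j\<in>A - S. t i j * z j)" for z i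
    unfolding out_def using sum.subset_diff[OF S(3) fin(1)] by (simp add: add.commute)
  have "(\<Sum>i\<in>S'. \<Sum>j\<in>S. t i j * x j) = (\<Sum>j\<in>S. x j)"
    by (subst sum.swap) (simp add: t1 flip: sum_distrib_right)
  \<comment> \<open>All mass of \<open>x\<close> on \<open>S\<close> arrives in \<open>S'\<close>,
    by \<open>t1\<close>. The assumption leaves no room for more, so inputs outside \<open>S\<close>
    send no mass of \<open>x\<close> there.\<close>
  then have "(\<Sum>i\<in>S'. \<Sum>j\<in>A - S. t i j * x j) \<le> 0"
    using mass by (simp add: split[of x] sum.distrib flip: S_def S'_def)
  moreover have nn: "0 \<le> (\<Sum>j\<in>A - S. t i j * x j)" for i
    using t_nonneg x_nonneg by (auto intro!: sum_nonneg)
  ultimately have "(\<Sum>i\<in>S'. \<Sum>j\<in>A - S. t i j * x j) = 0"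
    by (intro antisym sum_nonneg[of S']) auto
  then have "\<forall>i\<in>S'. (\<Sum>j\<in>A - S. t i j * x j) = 0"
    using nn sum_nonneg_eq_0_iff[OF S(2), of "\<lambda>i. \<Sum>j\<in>A - S. t i j * x j"] by simp
  then have out_x: "out x i = (\<Sum>j\<in>S. t i j * x j)" if "i \<in> S'" for i
    using that split by simp
  have out_y: "out y i = (\<Sum>j\<in>S. t i j * y j)" for i
  proof -
    have "(\<Sum>j\<in>A - S. t i j * y j) = 0"
      using y_nonneg by (intro sum.neutral) (force simp: S_def order_less_le)
    then show ?thesis using split by simp
  qed
  have "rsum B (out x) (out y) \<alpha> = rsum S' (out x) (out y) \<alpha>"
    unfolding rsum_def using fin S out_nonneg by (intro sum.mono_neutral_right) (auto simp: S'_def order_less_le)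
  also have "\<dots> = (\<Sum>i\<in>S'. (\<Sum>j\<in>S. t i j * x j) powr \<alpha> * (\<Sum>j\<in>S. t i j * y j) powr (1 - \<alpha>))"
    unfolding rsum_def by (intro sum.cong) (auto simp: out_x out_y)
  also have "\<dots> \<le> (\<Sum>i\<in>S'. \<Sum>j\<in>S. t i j * (x j powr \<alpha> * y j powr (1 - \<alpha>)))"
    using S t_nonneg x_nonneg y_nonneg \<alpha> by (intro sum_mono powr_sum_le) (auto simp: S_def)
  also have "\<dots> = rsum S x y \<alpha>"
    by (subst sum.swap) (simp add: t1 rsum_def flip: sum_distrib_right)
  also have "\<dots> = rsum A x y \<alpha>"
    unfolding rsum_def using fin S y_nonneg by (intro sum.mono_neutral_left) (force simp: S_def order_less_le)+
  finally show ?thesis .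
qed

text \<open>Inputs charged by \<open>y\<close> reach only outputs charged by \<open>out y\<close>,
  so the absolutely continuous mass, which is the sum of order 1, can only grow under a
  channel.\<close>

lemma charged_mass_le:
  "(\<Sum>j | j \<in> A \<and> 0 < y j. x j) \<le> (\<Sum>i | i \<in> B \<and> 0 < out y i. out x i)"
proof -
  have t0: "t i j = 0" if "i \<in> B" "\<not> 0 < out y i" "j \<in> A" "0 < y j" for i j
  proof -
    have "0 \<le> out y i" using t_nonneg y_nonneg by (auto simp: out_def intro!: sum_nonneg)
    then have "out y i = 0" using that by simp
    then have "t i j * y j = 0"
      using that fin t_nonneg y_nonneg sum_nonneg_eq_0_iff[of A "\<lambda>j. t i j * y j"] by (auto simp: out_def)
    then show ?thesis using that by auto
  qed
  have "(\<Sum>i | i \<in> B \<and> 0 < out y i. t i j) = 1" if "j \<in> A" "0 < y j" for j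
    using t_sum[OF that(1)] sum.mono_neutral_left[OF fin(2), of "{i \<in> B. 0 < out y i}" "\<lambda>i. t i j"] t0 that
    by auto
  then have "(\<Sum>j | j \<in> A \<and> 0 < y j. x j) = (\<Sum>j | j \<in> A \<and> 0 < y j. \<Sum>i | i \<in> B \<and> 0 < out y i. t i j * x j)"
    by (intro sum.cong) (auto simp flip: sum_distrib_right)
  also have "\<dots> = (\<Sum>i | i \<in> B \<and> 0 < out y i. \<Sum>j | j \<in> A \<and> 0 < y j. t i j * x j)"
    by (rule sum.swap)
  also have "\<dots> \<le> (\<Sum>i | i \<in> B \<and> 0 < out y i. out x i)"
    unfolding out_def using fin t_nonneg x_nonneg by (intro sum_mono sum_mono2) auto
  finally show ?thesis .
qed

end

section \<open>Monotonicity of power sums under majorization\<close>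

lemma rsum_one_charged:
  assumes "finite A" "\<And>j. j \<in> A \<Longrightarrow> 0 \<le> x j" "\<And>j. j \<in> A \<Longrightarrow> 0 \<le> y j"
  shows "rsum A x y 1 = (\<Sum>j | j \<in> A \<and> 0 < y j. x j)"
  unfolding rsum_def using assms by (intro sum.mono_neutral_cong_right) (auto simp: order_less_le)

text \<open>With \<open>0 powr a = 0\<close> the sums of order above 1 ignore mass that makes a
  divergence infinite, and a channel can turn such mass into a visible contribution. The last two
  claims therefore assume that the charged mass has not grown.\<close>

lemma majorizes_rsum:
  assumes maj: "majorizes a1 a2 b1 b2"
    and a1: "\<And>j. j < dim_vec a1 \<Longrightarrow> 0 \<le> a1 $ j" and a2: "\<And>j. j < dim_vec a1 \<Longrightarrow> 0 \<le> a2 $ j"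
  shows "0 < \<alpha> \<Longrightarrow> \<alpha> < 1 \<Longrightarrow> vec_rsum (dim_vec a1) a1 a2 \<alpha>
      \<le> vec_rsum (dim_vec b1) b1 b2 \<alpha>"
    and "vec_rsum (dim_vec a1) a1 a2 1 \<le> vec_rsum (dim_vec b1) b1 b2 1"
    and "vec_rsum (dim_vec a1) a2 a1 1 \<le> vec_rsum (dim_vec b1) b2 b1 1"
    and "1 < \<alpha> \<Longrightarrow> vec_rsum (dim_vec b1) b1 b2 1 \<le> vec_rsum (dim_vec a1) a1 a2 1
      \<Longrightarrow> vec_rsum (dim_vec b1) b1 b2 \<alpha> \<le> vec_rsum (dim_vec a1) a1 a2 \<alpha>"
    and "1 < \<alpha> \<Longrightarrow> vec_rsum (dim_vec b1) b2 b1 1 \<le> vec_rsum (dim_vec a1) a2 a1 1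
      \<Longrightarrow> vec_rsum (dim_vec b1) b2 b1 \<alpha> \<le> vec_rsum (dim_vec a1) a2 a1 \<alpha>"
proof -
  obtain t where t: "dim_vec a1 = dim_vec a2" "dim_vec b1 = dim_vec b2" "\<And>i j. 0 \<le> t i j"
    "\<And>j. j < dim_vec a1 \<Longrightarrow> (\<Sum>i<dim_vec b1. t i j) = 1"
    "\<And>i. i < dim_vec b1 \<Longrightarrow> b1 $ i = (\<Sum>j<dim_vec a1. t i j * a1 $ j)"
    "\<And>i. i < dim_vec b1 \<Longrightarrow> b2 $ i = (\<Sum>j<dim_vec a1. t i j * a2 $ j)"
    using majorizesE[OF maj] by blast
  interpret C: channel "{..<dim_vec a1}" "{..<dim_vec b1}" t "vec_index a1" "vec_index a2"
    using t a1 a2 by unfold_locales auto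
  interpret D: channel "{..<dim_vec a1}" "{..<dim_vec b1}" t "vec_index a2" "vec_index a1"
    using t a1 a2 by unfold_locales auto
  have out: "C.out (vec_index a1) i = b1 $ i" "C.out (vec_index a2) i = b2 $ i"
    "D.out (vec_index a1) i = b1 $ i" "D.out (vec_index a2) i = b2 $ i" if "i < dim_vec b1" for i
    using t(5,6)[OF that] by (simp_all add: C.out_def D.out_def)
  have out_rsum: "vec_rsum (dim_vec b1) b1 b2 \<alpha>
      = rsum {..<dim_vec b1} (C.out (vec_index a1)) (C.out (vec_index a2)) \<alpha>"
    "vec_rsum (dim_vec b1) b2 b1 \<alpha>
      = rsum {..<dim_vec b1} (D.out (vec_index a2)) (D.out (vec_index a1)) \<alpha>" for \<alpha>
    by (intro rsum_cong; simp add: out)+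
  have nonneg: "0 \<le> C.out (vec_index a1) i" "0 \<le> C.out (vec_index a2) i"
    "0 \<le> D.out (vec_index a1) i" "0 \<le> D.out (vec_index a2) i" for i
    using t(3) a1 a2 by (auto simp: C.out_def D.out_def intro!: sum_nonneg)
  have charged:
    "vec_rsum (dim_vec a1) a1 a2 1 = (\<Sum>j | j \<in> {..<dim_vec a1} \<and> 0 < a2 $ j. a1 $ j)"
    "vec_rsum (dim_vec a1) a2 a1 1 = (\<Sum>j | j \<in> {..<dim_vec a1} \<and> 0 < a1 $ j. a2 $ j)"
    by (rule rsum_one_charged; simp add: a1 a2)+
  have out_charged:
    "rsum {..<dim_vec b1} (C.out (vec_index a1)) (C.out (vec_index a2)) 1
      = (\<Sum>i | i \<in> {..<dim_vec b1} \<and> 0 < C.out (vec_index a2) i. C.out (vec_index a1) i)"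
    "rsum {..<dim_vec b1} (D.out (vec_index a2)) (D.out (vec_index a1)) 1
      = (\<Sum>i | i \<in> {..<dim_vec b1} \<and> 0 < D.out (vec_index a1) i. D.out (vec_index a2) i)"
    by (rule rsum_one_charged; simp add: nonneg)+
  show "vec_rsum (dim_vec a1) a1 a2 \<alpha>
      \<le> vec_rsum (dim_vec b1) b1 b2 \<alpha>" if "0 < \<alpha>" "\<alpha> < 1"
    using that unfolding out_rsum by (rule C.rsum_le_out)
  show "vec_rsum (dim_vec a1) a1 a2 1 \<le> vec_rsum (dim_vec b1) b1 b2 1"
    unfolding out_rsum charged out_charged by (rule C.charged_mass_le)
  show "vec_rsum (dim_vec a1) a2 a1 1 \<le> vec_rsum (dim_vec b1) b2 b1 1"
    unfolding out_rsum charged out_charged by (rule D.charged_mass_le)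
  show "vec_rsum (dim_vec b1) b1 b2 \<alpha> \<le> vec_rsum (dim_vec a1) a1 a2 \<alpha>"
    if "1 < \<alpha>" "vec_rsum (dim_vec b1) b1 b2 1 \<le> vec_rsum (dim_vec a1) a1 a2 1"
    using that(2) unfolding out_rsum charged out_charged by (rule C.out_rsum_le) (rule that(1))
  show "vec_rsum (dim_vec b1) b2 b1 \<alpha> \<le> vec_rsum (dim_vec a1) a2 a1 \<alpha>"
    if "1 < \<alpha>" "vec_rsum (dim_vec b1) b2 b1 1 \<le> vec_rsum (dim_vec a1) a2 a1 1"
    using that(2) unfolding out_rsum charged out_charged by (rule D.out_rsum_le) (rule that(1))
qed

text \<open>The counterpart of \<open>divergence_order\<close> for approximants, whose length may
  differ from \<open>n\<close> and whose second vector may have zeros. Full support of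
  \<open>q1\<close> is accordingly replaced by positivity of \<open>e1\<close> wherever
  \<open>e2\<close> is positive.\<close>

definition divergence_bound :: "nat \<Rightarrow> real vec \<Rightarrow> real vec \<Rightarrow> real vec \<Rightarrow> real vec \<Rightarrow> bool" where
  "divergence_bound n p1 p2 e1 e2 \<longleftrightarrow>
    (\<forall>\<alpha>>1. vec_rsum (dim_vec e1) e1 e2 \<alpha> \<le> vec_rsum n p1 p2 \<alpha>) \<and>
    (\<forall>\<alpha>. 0 < \<alpha> \<and> \<alpha> < 1 \<longrightarrow>
      vec_rsum n p1 p2 \<alpha> \<le> vec_rsum (dim_vec e1) e1 e2 \<alpha>) \<and>
    ((\<forall>i<n. 0 < p1 $ i) \<longrightarrow> (\<forall>i<dim_vec e1. 0 < e2 $ i \<longrightarrow> 0 < e1 $ i) \<and>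
      (\<forall>\<alpha>>1. vec_rsum (dim_vec e1) e2 e1 \<alpha> \<le> vec_rsum n p2 p1 \<alpha>))"

lemma dichotomyD:
  assumes "dichotomy p1 p2"
  shows "p1 \<in> prob_vecs (dim_vec p1)" "p2 \<in> prob_vecs (dim_vec p1)" "dim_vec p2 = dim_vec p1"
    "\<And>i. i < dim_vec p1 \<Longrightarrow> p2 $ i = 0 \<Longrightarrow> p1 $ i = 0"
proof -
  obtain d where d: "p1 \<in> prob_vecs d" "p2 \<in> prob_vecs d" "supp_vec p1 \<subseteq> supp_vec p2"
    using assms by (auto simp: dichotomy_def)
  then show "p1 \<in> prob_vecs (dim_vec p1)" "p2 \<in> prob_vecs (dim_vec p1)" "dim_vec p2 = dim_vec p1"
    using prob_vecsD(1)[OF d(1)] prob_vecsD(1)[OF d(2)] by simp_all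
  show "p1 $ i = 0" if "i < dim_vec p1" "p2 $ i = 0" for i
    using d(3) that by (auto simp: supp_vec_def)
qed

text \<open>Order 1 detects absolute continuity: the missing mass is exactly the mass of
  \<open>x\<close> where \<open>y\<close> vanishes.\<close>

lemma rsum_one_prob:
  assumes x: "x \<in> prob_vecs n" and y: "y \<in> prob_vecs n"
  shows "vec_rsum n x y 1 \<le> 1"
    and "(\<And>i. i < n \<Longrightarrow> y $ i = 0 \<Longrightarrow> x $ i = 0) \<Longrightarrow> vec_rsum n x y 1 = 1"
    and "1 \<le> vec_rsum n x y 1 \<Longrightarrow> i < n \<Longrightarrow> 0 < x $ i \<Longrightarrow> 0 < y $ i"
proof -
  note X = prob_vecsD[OF x] and Y = prob_vecsD[OF y]
  let ?f = "\<lambda>i. x $ i powr 1 * y $ i powr (1 - 1)"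
  have le: "?f i \<le> x $ i" if "i < n" for i using X(2)[OF that] by (cases "y $ i = 0") auto
  have "(\<Sum>i<n. ?f i) \<le> (\<Sum>i<n. x $ i)" using le by (intro sum_mono) auto
  then show "vec_rsum n x y 1 \<le> 1" using X(3) by (simp only: rsum_def)
  show "vec_rsum n x y 1 = 1" if "\<And>i. i < n \<Longrightarrow> y $ i = 0 \<Longrightarrow> x $ i = 0"
  proof -
    have "(\<Sum>i<n. ?f i) = (\<Sum>i<n. x $ i)"
      using that X(2) by (intro sum.cong) auto
    then show ?thesis using X(3) by (simp only: rsum_def)
  qed
  show "0 < y $ i" if "1 \<le> vec_rsum n x y 1" "i < n" "0 < x $ i"
  proof (rule ccontr)
    assume "\<not> 0 < y $ i"
    then have "y $ i = 0" using Y(2)[OF that(2)] by simp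
    then have "(\<Sum>i<n. ?f i) < (\<Sum>i<n. x $ i)"
      using le that by (intro sum_strict_mono_ex1) auto
    then show False using that(1) X(3) by (simp add: rsum_def)
  qed
qed

text \<open>\<Phi> stands for multiplication by the sum of a catalyst or for raising to the power
  \<open>m\<close>. Both are order embeddings on non-negative numbers, so data processing for the
  large vectors descends to the small ones.\<close>

lemma divergence_boundI:
  assumes p: "p1 \<in> prob_vecs n" "p2 \<in> prob_vecs n" "\<And>i. i < n \<Longrightarrow> 0 < p2 $ i" and e: "dichotomy e1 e2"
    and maj: "majorizes a1 a2 b1 b2"
    and a: "\<And>j. j < dim_vec a1 \<Longrightarrow> 0 \<le> a1 $ j" "\<And>j. j < dim_vec a1 \<Longrightarrow> 0 \<le> a2 $ j"
    and A: "\<And>\<alpha>. vec_rsum (dim_vec a1) a1 a2 \<alpha>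
      = \<Phi> \<alpha> (vec_rsum n p1 p2 \<alpha>)"
    and B: "\<And>\<alpha>. vec_rsum (dim_vec b1) b1 b2 \<alpha>
      = \<Phi> \<alpha> (vec_rsum (dim_vec e1) e1 e2 \<alpha>)"
    and mono: "\<And>\<alpha> u v. 0 \<le> u \<Longrightarrow> 0 \<le> v \<Longrightarrow> \<Phi> \<alpha> u \<le> \<Phi> \<alpha> v \<longleftrightarrow> u \<le> v"
  shows "divergence_bound n p1 p2 e1 e2"
proof -
  note P1 = prob_vecsD[OF p(1)] and P2 = prob_vecsD[OF p(2)]
  note E = dichotomyD[OF e]
  have A': "vec_rsum (dim_vec a1) a2 a1 \<alpha>
      = \<Phi> (1 - \<alpha>) (vec_rsum n p2 p1 \<alpha>)" for \<alpha>
    by (simp add: rsum_swap[of _ "vec_index a2"] rsum_swap[of _ "vec_index p2"] A)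
  have B': "vec_rsum (dim_vec b1) b2 b1 \<alpha>
      = \<Phi> (1 - \<alpha>) (vec_rsum (dim_vec e1) e2 e1 \<alpha>)" for \<alpha>
    by (simp add: rsum_swap[of _ "vec_index b2"] rsum_swap[of _ "vec_index e2"] B)
  note M = majorizes_rsum[OF maj a, unfolded A B A' B' mono[OF rsum_nonneg rsum_nonneg]]
  have P_one: "vec_rsum n p1 p2 1 = 1"
    using p(3) by (intro rsum_one_prob(2)[OF p(1,2)]) force
  have E_le: "vec_rsum (dim_vec e1) e2 e1 1 \<le> 1"
    "vec_rsum (dim_vec e1) e1 e2 1 \<le> 1"
    using rsum_one_prob(1)[OF E(2,1)] rsum_one_prob(1)[OF E(1,2)] by auto
  have full: "vec_rsum n p2 p1 1 = 1" if "\<forall>i<n. 0 < p1 $ i"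
    using that by (intro rsum_one_prob(2)[OF p(2,1)]) force
  show ?thesis
    unfolding divergence_bound_def
  proof (intro conjI allI impI)
    fix i assume "\<forall>i<n. 0 < p1 $ i" "i < dim_vec e1" "0 < e2 $ i"
    then show "0 < e1 $ i" using M(3) full rsum_one_prob(3)[OF E(2,1)] by auto
  qed (use M(1,4,5) P_one full E_le in auto)
qed

text \<open>Some index is charged by both vectors of the catalyst, so its sums are positive at every
  order; they multiply both sides and cancel.\<close>

lemma divergence_bound_catalyst:
  assumes p: "p1 \<in> prob_vecs n" "p2 \<in> prob_vecs n" "\<And>i. i < n \<Longrightarrow> 0 < p2 $ i" and e: "dichotomy e1 e2"
    and r: "dichotomy r1 r2"
    and maj: "majorizes (r1 \<otimes>\<^sub>v p1) (r2 \<otimes>\<^sub>v p2) (r1 \<otimes>\<^sub>v e1) (r2 \<otimes>\<^sub>v e2)"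
  shows "divergence_bound n p1 p2 e1 e2"
proof -
  note R = dichotomyD[OF r] and E = dichotomyD[OF e]
  note P1 = prob_vecsD[OF p(1)] and P2 = prob_vecsD[OF p(2)]
  obtain i where i: "i < dim_vec r1" "0 < r1 $ i" using prob_vecs_support[OF R(1)] .
  have "0 < r2 $ i" using R(4)[OF i(1)] i prob_vecsD(2)[OF R(2) i(1)] by (auto simp: order_less_le)
  then interpret R: divergence_pair "{..<dim_vec r1}" "vec_index r1" "vec_index r2"
    using prob_vecsD(2)[OF R(1)] prob_vecsD(2)[OF R(2)] i by unfold_locales auto
  have kron_nonneg: "0 \<le> (v \<otimes>\<^sub>v w) $ j" if "\<And>i. i < dim_vec v \<Longrightarrow> 0 \<le> v $ i" "\<And>i. i < dim_vec w \<Longrightarrow> 0 \<le> w $ i"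
    "j < dim_vec v * dim_vec w" for v w :: "real vec" and j
  proof -
    have "0 < dim_vec w" using that(3) by (cases "dim_vec w = 0") auto
    then show ?thesis using that by (simp add: kron_vec_def less_mult_imp_div_less)
  qed
  show ?thesis
  proof (rule divergence_boundI[OF p e maj, where \<Phi> = "\<lambda>\<alpha> u. R.F \<alpha> * u"])
    show "0 \<le> (r1 \<otimes>\<^sub>v p1) $ j" if "j < dim_vec (r1 \<otimes>\<^sub>v p1)" for j
      using that prob_vecsD(2)[OF R(1)] P1 by (intro kron_nonneg) auto
    show "0 \<le> (r2 \<otimes>\<^sub>v p2) $ j" if "j < dim_vec (r1 \<otimes>\<^sub>v p1)" for j
      using that prob_vecsD(2)[OF R(2)] R(3) P1 P2 by (intro kron_nonneg) auto
    show "vec_rsum (dim_vec (r1 \<otimes>\<^sub>v p1)) (r1 \<otimes>\<^sub>v p1) (r2 \<otimes>\<^sub>v p2) \<alpha>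
        = R.F \<alpha> * vec_rsum n p1 p2 \<alpha>" for \<alpha>
      using rsum_kron[of r1 r2 p1 p2] R(3) P1 P2 by simp
    show "vec_rsum (dim_vec (r1 \<otimes>\<^sub>v e1)) (r1 \<otimes>\<^sub>v e1) (r2 \<otimes>\<^sub>v e2) \<alpha>
        = R.F \<alpha> * vec_rsum (dim_vec e1) e1 e2 \<alpha>" for \<alpha>
      using rsum_kron[of r1 r2 e1 e2] R(3) E(3) by simp
    show "R.F \<alpha> * u \<le> R.F \<alpha> * v \<longleftrightarrow> u \<le> v" for \<alpha> u v
      using R.F_pos[of \<alpha>] by simp
  qed
qed

lemma divergence_bound_power:
  assumes p: "p1 \<in> prob_vecs n" "p2 \<in> prob_vecs n" "\<And>i. i < n \<Longrightarrow> 0 < p2 $ i" and e: "dichotomy e1 e2"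
    and "0 < m" and maj: "majorizes (kron_power p1 m) (kron_power p2 m) (kron_power e1 m) (kron_power e2 m)"
  shows "divergence_bound n p1 p2 e1 e2"
proof -
  note P1 = prob_vecsD[OF p(1)] and P2 = prob_vecsD[OF p(2)]
  note E = dichotomyD[OF e]
  show ?thesis
  proof (rule divergence_boundI[OF p e maj, where \<Phi> = "\<lambda>\<alpha> u. u ^ m"])
    show "0 \<le> kron_power p1 m $ j" if "j < dim_vec (kron_power p1 m)" for j
      using that P1 by (intro kron_power_nonneg) auto
    show "0 \<le> kron_power p2 m $ j" if "j < dim_vec (kron_power p1 m)" for j
      using that P1 P2 by (intro kron_power_nonneg) auto
    show "vec_rsum (dim_vec (kron_power p1 m)) (kron_power p1 m) (kron_power p2 m) \<alpha>
        = vec_rsum n p1 p2 \<alpha> ^ m" for \<alpha>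
      using rsum_kron_power[of p1 p2 m \<alpha>] P1 P2 by simp
    show "vec_rsum (dim_vec (kron_power e1 m)) (kron_power e1 m) (kron_power e2 m) \<alpha>
        = vec_rsum (dim_vec e1) e1 e2 \<alpha> ^ m" for \<alpha>
      using rsum_kron_power[of e1 e2 m \<alpha>] E(3) by simp
    show "u ^ m \<le> v ^ m \<longleftrightarrow> u \<le> v" if "0 \<le> u" "0 \<le> v" for u v :: real
      using that \<open>0 < m\<close> by (simp add: power_mono_iff)
  qed
qed

section \<open>Passage to the limit along approximating dichotomies\<close>

definition pad :: "real vec \<Rightarrow> nat \<Rightarrow> real" where
  "pad v i = (if i < dim_vec v then v $ i else 0)"

lemma pad_nonneg: "v \<in> prob_vecs d \<Longrightarrow> 0 \<le> pad v i"
  using prob_vecsD[of v d] by (auto simp: pad_def)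

lemma l1_dist_pad: "l1_dist v w = (\<Sum>i<max (dim_vec v) (dim_vec w). \<bar>pad v i - pad w i\<bar>)"
  by (simp add: l1_dist_def pad_def)

lemma pad_close:
  assumes "i < dim_vec v"
  shows "\<bar>v $ i - pad w i\<bar> \<le> l1_dist v w"
proof -
  have "\<bar>pad v i - pad w i\<bar> \<le> l1_dist v w"
    unfolding l1_dist_pad using assms by (intro member_le_sum[of i _ "\<lambda>i. \<bar>pad v i - pad w i\<bar>"]) auto
  then show ?thesis using assms by (simp add: pad_def)
qed

lemma pad_tail:
  assumes "w \<in> prob_vecs d"
  shows "(\<Sum>i = dim_vec v..<max (dim_vec v) (dim_vec w). pad w i) \<le> l1_dist v w"
proof -
  have "(\<Sum>i = dim_vec v..<max (dim_vec v) (dim_vec w). pad w i)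
      = (\<Sum>i = dim_vec v..<max (dim_vec v) (dim_vec w). \<bar>pad v i - pad w i\<bar>)"
    using pad_nonneg[OF assms] by (intro sum.cong) (auto simp: pad_def[of v])
  also have "\<dots> \<le> l1_dist v w"
    unfolding l1_dist_pad by (intro sum_mono2) auto
  finally show ?thesis .
qed

lemma rsum_pad:
  assumes "dim_vec e1 = d" "dim_vec e2 = d"
  shows "vec_rsum d e1 e2 \<alpha> = rsum {..<n} (pad e1) (pad e2) \<alpha> + rsum {n..<max n d} (pad e1) (pad e2) \<alpha>"
proof -
  have "vec_rsum d e1 e2 \<alpha> = rsum {..<d} (pad e1) (pad e2) \<alpha>"
    using assms by (intro rsum_cong) (auto simp: pad_def)
  also have "\<dots> = rsum {..<max n d} (pad e1) (pad e2) \<alpha>"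
    unfolding rsum_def using assms by (intro sum.mono_neutral_left) (auto simp: pad_def)
  also have "\<dots> = rsum {..<n} (pad e1) (pad e2) \<alpha> + rsum {n..<max n d} (pad e1) (pad e2) \<alpha>"
    unfolding rsum_def lessThan_atLeast0 by (rule sum.atLeastLessThan_concat[symmetric]) auto
  finally show ?thesis .
qed

text \<open>\<open>powr\<close> is continuous at base 0 along non-negative bases only for positive
  exponents: \<alpha> > 0 admits zeros of \<open>x'\<close>, while 1 - \<alpha> may be negative and
  forces \<open>y'\<close> away from 0.\<close>

lemma tendsto_rsum:
  assumes "\<And>i. i \<in> I \<Longrightarrow> (\<lambda>k. x k i) \<longlonglongrightarrow> x' i" "\<And>i. i \<in> I \<Longrightarrow> (\<lambda>k. y k i) \<longlonglongrightarrow> y' i"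
    and "\<And>i k. i \<in> I \<Longrightarrow> 0 \<le> x k i" and "\<And>i. i \<in> I \<Longrightarrow> y' i \<noteq> 0" "0 < \<alpha>"
  shows "(\<lambda>k. rsum I (x k) (y k) \<alpha>) \<longlonglongrightarrow> rsum I x' y' \<alpha>"
  unfolding rsum_def using assms by (intro tendsto_sum tendsto_mult tendsto_powr' tendsto_const) auto

lemma divergence_order_limit:
  assumes q: "q1 \<in> prob_vecs n" "q2 \<in> prob_vecs n" "\<And>i. i < n \<Longrightarrow> 0 < q2 $ i"
    and approx: "\<And>\<epsilon>. 0 < \<epsilon> \<Longrightarrow> \<exists>e1 e2. dichotomy e1 e2 \<and> l1_dist q1 e1 \<le> \<epsilon> \<and> l1_dist q2 e2 \<le> \<epsilon> \<and>
      divergence_bound n p1 p2 e1 e2"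
  shows "divergence_order n p1 p2 q1 q2"
proof -
  have "\<forall>k. \<exists>e1 e2. dichotomy e1 e2 \<and> l1_dist q1 e1 \<le> inverse (real (Suc k)) \<and>
      l1_dist q2 e2 \<le> inverse (real (Suc k)) \<and> divergence_bound n p1 p2 e1 e2"
    using approx by simp
  then obtain e1 e2 where dich: "\<And>k. dichotomy (e1 k) (e2 k)"
    and d1: "\<And>k. l1_dist q1 (e1 k) \<le> inverse (real (Suc k))"
    and d2: "\<And>k. l1_dist q2 (e2 k) \<le> inverse (real (Suc k))"
    and bound: "\<And>k. divergence_bound n p1 p2 (e1 k) (e2 k)" by metis
  note E = dichotomyD[OF dich]
  have dims: "dim_vec q1 = n" "dim_vec q2 = n" using prob_vecsD(1)[OF q(1)] prob_vecsD(1)[OF q(2)] .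
  have nonneg: "0 \<le> pad (e1 k) i" "0 \<le> pad (e2 k) i" for k i
    using pad_nonneg[OF E(1)] pad_nonneg[OF E(2)] by auto
  have lim: "(\<lambda>k. pad (f k) i) \<longlonglongrightarrow> v $ i"
    if "\<And>k. l1_dist v (f k) \<le> inverse (real (Suc k))" "i < dim_vec v" for f v i
  proof (rule metric_tendsto_imp_tendsto[OF LIMSEQ_inverse_real_of_nat])
    show "\<forall>\<^sub>F k in sequentially. dist (pad (f k) i) (v $ i) \<le> dist (inverse (real (Suc k))) 0"
      using order_trans[OF pad_close[OF that(2)] that(1)]
      by (simp add: dist_real_def abs_minus_commute)
  qed
  have lim1: "(\<lambda>k. pad (e1 k) i) \<longlonglongrightarrow> q1 $ i" and lim2: "(\<lambda>k. pad (e2 k) i) \<longlonglongrightarrow> q2 $ i" if "i < n" for i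
    using that dims by (auto intro!: lim d1 d2)
  have split: "vec_rsum (dim_vec (e1 k)) (e1 k) (e2 k) \<alpha>
      = rsum {..<n} (pad (e1 k)) (pad (e2 k)) \<alpha> + rsum {n..<max n (dim_vec (e1 k))} (pad (e1 k)) (pad (e2 k)) \<alpha>"
    "vec_rsum (dim_vec (e1 k)) (e2 k) (e1 k) \<alpha>
      = rsum {..<n} (pad (e2 k)) (pad (e1 k)) \<alpha> + rsum {n..<max n (dim_vec (e1 k))} (pad (e2 k)) (pad (e1 k)) \<alpha>"
    for k \<alpha>
    using E(3) by (auto intro!: rsum_pad)
  have lim_rsum: "(\<lambda>k. rsum {..<n} (pad (e1 k)) (pad (e2 k)) \<alpha>) \<longlonglongrightarrow> vec_rsum n q1 q2 \<alpha>"
    if "0 < \<alpha>" for \<alpha>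
    using that q(3) nonneg lim1 lim2 by (intro tendsto_rsum) force+
  have gt: "vec_rsum n q1 q2 \<alpha> \<le> vec_rsum n p1 p2 \<alpha>"
    if "1 < \<alpha>" for \<alpha>
  proof (rule LIMSEQ_le_const2[OF lim_rsum])
    have "rsum {..<n} (pad (e1 k)) (pad (e2 k)) \<alpha> \<le> vec_rsum n p1 p2 \<alpha>" for k
      using bound[of k] that split(1)[of k \<alpha>] rsum_nonneg[of "{n..<max n (dim_vec (e1 k))}" "pad (e1 k)" "pad (e2 k)" \<alpha>]
      unfolding divergence_bound_def by force
    then show "\<exists>N. \<forall>k\<ge>N. rsum {..<n} (pad (e1 k)) (pad (e2 k)) \<alpha> \<le> vec_rsum n p1 p2 \<alpha>"
      by blast
  qed (use that in simp)
  have lt: "vec_rsum n p1 p2 \<alpha> \<le> vec_rsum n q1 q2 \<alpha>"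
    if \<alpha>: "0 < \<alpha>" "\<alpha> < 1" for \<alpha>
  proof -
    \<comment> \<open>Below order 1 the tail counts against the claim; the tangent at ratio 1 bounds
      it by the tail masses, which are part of the distances.\<close>
    have tail: "rsum {n..<max n (dim_vec (e1 k))} (pad (e1 k)) (pad (e2 k)) \<alpha> \<le> inverse (real (Suc k))" for k
    proof -
      let ?K = "{n..<max n (dim_vec (e1 k))}"
      have "rsum ?K (pad (e1 k)) (pad (e2 k)) \<alpha> \<le> (\<Sum>i\<in>?K. (1 - \<alpha>) * pad (e2 k) i + \<alpha> * pad (e1 k) i)"
        unfolding rsum_def tangent_one[symmetric] using nonneg \<alpha> by (intro sum_mono le_tangent) auto
      also have "\<dots> = (1 - \<alpha>) * (\<Sum>i\<in>?K. pad (e2 k) i) + \<alpha> * (\<Sum>i\<in>?K. pad (e1 k) i)"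
        by (simp add: sum.distrib sum_distrib_left)
      also have "\<dots> \<le> (1 - \<alpha>) * inverse (real (Suc k)) + \<alpha> * inverse (real (Suc k))"
        using order_trans[OF pad_tail[OF E(1)[of k], of q1] d1] order_trans[OF pad_tail[OF E(2)[of k], of q2] d2] \<alpha>
        by (intro add_mono mult_left_mono) (simp_all add: dims E(3))
      also have "\<dots> = inverse (real (Suc k))" by (simp add: algebra_simps del: of_nat_Suc)
      finally show ?thesis .
    qed
    have "(\<lambda>k. rsum {..<n} (pad (e1 k)) (pad (e2 k)) \<alpha> + inverse (real (Suc k)))
        \<longlonglongrightarrow> vec_rsum n q1 q2 \<alpha> + 0"
      using \<alpha> by (intro tendsto_add lim_rsum LIMSEQ_inverse_real_of_nat)
    moreover have "vec_rsum n p1 p2 \<alpha>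
        \<le> rsum {..<n} (pad (e1 k)) (pad (e2 k)) \<alpha> + inverse (real (Suc k))" for k
    proof -
      have "vec_rsum n p1 p2 \<alpha> \<le> vec_rsum (dim_vec (e1 k)) (e1 k) (e2 k) \<alpha>"
        using bound[of k] \<alpha> unfolding divergence_bound_def by blast
      then show ?thesis using split(1)[of k \<alpha>] tail[of k] by linarith
    qed
    ultimately show ?thesis by (intro LIMSEQ_le_const[where X = "\<lambda>k. rsum {..<n} (pad (e1 k)) (pad (e2 k)) \<alpha> + inverse (real (Suc k))"]) auto
  qed
  have rev: "(\<forall>i<n. 0 < q1 $ i) \<and>
      (\<forall>\<alpha><0. vec_rsum n q1 q2 \<alpha> \<le> vec_rsum n p1 p2 \<alpha>)"
    if full: "\<forall>i<n. 0 < p1 $ i"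
  proof -
    have le: "rsum {..<n} (pad (e2 k)) (pad (e1 k)) \<alpha> \<le> vec_rsum n p2 p1 \<alpha>"
      if "1 < \<alpha>" for k \<alpha>
      using bound[of k] full that split(2)[of k \<alpha>] rsum_nonneg[of "{n..<max n (dim_vec (e1 k))}" "pad (e2 k)" "pad (e1 k)" \<alpha>]
      unfolding divergence_bound_def by force
    \<comment> \<open>At order 2 a single term bounds the square of an entry of \<open>e2 k\<close>
      by \<open>C\<close> times the entry of \<open>e1 k\<close>. In the limit \<open>q1\<close> is
      positive because \<open>q2\<close> is, and only then does the reversed sum converge.\<close>
    define C where "C = vec_rsum n p2 p1 2"
    have q1_pos: "0 < q1 $ i" if i: "i < n" for i
    proof -
      have "(pad (e2 k) i)\<^sup>2 \<le> C * pad (e1 k) i" for k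
      proof (cases "pad (e2 k) i = 0")
        case True
        then show ?thesis using nonneg(1)[of k i] by (simp add: C_def rsum_nonneg)
      next
        case False
        with nonneg(2)[of k i] have pos2: "0 < pad (e2 k) i" by simp
        then have ik: "i < dim_vec (e1 k)" "0 < e2 k $ i"
          by (simp_all add: pad_def E(3) split: if_splits)
        moreover have "\<forall>i<dim_vec (e1 k). 0 < e2 k $ i \<longrightarrow> 0 < e1 k $ i"
          using bound[of k] full unfolding divergence_bound_def by blast
        ultimately have "0 < pad (e1 k) i" by (simp add: pad_def)
        moreover have "pad (e2 k) i powr 2 * pad (e1 k) i powr (1 - 2) \<le> C"
        proof -
          have "pad (e2 k) i powr 2 * pad (e1 k) i powr (1 - 2) \<le> rsum {..<n} (pad (e2 k)) (pad (e1 k)) 2"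
            unfolding rsum_def using i by (intro member_le_sum) auto
          then show ?thesis using le[of 2 k] by (simp add: C_def)
        qed
        ultimately show ?thesis using pos2 by (simp add: powr_minus field_simps)
      qed
      moreover have "(\<lambda>k. (pad (e2 k) i)\<^sup>2) \<longlonglongrightarrow> (q2 $ i)\<^sup>2" "(\<lambda>k. C * pad (e1 k) i) \<longlonglongrightarrow> C * q1 $ i"
        using lim1[OF i] lim2[OF i] by (auto intro!: tendsto_intros)
      ultimately have "(q2 $ i)\<^sup>2 \<le> C * q1 $ i" by (intro LIMSEQ_le) auto
      then have "0 < C * q1 $ i" using q(3)[OF i] by (meson less_le_trans zero_less_power)
      then show ?thesis using prob_vecsD(2)[OF q(1) i] by (auto simp: zero_less_mult_iff)
    qed
    have "vec_rsum n q1 q2 \<alpha> \<le> vec_rsum n p1 p2 \<alpha>" if "\<alpha> < 0" for \<alpha>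
    proof -
      have "(\<lambda>k. rsum {..<n} (pad (e2 k)) (pad (e1 k)) (1 - \<alpha>)) \<longlonglongrightarrow> vec_rsum n q2 q1 (1 - \<alpha>)"
        using that q1_pos nonneg lim1 lim2 by (intro tendsto_rsum) force+
      then have "vec_rsum n q2 q1 (1 - \<alpha>) \<le> vec_rsum n p2 p1 (1 - \<alpha>)"
        using le that by (intro LIMSEQ_le_const2) auto
      then show ?thesis by (simp add: rsum_swap[of _ "vec_index p2"] rsum_swap[of _ "vec_index q2"])
    qed
    with q1_pos show ?thesis by blast
  qed
  show ?thesis unfolding divergence_order_def using gt lt rev by blast
qed

section \<open>The catalytic and asymptotic characterizations\<close>

lemma concat_vec_all:
  assumes "\<And>x i. x \<in> set xs \<Longrightarrow> i < dim_vec (f x) \<Longrightarrow> P (f x $ i)" "i < dim_vec (concat_vec (map f xs))"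
  shows "P (concat_vec (map f xs) $ i)"
  using assms
proof (induction xs arbitrary: i)
  case (Cons x xs)
  have "P (concat_vec (map f xs) $ j)" if "j < dim_vec (concat_vec (map f xs))" for j
    using Cons.IH[OF _ that] Cons.prems(1) by simp
  then show ?case using Cons.prems by (auto simp: concat_vec_def)
qed (simp add: concat_vec_def)

lemma kron_vec_all:
  assumes "\<And>a b. P a \<Longrightarrow> P b \<Longrightarrow> P (a * b)" "\<And>i. i < dim_vec v \<Longrightarrow> P (v $ i)" "\<And>i. i < dim_vec w \<Longrightarrow> P (w $ i)"
    and "k < dim_vec (v \<otimes>\<^sub>v w)"
  shows "P ((v \<otimes>\<^sub>v w) $ k)"
proof -
  have "0 < dim_vec w" using assms(4) by (cases "dim_vec w = 0") auto
  then show ?thesis using assms by (simp add: kron_vec_def less_mult_imp_div_less)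
qed

lemma telescope_nonneg:
  assumes "\<And>i. i < dim_vec q \<Longrightarrow> 0 \<le> q $ i" "\<And>i. i < dim_vec p \<Longrightarrow> 0 \<le> p $ i" "k < dim_vec (telescope_vec m q p)"
  shows "0 \<le> telescope_vec m q p $ k"
proof -
  let ?c = "concat_vec (map (\<lambda>l. kron_power q l \<otimes>\<^sub>v kron_power p (m - l)) [0..<Suc m])"
  have "0 \<le> ?c $ k"
    using assms
    by (intro concat_vec_all[of _ _ "\<lambda>x. 0 \<le> x"] kron_vec_all[of "\<lambda>x. 0 \<le> x"] kron_power_nonneg)
      (simp_all add: telescope_vec_def del: upt_Suc)
  then show ?thesis using assms(3) unfolding telescope_vec_def by (simp del: upt_Suc)
qed

lemma telescope_pos:
  assumes "\<And>i. i < dim_vec q \<Longrightarrow> 0 < q $ i" "\<And>i. i < dim_vec p \<Longrightarrow> 0 < p $ i" "k < dim_vec (telescope_vec m q p)"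
  shows "0 < telescope_vec m q p $ k"
proof -
  let ?c = "concat_vec (map (\<lambda>l. kron_power q l \<otimes>\<^sub>v kron_power p (m - l)) [0..<Suc m])"
  have "0 < ?c $ k"
    using assms
    by (intro concat_vec_all[of _ _ "\<lambda>x. 0 < x"] kron_vec_all[of "\<lambda>x. 0 < x"] kron_power_pos)
      (simp_all add: telescope_vec_def del: upt_Suc)
  then show ?thesis using assms(3) unfolding telescope_vec_def by (simp del: upt_Suc)
qed

lemma telescope_prob:
  assumes q: "q \<in> prob_vecs n" and p: "p \<in> prob_vecs n"
  shows "telescope_vec m q p \<in> prob_vecs (dim_vec (telescope_vec m q p))"
proof -
  note Q = prob_vecsD[OF q] and P = prob_vecsD[OF p]
  have "pairsum (\<lambda>x y. x) (telescope_vec m q p) (telescope_vec m q p) = (\<Sum>l\<le>m. 1 / (real m + 1))"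
  proof (subst pairsum_telescope[OF refl refl], rule sum.cong)
    fix l
    have "pairsum (\<lambda>a b. pairsum (\<lambda>c d. 1 / (real m + 1) * (a * c)) (kron_power p (m - l)) (kron_power p (m - l)))
        (kron_power q l) (kron_power q l)
      = 1 / (real m + 1) * ((\<Sum>i<n ^ l. kron_power q l $ i) * (\<Sum>i<n ^ (m - l). kron_power p (m - l) $ i))"
      unfolding pairsum_def sum_product using Q(1) P(1) by (simp add: sum_distrib_left)
    then show "pairsum (\<lambda>a b. pairsum (\<lambda>c d. 1 / (real m + 1) * (a * c)) (kron_power p (m - l)) (kron_power p (m - l)))
        (kron_power q l) (kron_power q l) = 1 / (real m + 1)"
      using sum_kron_power[of q l] sum_kron_power[of p "m - l"] Q P by simp
  qed simp
  then have "(\<Sum>i<dim_vec (telescope_vec m q p). telescope_vec m q p $ i) = 1"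
    by (simp add: pairsum_def)
  moreover have "0 \<le> telescope_vec m q p $ i" if "i < dim_vec (telescope_vec m q p)" for i
    using that Q P by (intro telescope_nonneg) auto
  ultimately show ?thesis unfolding prob_vecs_def by (intro CollectI conjI carrier_vec_dim_vec) blast+
qed

lemma kron_vec_sum: "(\<Sum>k<dim_vec (v \<otimes>\<^sub>v w). (v \<otimes>\<^sub>v w) $ k) = (\<Sum>i<dim_vec v. v $ i) * (\<Sum>j<dim_vec w. w $ j)"
  using pairsum_kron_mult[of v v w w "\<lambda>x y. x"] by (simp add: pairsum_def)

lemma max_scale:
  fixes c :: real
  assumes "0 < c"
  shows "max 0 (c * x - t * (c * y)) = c * max 0 (x - t * y)"
proof -
  have "c * x - t * (c * y) = c * (x - t * y)" by (simp add: algebra_simps)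
  then show ?thesis using assms by (simp add: max_def zero_le_mult_iff)
qed

section \<open>The telescope as catalyst for the mixed target\<close>

context dichotomy_mixture
begin

lemma n_pos: "0 < n"
  using P1(3) by (cases n) auto

lemma majorizes_power:
  assumes "\<And>t. pairsum (\<lambda>x y. max 0 (x - t * y)) (kron_power e1 m) (kron_power q2 m)
    \<le> pairsum (\<lambda>x y. max 0 (x - t * y)) (kron_power p1 m) (kron_power p2 m)"
  shows "majorizes (kron_power p1 m) (kron_power p2 m) (kron_power e1 m) (kron_power q2 m)"
proof (rule majorizesI)
  have sums: "(\<Sum>j<n ^ m. kron_power v m $ j) = 1" if "v \<in> prob_vecs n" for v
    using sum_kron_power[of v m] prob_vecsD[OF that] by simp
  show "(\<Sum>i<dim_vec (kron_power e1 m). kron_power e1 m $ i) = (\<Sum>j<dim_vec (kron_power p1 m). kron_power p1 m $ j)"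
    "(\<Sum>i<dim_vec (kron_power q2 m). kron_power q2 m $ i) = (\<Sum>j<dim_vec (kron_power p2 m). kron_power p2 m $ j)"
    using sums[OF e1_prob] sums[OF p1] sums[OF p2] sums[OF q2] by (simp_all add: P1 P2 Q2)
  show "0 < kron_power p2 m $ j" if "j < dim_vec (kron_power p2 m)" for j
    using that P2 p2_pos by (intro kron_power_pos) auto
  show "0 < kron_power q2 m $ j" if "j < dim_vec (kron_power q2 m)" for j
    using that Q2 q2_pos by (intro kron_power_pos) auto
qed (use assms n_pos P1 P2 Q2 in simp_all)

text \<open>The hinge is positively homogeneous, so the normalisation of the telescope factors out
  and the comparison of the two end blocks is \<open>hinge\<close> at power \<open>Suc m\<close>.
  Positivity of \<open>q2\<close> and \<open>p2\<close> makes \<open>r2\<close> strictly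
  positive.\<close>

lemma telescope_catalyst:
  assumes hinge: "\<And>t. pairsum (\<lambda>x y. max 0 (x - t * y)) (kron_power e1 (Suc m)) (kron_power q2 (Suc m))
    \<le> pairsum (\<lambda>x y. max 0 (x - t * y)) (kron_power p1 (Suc m)) (kron_power p2 (Suc m))"
  defines "r1 \<equiv> telescope_vec m e1 p1" and "r2 \<equiv> telescope_vec m q2 p2"
  shows "dichotomy r1 r2" "majorizes (r1 \<otimes>\<^sub>v p1) (r2 \<otimes>\<^sub>v p2) (r1 \<otimes>\<^sub>v e1) (r2 \<otimes>\<^sub>v q2)"
proof -
  have dims: "dim_vec r1 = dim_vec r2" by (simp add: r1_def r2_def dim_telescope_vec P1 P2 Q2)
  have r1: "r1 \<in> prob_vecs (dim_vec r1)" unfolding r1_def using e1_prob p1 by (rule telescope_prob)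
  have r2: "r2 \<in> prob_vecs (dim_vec r1)" unfolding dims unfolding r2_def using q2 p2 by (rule telescope_prob)
  have r2_pos: "0 < r2 $ i" if "i < dim_vec r2" for i
    using that Q2 q2_pos P2 p2_pos unfolding r2_def by (intro telescope_pos) auto
  then have "supp_vec r1 \<subseteq> supp_vec r2" using dims by (force simp: supp_vec_def)
  with r1 r2 show "dichotomy r1 r2" by (auto simp: dichotomy_def)
  have r_dim: "0 < dim_vec r1" using prob_vecs_support[OF r1] by (metis gr_zeroI not_less_zero)
  show "majorizes (r1 \<otimes>\<^sub>v p1) (r2 \<otimes>\<^sub>v p2) (r1 \<otimes>\<^sub>v e1) (r2 \<otimes>\<^sub>v q2)"
  proof (rule majorizesI)
    show "0 < (r2 \<otimes>\<^sub>v p2) $ j" if "j < dim_vec (r2 \<otimes>\<^sub>v p2)" for j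
      using that r2_pos P2 p2_pos by (intro kron_vec_all[of "\<lambda>x. 0 < x"]) auto
    show "0 < (r2 \<otimes>\<^sub>v q2) $ j" if "j < dim_vec (r2 \<otimes>\<^sub>v q2)" for j
      using that r2_pos Q2 q2_pos by (intro kron_vec_all[of "\<lambda>x. 0 < x"]) auto
    show "(\<Sum>i<dim_vec (r1 \<otimes>\<^sub>v e1). (r1 \<otimes>\<^sub>v e1) $ i) = (\<Sum>i<dim_vec (r1 \<otimes>\<^sub>v p1). (r1 \<otimes>\<^sub>v p1) $ i)"
      "(\<Sum>i<dim_vec (r2 \<otimes>\<^sub>v q2). (r2 \<otimes>\<^sub>v q2) $ i) = (\<Sum>i<dim_vec (r2 \<otimes>\<^sub>v p2). (r2 \<otimes>\<^sub>v p2) $ i)"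
      using prob_vecsD(3)[OF e1_prob] unfolding kron_vec_sum by (simp_all add: P1 P2 Q2)
    show "pairsum (\<lambda>x y. max 0 (x - t * y)) (r1 \<otimes>\<^sub>v e1) (r2 \<otimes>\<^sub>v q2)
        \<le> pairsum (\<lambda>x y. max 0 (x - t * y)) (r1 \<otimes>\<^sub>v p1) (r2 \<otimes>\<^sub>v p2)" for t
      unfolding r1_def r2_def
    proof (rule pairsum_telescope_le)
      let ?c = "1 / (real m + 1)"
      have "max 0 (?c * x - t * (?c * y)) = ?c * max 0 (x - t * y)" for x y
        by (rule max_scale) simp
      then have scale: "pairsum (\<lambda>x y. max 0 (?c * x - t * (?c * y))) v w = ?c * pairsum (\<lambda>x y. max 0 (x - t * y)) v w" for v w
        by (simp only: pairsum_def sum_distrib_left)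
      show "pairsum (\<lambda>x y. max 0 (?c * x - t * (?c * y))) (kron_power e1 (Suc m)) (kron_power q2 (Suc m))
          \<le> pairsum (\<lambda>x y. max 0 (?c * x - t * (?c * y))) (kron_power p1 (Suc m)) (kron_power p2 (Suc m))"
        unfolding scale by (intro mult_left_mono hinge) simp
    qed (simp_all add: P1 P2 Q2)
  qed (use dims r_dim n_pos P1 P2 Q2 in simp_all)
qed

lemma l1_dist_e1: "l1_dist q1 e1 \<le> 2 * \<delta>"
proof -
  have "l1_dist q1 e1 = (\<Sum>i<n. \<bar>q1 $ i - e1 $ i\<bar>)" by (simp add: l1_dist_def Q1(1))
  also have "\<dots> \<le> (\<Sum>i<n. \<delta> * (q1 $ i + q2 $ i))"
  proof (rule sum_mono)
    fix i assume "i \<in> {..<n}"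
    then have i: "i < n" by simp
    have "q1 $ i - e1 $ i = \<delta> * (q1 $ i - q2 $ i)" by (simp add: e1_index[OF i] algebra_simps)
    then have "\<bar>q1 $ i - e1 $ i\<bar> = \<delta> * \<bar>q1 $ i - q2 $ i\<bar>" using \<delta> by (simp add: abs_mult)
    also have "\<dots> \<le> \<delta> * (q1 $ i + q2 $ i)" using \<delta> Q1(2)[OF i] Q2(2)[OF i] by (intro mult_left_mono) auto
    finally show "\<bar>q1 $ i - e1 $ i\<bar> \<le> \<delta> * (q1 $ i + q2 $ i)" .
  qed
  also have "\<dots> = 2 * \<delta>" by (simp add: sum.distrib Q1(3) Q2(3) flip: sum_distrib_left)
  finally show ?thesis .
qed

end

lemma l1_dist_self [simp]: "l1_dist v v = 0"
  by (simp add: l1_dist_def)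

theorem corollary28:
  fixes n :: nat and p1 p2 q1 q2 :: "real vec"
  assumes "p1 \<in> prob_vecs n" and "p2 \<in> prob_vecs n"
    and "q1 \<in> prob_vecs n" and "q2 \<in> prob_vecs n"
    and "supp_vec p2 = {..<n}" and "supp_vec q2 = {..<n}"
    and "p1 \<noteq> p2"
  shows
    "(renyi_dominates p1 p2 q1 q2 \<longleftrightarrow>
       (\<forall>\<epsilon>>0. \<exists>e1 e2 r1 r2. dichotomy e1 e2 \<and> dichotomy r1 r2 \<and>
          l1_dist q1 e1 \<le> \<epsilon> \<and> l1_dist q2 e2 \<le> \<epsilon> \<and>
          majorizes (r1 \<otimes>\<^sub>v p1) (r2 \<otimes>\<^sub>v p2) (r1 \<otimes>\<^sub>v e1) (r2 \<otimes>\<^sub>v e2)))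
     \<and>
     (renyi_dominates p1 p2 q1 q2 \<longleftrightarrow>
       (\<forall>\<epsilon>>0. \<exists>e1 e2. dichotomy e1 e2 \<and>
          l1_dist q1 e1 \<le> \<epsilon> \<and> l1_dist q2 e2 \<le> \<epsilon> \<and>
          (\<forall>\<^sub>F m in sequentially. \<exists>r1 r2.
             r1 = telescope_vec m e1 p1 \<and> r2 = telescope_vec m e2 p2 \<and> dichotomy r1 r2 \<and>
             majorizes (r1 \<otimes>\<^sub>v p1) (r2 \<otimes>\<^sub>v p2) (r1 \<otimes>\<^sub>v e1) (r2 \<otimes>\<^sub>v e2))))
     \<and>
     (renyi_dominates p1 p2 q1 q2 \<longleftrightarrow>
       (\<forall>\<epsilon>>0. \<exists>e1 e2. dichotomy e1 e2 \<and> e2 = q2 \<and>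
          l1_dist q1 e1 \<le> \<epsilon> \<and> l1_dist q2 e2 \<le> \<epsilon> \<and>
          (\<forall>\<^sub>F m in sequentially. \<exists>r1 r2.
             r1 = telescope_vec m e1 p1 \<and> r2 = telescope_vec m e2 p2 \<and> dichotomy r1 r2 \<and>
             majorizes (r1 \<otimes>\<^sub>v p1) (r2 \<otimes>\<^sub>v p2) (r1 \<otimes>\<^sub>v e1) (r2 \<otimes>\<^sub>v e2))))
     \<and>
     (renyi_dominates p1 p2 q1 q2 \<longleftrightarrow>
       (\<forall>\<epsilon>>0. \<exists>e1 \<in> prob_vecs n. \<exists>e2 \<in> prob_vecs n. dichotomy e1 e2 \<and>
          l1_dist q1 e1 \<le> \<epsilon> \<and> l1_dist q2 e2 \<le> \<epsilon> \<and>
          (\<forall>\<^sub>F m in sequentially.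
             majorizes (kron_power p1 m) (kron_power p2 m) (kron_power e1 m) (kron_power e2 m))))
     \<and>
     (renyi_dominates p1 p2 q1 q2 \<longleftrightarrow>
       (\<forall>\<epsilon>>0. \<exists>e1 \<in> prob_vecs n. \<exists>e2 \<in> prob_vecs n. dichotomy e1 e2 \<and> e2 = q2 \<and>
          l1_dist q1 e1 \<le> \<epsilon> \<and> l1_dist q2 e2 \<le> \<epsilon> \<and>
          (\<forall>\<^sub>F m in sequentially.
             majorizes (kron_power p1 m) (kron_power p2 m) (kron_power e1 m) (kron_power e2 m))))"
proof -
  have p2_pos: "0 < p2 $ i" and q2_pos: "0 < q2 $ i" if "i < n" for i
    using assms(5,6) that by (auto simp: supp_prob[OF assms(2)] supp_prob[OF assms(4)])
  have supp: "dichotomy e q2" if "e \<in> prob_vecs n" for e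
    using that assms(4,6) prob_vecsD(1)[OF that] by (auto simp: dichotomy_def supp_vec_def)
  let ?D = "renyi_dominates p1 p2 q1 q2"
  let ?maj = "\<lambda>m e1 e2. majorizes (kron_power p1 m) (kron_power p2 m) (kron_power e1 m) (kron_power e2 m)"
  let ?cat = "\<lambda>r1 r2 e1 e2. majorizes (r1 \<otimes>\<^sub>v p1) (r2 \<otimes>\<^sub>v p2) (r1 \<otimes>\<^sub>v e1) (r2 \<otimes>\<^sub>v e2)"
  let ?tel = "\<lambda>m e1 e2. \<exists>r1 r2. r1 = telescope_vec m e1 p1 \<and> r2 = telescope_vec m e2 p2 \<and> dichotomy r1 r2 \<and> ?cat r1 r2 e1 e2"
  let ?near = "\<lambda>\<epsilon> e1 e2. l1_dist q1 e1 \<le> \<epsilon> \<and> l1_dist q2 e2 \<le> \<epsilon>"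
  \<comment> \<open>Names for the five right-hand sides. Domination implies the strongest forms
    \<open>c3\<close> and \<open>c5\<close>; \<open>c3\<close> gives \<open>c2\<close>, which gives
    \<open>c1\<close>, and \<open>c5\<close> gives \<open>c4\<close>; both \<open>c1\<close> and
    \<open>c4\<close> lead back to domination.\<close>
  define c1 where "c1 \<longleftrightarrow> (\<forall>\<epsilon>>0. \<exists>e1 e2 r1 r2. dichotomy e1 e2 \<and> dichotomy r1 r2 \<and>
    l1_dist q1 e1 \<le> \<epsilon> \<and> l1_dist q2 e2 \<le> \<epsilon> \<and> ?cat r1 r2 e1 e2)"
  define c2 where "c2 \<longleftrightarrow> (\<forall>\<epsilon>>0. \<exists>e1 e2. dichotomy e1 e2 \<and>
    l1_dist q1 e1 \<le> \<epsilon> \<and> l1_dist q2 e2 \<le> \<epsilon> \<and> (\<forall>\<^sub>F m in sequentially. ?tel m e1 e2))"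
  define c3 where "c3 \<longleftrightarrow> (\<forall>\<epsilon>>0. \<exists>e1 e2. dichotomy e1 e2 \<and> e2 = q2 \<and>
    l1_dist q1 e1 \<le> \<epsilon> \<and> l1_dist q2 e2 \<le> \<epsilon> \<and> (\<forall>\<^sub>F m in sequentially. ?tel m e1 e2))"
  define c4 where "c4 \<longleftrightarrow> (\<forall>\<epsilon>>0. \<exists>e1\<in>prob_vecs n. \<exists>e2\<in>prob_vecs n. dichotomy e1 e2 \<and>
    l1_dist q1 e1 \<le> \<epsilon> \<and> l1_dist q2 e2 \<le> \<epsilon> \<and> (\<forall>\<^sub>F m in sequentially. ?maj m e1 e2))"
  define c5 where "c5 \<longleftrightarrow> (\<forall>\<epsilon>>0. \<exists>e1\<in>prob_vecs n. \<exists>e2\<in>prob_vecs n. dichotomy e1 e2 \<and> e2 = q2 \<and>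
    l1_dist q1 e1 \<le> \<epsilon> \<and> l1_dist q2 e2 \<le> \<epsilon> \<and> (\<forall>\<^sub>F m in sequentially. ?maj m e1 e2))"
  have forward: "\<exists>e1\<in>prob_vecs n. l1_dist q1 e1 \<le> \<epsilon> \<and> (\<forall>\<^sub>F m in sequentially. ?maj m e1 q2) \<and>
      (\<forall>\<^sub>F m in sequentially. ?tel m e1 q2)" if dom: ?D and "0 < \<epsilon>" for \<epsilon>
  proof -
    \<comment> \<open>Mixing moves \<open>q1\<close> by at most 2 \<delta>, hence half of
      \<epsilon>; the cap 1/2 keeps \<delta> below 1.\<close>
    define \<delta> where "\<delta> = min (1 / 2) (\<epsilon> / 2)"
    have small: "0 < \<delta>" "\<delta> < 1" "2 * \<delta> \<le> \<epsilon>" using \<open>0 < \<epsilon>\<close> by (auto simp: \<delta>_def)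
    interpret dichotomy_mixture n p1 p2 q1 q2 \<delta>
      using assms(1-4,7) p2_pos q2_pos small by unfold_locales auto
    have ev: "\<forall>\<^sub>F m in sequentially. \<forall>t.
        pairsum (\<lambda>x y. max 0 (x - t * y)) (kron_power e1 m) (kron_power q2 m)
        \<le> pairsum (\<lambda>x y. max 0 (x - t * y)) (kron_power p1 m) (kron_power p2 m)"
    proof (rule eventually_majorizes)
      show "divergence_order n p1 p2 q1 q2" by (rule renyi_dominates_orders(1)[OF assms(1-4) p2_pos q2_pos dom])
      show "entropy_order n p1 p2 q1 q2" by (rule renyi_dominates_orders(2)[OF assms(1-4) p2_pos q2_pos dom])
      show "max_ratio_order n p1 p2 q1 q2" by (rule renyi_dominates_orders(3)[OF assms(1-4) p2_pos q2_pos dom])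
      show "entropy_order n p2 p1 q2 q1 \<and> max_ratio_order n p2 p1 q2 q1" if "\<forall>i<n. 0 < p1 $ i"
        by (rule renyi_dominates_orders(4)[OF assms(1-4) p2_pos q2_pos dom that])
    qed
    have "\<forall>\<^sub>F m in sequentially. ?maj m e1 q2"
      using ev by eventually_elim (rule majorizes_power, blast)
    moreover have "\<forall>\<^sub>F m in sequentially. ?tel m e1 q2"
      \<comment> \<open>The telescope of index \<open>m\<close> rests on the comparison of the
        powers \<open>m + 1\<close>, so the eventual statement is shifted by one.\<close>
      using ev[folded eventually_sequentially_Suc[where P = "\<lambda>m. \<forall>t.
        pairsum (\<lambda>x y. max 0 (x - t * y)) (kron_power e1 m) (kron_power q2 m)
        \<le> pairsum (\<lambda>x y. max 0 (x - t * y)) (kron_power p1 m) (kron_power p2 m)"]]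
    proof eventually_elim
      case (elim m)
      then show ?case using telescope_catalyst[of m] by blast
    qed
    ultimately show ?thesis using e1_prob l1_dist_e1 small(3) by (intro bexI[of _ e1]) auto
  qed
  have D3: c3 if dom: ?D
    unfolding c3_def
  proof (intro allI impI)
    fix \<epsilon> :: real assume "0 < \<epsilon>"
    then obtain e1 where "e1 \<in> prob_vecs n" "l1_dist q1 e1 \<le> \<epsilon>" "\<forall>\<^sub>F m in sequentially. ?tel m e1 q2"
      using forward[OF dom] by blast
    then show "\<exists>e1 e2. dichotomy e1 e2 \<and> e2 = q2 \<and> l1_dist q1 e1 \<le> \<epsilon> \<and> l1_dist q2 e2 \<le> \<epsilon> \<and>
        (\<forall>\<^sub>F m in sequentially. ?tel m e1 e2)"
      using supp \<open>0 < \<epsilon>\<close> by (intro exI[of _ e1] exI[of _ q2]) simp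
  qed
  have D5: c5 if dom: ?D
    unfolding c5_def
  proof (intro allI impI)
    fix \<epsilon> :: real assume "0 < \<epsilon>"
    then obtain e1 where "e1 \<in> prob_vecs n" "l1_dist q1 e1 \<le> \<epsilon>" "\<forall>\<^sub>F m in sequentially. ?maj m e1 q2"
      using forward[OF dom] by blast
    then show "\<exists>e1\<in>prob_vecs n. \<exists>e2\<in>prob_vecs n. dichotomy e1 e2 \<and> e2 = q2 \<and>
        l1_dist q1 e1 \<le> \<epsilon> \<and> l1_dist q2 e2 \<le> \<epsilon> \<and> (\<forall>\<^sub>F m in sequentially. ?maj m e1 e2)"
      using supp \<open>0 < \<epsilon>\<close> assms(4) by (intro bexI[of _ e1] bexI[of _ q2]) simp_all
  qed
  have backward: ?D if "\<And>\<epsilon>. 0 < \<epsilon> \<Longrightarrow> \<exists>e1 e2. dichotomy e1 e2 \<and> l1_dist q1 e1 \<le> \<epsilon> \<and> l1_dist q2 e2 \<le> \<epsilon> \<and>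
      divergence_bound n p1 p2 e1 e2"
    by (rule divergence_order_renyi_dominates[OF assms(1-4) p2_pos q2_pos
        divergence_order_limit[OF assms(3,4) q2_pos that]])
  have 1: ?D if c1: c1
  proof (rule backward)
    fix \<epsilon> :: real assume "0 < \<epsilon>"
    from c1[unfolded c1_def, rule_format, OF this]
    obtain e1 e2 r1 r2 where e: "dichotomy e1 e2" "l1_dist q1 e1 \<le> \<epsilon>" "l1_dist q2 e2 \<le> \<epsilon>"
      and r: "dichotomy r1 r2" "?cat r1 r2 e1 e2" by (elim exE conjE) (rule that)
    have "divergence_bound n p1 p2 e1 e2"
      by (rule divergence_bound_catalyst[OF assms(1,2) p2_pos e(1) r])
    with e show "\<exists>e1 e2. dichotomy e1 e2 \<and> l1_dist q1 e1 \<le> \<epsilon> \<and> l1_dist q2 e2 \<le> \<epsilon> \<and>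
      divergence_bound n p1 p2 e1 e2" by blast
  qed
  have 4: ?D if c4: c4
  proof (rule backward)
    fix \<epsilon> :: real assume "0 < \<epsilon>"
    from c4[unfolded c4_def, rule_format, OF this]
    obtain e1 e2 where e: "dichotomy e1 e2" "l1_dist q1 e1 \<le> \<epsilon>" "l1_dist q2 e2 \<le> \<epsilon>"
      and ev: "\<forall>\<^sub>F m in sequentially. ?maj m e1 e2" by (elim bexE conjE) (rule that)
    \<comment> \<open>The power 0 of every vector is the same one-entry vector and carries no
      information, so a positive exponent is selected.\<close>
    from eventually_happens'[OF sequentially_bot eventually_conj[OF ev eventually_gt_at_top[of 0]]]
    obtain m where "?maj m e1 e2" "0 < m" by blast
    then have "divergence_bound n p1 p2 e1 e2"
      by (intro divergence_bound_power[OF assms(1,2) p2_pos e(1)])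
    with e show "\<exists>e1 e2. dichotomy e1 e2 \<and> l1_dist q1 e1 \<le> \<epsilon> \<and> l1_dist q2 e2 \<le> \<epsilon> \<and>
      divergence_bound n p1 p2 e1 e2" by blast
  qed
  have 32: "c3 \<Longrightarrow> c2" unfolding c2_def c3_def by (elim all_forward imp_forward) blast+
  have 54: "c5 \<Longrightarrow> c4" unfolding c4_def c5_def by (elim all_forward imp_forward) blast+
  have 21: c1 if c2: c2
    unfolding c1_def
  proof (intro allI impI)
    fix \<epsilon> :: real assume "0 < \<epsilon>"
    from c2[unfolded c2_def, rule_format, OF this]
    obtain e1 e2 where e: "dichotomy e1 e2" "l1_dist q1 e1 \<le> \<epsilon>" "l1_dist q2 e2 \<le> \<epsilon>"
      and ev: "\<forall>\<^sub>F m in sequentially. ?tel m e1 e2" by (elim exE conjE) (rule that)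
    from eventually_happens'[OF sequentially_bot ev] obtain m where "?tel m e1 e2" ..
    with e show "\<exists>e1 e2 r1 r2. dichotomy e1 e2 \<and> dichotomy r1 r2 \<and>
        l1_dist q1 e1 \<le> \<epsilon> \<and> l1_dist q2 e2 \<le> \<epsilon> \<and> ?cat r1 r2 e1 e2" by blast
  qed
  show ?thesis
    unfolding c1_def[symmetric] c2_def[symmetric] c3_def[symmetric] c4_def[symmetric] c5_def[symmetric]
    using D3 D5 1 4 32 54 21 by blast
qed

end
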